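(* There is a constant $R=R(q)>0$ such that for every multiple eigenvalue $\lambda_0$ of $L_0$ with $|\lambda_0|>R$ the following statements are equivalent: (a) $\lambda_0$ is an ESS of $L$. (b) $\lambda_0$ is a spectral singularity of $L$. (c) The geometric multiplicity of the eigenvalue $\lambda_0$ of $L_0$ is $1$, that is, there exist one eigenfunction and one associated function corresponding to $\lambda_0$. (d) $\lambda_0$ is neither a Dirichlet nor a Neumann eigenvalue, that is, $\varphi(1,\lambda_0)\ne0$ and $\theta'(1,\lambda_0)\neq0$. The same holds with $L_0$ replaced by $L_\pi$.
   Context: Let $q:\mathbb R\to\mathbb C$ be $1$-periodic, Lebesgue integrable on $[0,1]$, with $\int_0^1 q=0$. $L=L(q)$ is the operator in $L_2(-\infty,\infty)$ generated by $l(y)=-y''+qy$. For $t\in\mathbb C$ (taken mod $2\pi$), $L_t$ is the operator in $L_2[0,1]$ generated by $l$ and $y(1)=e^{it}y(0)$, $y'(1)=e^{it}y'(0)$; $\sigma(L)=\bigcup_{t\in(-\pi,\pi]}\sigma(L_t)$. $\theta(x,\lambda),\varphi(x,\lambda)$ are the solutions of $l(y)=\lambda y$ with $\theta(0,\lambda)=\varphi'(0,\lambda)=1$, $\theta'(0,\lambda)=\varphi(0,\lambda)=0$, and $F(\lambda)=\varphi'(1,\lambda)+\theta(1,\lambda)$. The eigenvalues of $L_t$ are the roots of $F(\lambda)=2\cos t$; multiplicity of an eigenvalue means its multiplicity as a root. For real $t$ the eigenvalues, counted with multiplicity, are numbered $\lambda_n(t)$, $n\in\mathbb Z$, so that each $\lambda_n$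 is continuous on $[0,\pi]$ (known to be possible); extend by $\lambda_n(-t)=\lambda_n(t)$ and $2\pi$-periodicity. $A_n$ is the (finite) set of $t\in(-\pi,\pi]$ for which $\lambda_n(t)$ is a multiple eigenvalue of $L_t$. $\Psi_{n,t}$ is an eigenfunction of $L_t$ for $\lambda_n(t)$ and $\Psi^*_{n,t}$ an eigenfunction of $L_t^*$ for $\overline{\lambda_n(t)}$, both normalized in $L_2[0,1]$ and extended to $\mathbb R$ by multiplication by $e^{it}$ under $x\mapsto x+1$; $\alpha_n(t)=(\Psi_{n,t},\Psi^*_{n,t})$ (inner product of $L_2[0,1]$). Regular spectral arc: a closed arc $\gamma=\{\lambda(t):t\in[\alpha,\beta]\}$ with $\lambda$ analytic in a neighbourhood of the real interval $[\alpha,\beta]$, $F(\lambda(t))=2\cos t$ and $F'(\lambda(t))\ne0$ on $[\alpha,\beta]$, $\lambda'(t)\neq0$ on $(\alpha,\beta)$. For a regular spectral arc $\gamma\subset\{\lambda_n(t):t\in[0,\pi]\}$, with $\delta=\{t\in(-\pi,\pi]:\lambda_n(t)\in\gamma\}$, the projection is $P(\gamma)f=\frac1{2\pi}\int_\delta\frac1{\alpha_n(t)}(f,\Psi^*_{n,t})_{L_2(\mathbb R)}\Psi_{n,t}\,dt$, and $\|P(\gamma)\|=\sup_{t\in\delta}|\alpha_n(t)|^{-1}$. Spectral singularity: $\lambda\in\sigma(L)$ such that for all $\varepsilon>0$ there is a sequence of regular spectral arcs $\gamma_n\subset\{z:|z-\lambda|<\varepsilon\}$ with $\|P(\gamma_n)\|\to\infty$.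 Essential spectral singularity (ESS): $\lambda_0\in\sigma(L_{\pm t_0})$ for which there is $n\in\mathbb Z$ with $\lambda_0=\lambda_n(t_0)$ such that for each $\varepsilon>0$ the function $1/\alpha_n$ is not integrable on $\big((t_0-\varepsilon,t_0+\varepsilon)\cup(-t_0-\varepsilon,-t_0+\varepsilon)\big)\setminus A_n$. An associated function for $\lambda_0$ is a $\phi$ in the domain of $L_0$ (resp. $L_\pi$) with $(L_0-\lambda_0)\phi=\Psi$ (resp. with $L_\pi$), $\Psi$ an eigenfunction for $\lambda_0$. Dirichlet eigenvalues are the eigenvalues of $l$ on $[0,1]$ with $y(0)=y(1)=0$; Neumann eigenvalues those with $y'(0)=y'(1)=0$. *)

theory Defs
  imports "HOL-Complex_Analysis.Complex_Analysis" "HOL-Library.Function_Algebras"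
begin

section \<open>The differential expression \<open>l(y) = - y'' + q y\<close>\<close>

text \<open>
  \<open>hill_expr q a b y f\<close>: on \<open>[a, b]\<close> the function \<open>y\<close> is differentiable, its derivative
  \<open>y1\<close> is absolutely continuous with almost-everywhere derivative \<open>y2\<close>, and
  \<open>- y'' + q y = f\<close> almost everywhere. Absolute continuity of \<open>y1\<close> is expressed by \<open>y1\<close>
  being an indefinite integral of a Lebesgue integrable function.
\<close>

definition hill_expr ::
    "(real \<Rightarrow> complex) \<Rightarrow> real \<Rightarrow> real \<Rightarrow> (real \<Rightarrow> complex) \<Rightarrow> (real \<Rightarrow> complex) \<Rightarrow> bool" where
  "hill_expr q a b y f \<longleftrightarrow>
     (\<exists>y1 y2. (\<forall>x\<in>{a..b}. (y has_vector_derivative y1 x) (at x within {a..b})) \<and>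
              y2 absolutely_integrable_on {a..b} \<and>
              (\<forall>x\<in>{a..b}. y1 x = y1 a + integral {a..x} y2) \<and>
              (AE x in lebesgue_on {a..b}. f x = - y2 x + q x * y x))"

definition hill_solution :: "(real \<Rightarrow> complex) \<Rightarrow> complex \<Rightarrow> (real \<Rightarrow> complex) \<Rightarrow> bool" where
  "hill_solution q \<mu> y \<longleftrightarrow> (\<forall>a b. a < b \<longrightarrow> hill_expr q a b y (\<lambda>x. \<mu> * y x))"

definition theta :: "(real \<Rightarrow> complex) \<Rightarrow> complex \<Rightarrow> real \<Rightarrow> complex" where
  "theta q \<mu> = (THE y. hill_solution q \<mu> y \<and> y 0 = 1 \<and> vector_derivative y (at 0) = 0)"

definition phi :: "(real \<Rightarrow> complex) \<Rightarrow> complex \<Rightarrow> real \<Rightarrow> complex" where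
  "phi q \<mu> = (THE y. hill_solution q \<mu> y \<and> y 0 = 0 \<and> vector_derivative y (at 0) = 1)"

definition hill_discriminant :: "(real \<Rightarrow> complex) \<Rightarrow> complex \<Rightarrow> complex" where
  "hill_discriminant q \<mu> = vector_derivative (phi q \<mu>) (at 1) + theta q \<mu> 1"


section \<open>The space \<open>L\<^sub>2[0,1]\<close>\<close>

text \<open>
  Elements of \<open>L\<^sub>2[0,1]\<close> are represented by functions on the real line of which only the values
  on \<open>[0, 1]\<close> matter.
\<close>

definition L2_01 :: "(real \<Rightarrow> complex) \<Rightarrow> bool" where
  "L2_01 f \<longleftrightarrow> f \<in> borel_measurable (lebesgue_on {0..1}) \<and>
                (\<lambda>x. (norm (f x))\<^sup>2) absolutely_integrable_on {0..1}"

definition L2_inner :: "(real \<Rightarrow> complex) \<Rightarrow> (real \<Rightarrow> complex) \<Rightarrow> complex" where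
  "L2_inner f g = integral {0..1} (\<lambda>x. f x * cnj (g x))"

definition L2_norm :: "(real \<Rightarrow> complex) \<Rightarrow> real" where
  "L2_norm f = sqrt (integral {0..1} (\<lambda>x. (norm (f x))\<^sup>2))"


section \<open>The operators \<open>L\<^sub>t\<close>\<close>

text \<open>
  \<open>Lt_op q t y f\<close> says that \<open>(y, f)\<close> is in the graph of \<open>L\<^sub>t\<close>, where \<open>y\<close> is the continuously
  differentiable representative on \<open>[0, 1]\<close>; \<open>Lt_adj q t z w\<close> says that \<open>(z, w)\<close> is in the graph
  of the Hilbert space adjoint of \<open>L\<^sub>t\<close>.
\<close>

definition Lt_op ::
    "(real \<Rightarrow> complex) \<Rightarrow> complex \<Rightarrow> (real \<Rightarrow> complex) \<Rightarrow> (real \<Rightarrow> complex) \<Rightarrow> bool" where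
  "Lt_op q t y f \<longleftrightarrow> L2_01 y \<and> L2_01 f \<and> hill_expr q 0 1 y f \<and>
     y 1 = exp (\<i> * t) * y 0 \<and>
     vector_derivative y (at 1 within {0..1}) =
       exp (\<i> * t) * vector_derivative y (at 0 within {0..1})"

definition Lt_adj ::
    "(real \<Rightarrow> complex) \<Rightarrow> complex \<Rightarrow> (real \<Rightarrow> complex) \<Rightarrow> (real \<Rightarrow> complex) \<Rightarrow> bool" where
  "Lt_adj q t z w \<longleftrightarrow> L2_01 z \<and> L2_01 w \<and>
     (\<forall>y f. Lt_op q t y f \<longrightarrow> L2_inner f z = L2_inner y w)"

definition Lt_eigenfunction ::
    "(real \<Rightarrow> complex) \<Rightarrow> complex \<Rightarrow> complex \<Rightarrow> (real \<Rightarrow> complex) \<Rightarrow> bool" where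
  "Lt_eigenfunction q t \<mu> y \<longleftrightarrow> Lt_op q t y (\<lambda>x. \<mu> * y x) \<and> (\<exists>x\<in>{0..1}. y x \<noteq> 0)"

definition Lt_associated ::
    "(real \<Rightarrow> complex) \<Rightarrow> complex \<Rightarrow> complex \<Rightarrow> (real \<Rightarrow> complex) \<Rightarrow> (real \<Rightarrow> complex) \<Rightarrow> bool" where
  "Lt_associated q t \<mu> \<psi> \<phi> \<longleftrightarrow>
     Lt_eigenfunction q t \<mu> \<psi> \<and> Lt_op q t \<phi> (\<lambda>x. \<mu> * \<phi> x + \<psi> x)"

definition Lt_resolvent_set :: "(real \<Rightarrow> complex) \<Rightarrow> complex \<Rightarrow> complex set" where
  "Lt_resolvent_set q t =
     {\<mu>. (\<forall>y. Lt_op q t y (\<lambda>x. \<mu> * y x) \<longrightarrow> (\<forall>x\<in>{0..1}. y x = 0)) \<and>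
         (\<exists>C. \<forall>f. L2_01 f \<longrightarrow>
            (\<exists>y. Lt_op q t y (\<lambda>x. \<mu> * y x + f x) \<and> L2_norm y \<le> C * L2_norm f))}"

definition Lt_spectrum :: "(real \<Rightarrow> complex) \<Rightarrow> complex \<Rightarrow> complex set" where
  "Lt_spectrum q t = - Lt_resolvent_set q t"

definition hill_spectrum :: "(real \<Rightarrow> complex) \<Rightarrow> complex set" where
  "hill_spectrum q = (\<Union>t\<in>{-pi<..pi}. Lt_spectrum q (of_real t))"

definition Lt_multiplicity :: "(real \<Rightarrow> complex) \<Rightarrow> complex \<Rightarrow> complex \<Rightarrow> nat" where
  "Lt_multiplicity q t \<mu> = nat (zorder (\<lambda>z. hill_discriminant q z - 2 * cos t) \<mu>)"

definition Lt_multiple_eigenvalue :: "(real \<Rightarrow> complex) \<Rightarrow> complex \<Rightarrow> complex \<Rightarrow> bool" where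
  "Lt_multiple_eigenvalue q t \<mu> \<longleftrightarrow>
     (\<exists>y. Lt_eigenfunction q t \<mu> y) \<and> Lt_multiplicity q t \<mu> \<ge> 2"

text \<open>
  Functions on \<open>[0, 1]\<close> are extended by zero here, so that the eigenspace is a genuine linear
  subspace whose elements are determined by their values on \<open>[0, 1]\<close>.
\<close>

definition Lt_geometric_multiplicity :: "(real \<Rightarrow> complex) \<Rightarrow> complex \<Rightarrow> complex \<Rightarrow> nat" where
  "Lt_geometric_multiplicity q t \<mu> =
     vector_space.dim (\<lambda>(c::complex) (f::real \<Rightarrow> complex). (\<lambda>x. c * f x))
       {y. Lt_op q t y (\<lambda>x. \<mu> * y x) \<and> (\<forall>x. x \<notin> {0..1} \<longrightarrow> y x = 0)}"

text \<open>
  Up to scaling there is one eigenfunction, and up to scaling and addition of eigenfunctions one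
  associated function.
\<close>

definition one_eigenfunction_one_associated ::
    "(real \<Rightarrow> complex) \<Rightarrow> complex \<Rightarrow> complex \<Rightarrow> bool" where
  "one_eigenfunction_one_associated q t \<mu> \<longleftrightarrow>
     (\<exists>\<psi> \<phi>. Lt_eigenfunction q t \<mu> \<psi> \<and>
        (\<forall>\<psi>'. Lt_eigenfunction q t \<mu> \<psi>' \<longrightarrow> (\<exists>c. \<forall>x\<in>{0..1}. \<psi>' x = c * \<psi> x)) \<and>
        Lt_associated q t \<mu> \<psi> \<phi> \<and>
        (\<forall>\<psi>' \<phi>'. Lt_associated q t \<mu> \<psi>' \<phi>' \<longrightarrow>
           (\<exists>c d. \<forall>x\<in>{0..1}. \<phi>' x = c * \<phi> x + d * \<psi> x)))"

definition dirichlet_eigenvalue :: "(real \<Rightarrow> complex) \<Rightarrow> complex \<Rightarrow> bool" where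
  "dirichlet_eigenvalue q \<mu> \<longleftrightarrow>
     (\<exists>y. hill_expr q 0 1 y (\<lambda>x. \<mu> * y x) \<and> (\<exists>x\<in>{0..1}. y x \<noteq> 0) \<and> y 0 = 0 \<and> y 1 = 0)"

definition neumann_eigenvalue :: "(real \<Rightarrow> complex) \<Rightarrow> complex \<Rightarrow> bool" where
  "neumann_eigenvalue q \<mu> \<longleftrightarrow>
     (\<exists>y. hill_expr q 0 1 y (\<lambda>x. \<mu> * y x) \<and> (\<exists>x\<in>{0..1}. y x \<noteq> 0) \<and>
          vector_derivative y (at 0 within {0..1}) = 0 \<and>
          vector_derivative y (at 1 within {0..1}) = 0)"


section \<open>Bloch eigenvalues and eigenfunctions\<close>

text \<open>
  An admissible numbering \<open>\<lambda>\<^sub>n(t)\<close> of the eigenvalues of all \<open>L\<^sub>t\<close>, \<open>t\<close> real: every complex number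
  occurs among the \<open>\<lambda>\<^sub>n(t)\<close> as often as its multiplicity as a root of \<open>F(\<mu>) = 2 cos t\<close> (which is 0
  if it is not a root). The finiteness clause excludes the value 0 of \<^const>\<open>card\<close> on infinite sets.
\<close>

definition bloch_eigenvalues :: "(real \<Rightarrow> complex) \<Rightarrow> (int \<Rightarrow> real \<Rightarrow> complex) \<Rightarrow> bool" where
  "bloch_eigenvalues q lam \<longleftrightarrow>
     (\<forall>t \<mu>. finite {n. lam n t = \<mu>} \<and> card {n. lam n t = \<mu>} = Lt_multiplicity q (of_real t) \<mu>) \<and>
     (\<forall>n. continuous_on {0..pi} (lam n)) \<and>
     (\<forall>n t. lam n (- t) = lam n t) \<and>
     (\<forall>n t. lam n (t + 2 * pi) = lam n t)"

text \<open>
  A choice of normalized eigenfunctions \<open>\<Psi>\<^sub>n\<^sub>,\<^sub>t\<close> of \<open>L\<^sub>t\<close> and \<open>\<Psi>\<^sup>*\<^sub>n\<^sub>,\<^sub>t\<close> of its adjoint. At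
  simple eigenvalues they are unique up to unimodular factors.
\<close>

definition bloch_eigenfunctions ::
    "(real \<Rightarrow> complex) \<Rightarrow> (int \<Rightarrow> real \<Rightarrow> complex) \<Rightarrow>
     (int \<Rightarrow> real \<Rightarrow> real \<Rightarrow> complex) \<Rightarrow> (int \<Rightarrow> real \<Rightarrow> real \<Rightarrow> complex) \<Rightarrow> bool" where
  "bloch_eigenfunctions q lam \<Psi> \<Psi>s \<longleftrightarrow>
     (\<forall>n t. Lt_eigenfunction q (of_real t) (lam n t) (\<Psi> n t) \<and> L2_norm (\<Psi> n t) = 1 \<and>
            Lt_adj q (of_real t) (\<Psi>s n t) (\<lambda>x. cnj (lam n t) * \<Psi>s n t x) \<and>
            L2_norm (\<Psi>s n t) = 1 \<and>
            (\<forall>x. \<Psi> n t (x + 1) = exp (\<i> * of_real t) * \<Psi> n t x) \<and>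
            (\<forall>x. \<Psi>s n t (x + 1) = exp (\<i> * of_real t) * \<Psi>s n t x))"

definition bloch_alpha ::
    "(int \<Rightarrow> real \<Rightarrow> real \<Rightarrow> complex) \<Rightarrow> (int \<Rightarrow> real \<Rightarrow> real \<Rightarrow> complex) \<Rightarrow>
     int \<Rightarrow> real \<Rightarrow> complex" where
  "bloch_alpha \<Psi> \<Psi>s n t = L2_inner (\<Psi> n t) (\<Psi>s n t)"

definition multiple_quasimomenta ::
    "(real \<Rightarrow> complex) \<Rightarrow> (int \<Rightarrow> real \<Rightarrow> complex) \<Rightarrow> int \<Rightarrow> real set" where
  "multiple_quasimomenta q lam n =
     {t \<in> {-pi<..pi}. Lt_multiple_eigenvalue q (of_real t) (lam n t)}"


section \<open>Spectral singularities\<close>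

definition regular_spectral_arc :: "(real \<Rightarrow> complex) \<Rightarrow> complex set \<Rightarrow> bool" where
  "regular_spectral_arc q \<gamma> \<longleftrightarrow>
     (\<exists>l a b. a < b \<and> l analytic_on (of_real ` {a..b}) \<and>
        (\<forall>t\<in>{a..b}. hill_discriminant q (l (of_real t)) = 2 * cos (of_real t) \<and>
                    deriv (hill_discriminant q) (l (of_real t)) \<noteq> 0) \<and>
        (\<forall>t\<in>{a<..<b}. deriv l (of_real t) \<noteq> 0) \<and>
        \<gamma> = (\<lambda>t. l (of_real t)) ` {a..b})"

text \<open>
  The norm of the projection \<open>P(\<gamma>)\<close>, for \<open>\<gamma>\<close> contained in the range of \<open>\<lambda>\<^sub>n\<close>. It is taken in the
  extended reals, where the inverse of 0 is infinite.
\<close>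

definition spectral_projection_norm ::
    "(int \<Rightarrow> real \<Rightarrow> complex) \<Rightarrow> (int \<Rightarrow> real \<Rightarrow> complex) \<Rightarrow> int \<Rightarrow> complex set \<Rightarrow> ereal" where
  "spectral_projection_norm lam \<alpha> n \<gamma> =
     (SUP t\<in>{t \<in> {-pi<..pi}. lam n t \<in> \<gamma>}. inverse (ereal (norm (\<alpha> n t))))"

definition spectral_singularity ::
    "(real \<Rightarrow> complex) \<Rightarrow> (int \<Rightarrow> real \<Rightarrow> complex) \<Rightarrow> (int \<Rightarrow> real \<Rightarrow> complex) \<Rightarrow> complex \<Rightarrow> bool" where
  "spectral_singularity q lam \<alpha> \<mu> \<longleftrightarrow> \<mu> \<in> hill_spectrum q \<and>
     (\<forall>\<epsilon>>0. \<exists>(\<gamma> :: nat \<Rightarrow> complex set) m.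
        (\<forall>k. regular_spectral_arc q (\<gamma> k) \<and> \<gamma> k \<subseteq> lam (m k) ` {0..pi} \<and> \<gamma> k \<subseteq> ball \<mu> \<epsilon>) \<and>
        (\<lambda>k. spectral_projection_norm lam \<alpha> (m k) (\<gamma> k)) \<longlonglongrightarrow> \<infinity>)"

text \<open>
  Integrability of \<open>1/\<alpha>\<^sub>n\<close> is stated for its modulus: the modulus does not depend on the choice
  of the eigenfunctions, whereas an arbitrary choice of their phases could make \<open>1/\<alpha>\<^sub>n\<close> itself
  non-measurable and hence trivially not integrable.
\<close>

definition essential_spectral_singularity ::
    "(real \<Rightarrow> complex) \<Rightarrow> (int \<Rightarrow> real \<Rightarrow> complex) \<Rightarrow> (int \<Rightarrow> real \<Rightarrow> complex) \<Rightarrow> complex \<Rightarrow> bool" where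
  "essential_spectral_singularity q lam \<alpha> \<mu> \<longleftrightarrow>
     (\<exists>t0\<in>{-pi<..pi}.
        \<mu> \<in> Lt_spectrum q (of_real t0) \<and> \<mu> \<in> Lt_spectrum q (of_real (- t0)) \<and>
        (\<exists>n. \<mu> = lam n t0 \<and>
           (\<forall>\<epsilon>>0. \<not> (\<lambda>t. 1 / norm (\<alpha> n t)) absolutely_integrable_on
              (({t0 - \<epsilon><..<t0 + \<epsilon>} \<union> {- t0 - \<epsilon><..<- t0 + \<epsilon>})
                 - multiple_quasimomenta q lam n))))"

end

theory Submission
  imports Defs
begin

text \<open>
  Write \<open>M(\<mu>)\<close> for the monodromy matrix with entries \<open>\<theta>(1), \<phi>(1), \<theta>'(1), \<phi>'(1)\<close>. If
  \<open>\<phi>(1) \<noteq> 0\<close>, the eigenfunctions of \<open>L\<^sub>t\<close> and of its adjoint are multiples of the Bloch solution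
  \<open>\<phi>(1) \<theta> + (e\<^sup>i\<^sup>t - \<theta>(1)) \<phi>\<close> and of the conjugate of the one for \<open>- t\<close>, and the integral of
  the product of these two Bloch solutions is \<open>- \<phi>(1) F'(\<mu>)\<close>; so \<open>\<bar>\<alpha>\<bar>\<close> is \<open>\<bar>\<phi>(1) F'\<bar>\<close> divided by
  the two norms.

  Let \<open>\<mu>\<close> be a multiple eigenvalue of \<open>L\<^sub>0\<close> or \<open>L\<^sub>\<pi>\<close>. If \<open>\<phi>(1) \<noteq> 0\<close> there, then
  \<open>\<bar>F'\<bar>\<^sup>2 = O(\<bar>F - F(\<mu>)\<bar>)\<close>, so \<open>\<alpha>(t) = O(\<bar>t - t\<^sub>0\<bar>)\<close>: \<open>1/\<alpha>\<close> is unbounded and not integrable. Moreover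
  \<open>F'(\<mu>) = 0\<close> is exactly the solvability condition for an associated function. For large \<open>\<mu>\<close>
  the asymptotics of the solutions give \<open>\<integral>\<theta>\<^sup>2 \<noteq> 0\<close>, \<open>\<integral>\<phi>\<^sup>2 \<noteq> 0\<close> and
  \<open>\<integral>\<theta>\<^sup>2 \<integral>\<phi>\<^sup>2 \<noteq> (\<integral>\<theta>\<phi>)\<^sup>2\<close>. Then \<open>\<phi>(1) = 0\<close>, \<open>\<theta>'(1) = 0\<close> and \<open>M(\<mu>) = \<plusminus> I\<close> are equivalent, and in
  that case \<open>\<phi>(1)\<close>, \<open>F'\<close> and the Bloch solutions vanish exactly to first order at \<open>\<mu>\<close>, so
  that \<open>1/\<alpha>\<close> stays bounded.
\<close>

text \<open>As \<open>q\<close> is merely integrable, solutions have a second derivative only almost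
  everywhere. One integrated statement, \<open>lagrange_identity\<close>, replaces pointwise
  calculus: uniqueness, variation of constants, the \<mu>-derivatives of the monodromy entries and
  the comparison with sines and cosines all come from pairing a solution with a suitable second
  function. As \<open>q\<close> is complex, the integrals of \<theta>^2 and \<phi>^2 carry no
  conjugation and can vanish. This alone forces \<mu> to be large, and the threshold depends on
  \<open>q\<close> only through the integral of its modulus. The branches \<open>lam n\<close> need
  not be differentiable at a multiple eigenvalue. No expansion of them is used: their values enter
  only through F(lam n t) = 2 cos t, and the estimates are made in the \<mu>-plane. At scalar
  monodromy the Bloch solution vanishes identically, so the formula for the modulus of \<alpha>
  becomes 0/0 there; this is why numerator and denominator must be compared order by order.\<close>

section \<open>Integration by parts for absolutely continuous functions\<close>

lemma absolutely_integrable_continuous_mult: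
  fixes f g :: "real \<Rightarrow> 'a::{real_normed_field,euclidean_space}"
  assumes "continuous_on {a..b} f" "g absolutely_integrable_on {a..b}"
  shows "(\<lambda>x. f x * g x) absolutely_integrable_on {a..b}"
proof (rule absolutely_integrable_bounded_measurable_product[OF bilinear_times])
  show "f \<in> borel_measurable (lebesgue_on {a..b})"
    using assms(1) by (simp add: continuous_imp_measurable_on_sets_lebesgue)
  show "bounded (f ` {a..b})"
    using assms(1) by (simp add: compact_continuous_image compact_imp_bounded)
qed (use assms in auto)

lemma absolutely_integrable_mult_continuous:
  fixes f g :: "real \<Rightarrow> 'a::{real_normed_field,euclidean_space}"
  assumes "continuous_on {a..b} f" "g absolutely_integrable_on {a..b}"
  shows "(\<lambda>x. g x * f x) absolutely_integrable_on {a..b}"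
  using absolutely_integrable_continuous_mult[OF assms] by (simp add: mult.commute)

text \<open>Fubini's theorem concerns Bochner integrals over \<open>lebesgue_on\<close>, while the
  definitions use gauge integrals; this passes from one to the other.\<close>

lemma integral_lebesgue_on_Icc:
  fixes f :: "real \<Rightarrow> 'a::euclidean_space"
  assumes "f absolutely_integrable_on {a..b}"
  shows "integral\<^sup>L (lebesgue_on {a..b}) f = integral {a..b} f"
  using assms absolutely_integrable_imp_integrable lebesgue_integral_eq_integral by fastforce

lemma indefinite_integral_continuous_on:
  fixes u :: "real \<Rightarrow> 'a::euclidean_space"
  assumes "u absolutely_integrable_on {a..b}"
      and "\<And>x. x \<in> {a..b} \<Longrightarrow> U x = U a + integral {a..x} u"
  shows "continuous_on {a..b} U"
proof -
  have "continuous_on {a..b} (\<lambda>x. U a + integral {a..x} u)"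
    by (intro continuous_intros indefinite_integral_continuous_1)
       (use assms absolutely_integrable_on_def in auto)
  then show ?thesis using assms(2) continuous_on_cong by (metis (no_types, lifting))
qed

text \<open>The product rule for absolutely continuous functions, by Fubini on the triangle
  \<open>{r \<le> s}\<close> and on its complement.\<close>

lemma integral_product_rule:
  fixes u v :: "real \<Rightarrow> 'a::{real_normed_field,euclidean_space}"
  assumes "a \<le> b"
      and u: "u absolutely_integrable_on {a..b}" and v: "v absolutely_integrable_on {a..b}"
      and U: "\<And>x. x \<in> {a..b} \<Longrightarrow> U x = U a + integral {a..x} u"
      and V: "\<And>x. x \<in> {a..b} \<Longrightarrow> V x = V a + integral {a..x} v"
  shows "integral {a..b} (\<lambda>x. u x * V x + U x * v x) = U b * V b - U a * V a"
proof -
  define M where "M = lebesgue_on {a..b}"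
  have fM: "finite_measure M" unfolding M_def by (rule finite_measure_lebesgue_on) auto
  interpret finite_measure M by (rule fM)
  interpret P: pair_sigma_finite M M
    by (simp add: pair_sigma_finite_def sigma_finite_measure_axioms)
  have sp: "space M = {a..b}" by (simp add: M_def)
  have contU: "continuous_on {a..b} U" and contV: "continuous_on {a..b} V"
    using indefinite_integral_continuous_on u v U V by blast+
  have ui: "integrable M u" and vi: "integrable M v"
    using u v by (auto simp: M_def absolutely_integrable_imp_integrable)
  have um[measurable]: "u \<in> borel_measurable M" and vm[measurable]: "v \<in> borel_measurable M"
    using ui vi by auto
  have idm[measurable]: "(\<lambda>x. x) \<in> borel_measurable M"
    unfolding M_def by (simp add: continuous_imp_measurable_on_sets_lebesgue)
  have le[measurable]: "Measurable.pred (M \<Otimes>\<^sub>M M) (\<lambda>p. snd p \<le> fst p)"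
  proof -
    have 1: "(\<lambda>p. fst p) \<in> borel_measurable (M \<Otimes>\<^sub>M M)" "(\<lambda>p. snd p) \<in> borel_measurable (M \<Otimes>\<^sub>M M)"
      using measurable_compose[OF measurable_fst idm] measurable_compose[OF measurable_snd idm] by auto
    show ?thesis using 1 by (simp add: borel_measurable_pred_less borel_measurable_le pred_def)
  qed
  have prod: "integrable (M \<Otimes>\<^sub>M M) (\<lambda>p. u (fst p) * v (snd p))"
  proof (rule P.Fubini_integrable)
    show "(\<lambda>p. u (fst p) * v (snd p)) \<in> borel_measurable (M \<Otimes>\<^sub>M M)" by measurable
    show "integrable M (\<lambda>x. \<integral>y. norm (u (fst (x, y)) * v (snd (x, y))) \<partial>M)"
      using ui vi by (simp add: norm_mult)
    show "AE x in M. integrable M (\<lambda>y. u (fst (x, y)) * v (snd (x, y)))"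
      using vi by simp
  qed
  \<comment> \<open>Extension by zero off the triangle makes both iterated integrals run over the
    same square. They are the integrals of \<open>u * (V - V a)\<close> and of
    \<open>(U b - U) * v\<close>; equating them is integration by parts.\<close>
  define f where "f s r = (if r \<le> s then u s * v r else 0)" for s r
  have fint: "integrable (M \<Otimes>\<^sub>M M) (case_prod f)"
  proof (rule Bochner_Integration.integrable_bound[OF prod])
    have "(\<lambda>p. if snd p \<le> fst p then u (fst p) * v (snd p) else 0) \<in> borel_measurable (M \<Otimes>\<^sub>M M)"
      by measurable
    then show "case_prod f \<in> borel_measurable (M \<Otimes>\<^sub>M M)" by (simp add: f_def case_prod_beta')
    show "AE x in M \<Otimes>\<^sub>M M. norm (case_prod f x) \<le> norm (u (fst x) * v (snd x))"
      by (auto simp: f_def)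
  qed
  have absI: "(\<lambda>r. if r \<in> T then w r else 0) absolutely_integrable_on {a..b}"
    if "w absolutely_integrable_on {a..b}" "T = {c..d}" "T \<subseteq> {a..b}" for w :: "real \<Rightarrow> 'a" and T c d
  proof -
    have "w absolutely_integrable_on {c..d}"
      using absolutely_integrable_on_subinterval that by metis
    then have "w absolutely_integrable_on T" using that by simp
    then have "(\<lambda>r. if r \<in> T then w r else 0) absolutely_integrable_on T"
      by (rule absolutely_integrable_spike[where S = "{}"]) (use that in auto)
    then show ?thesis
      by (rule absolutely_integrable_spike_set) (use that in \<open>auto intro: negligible_subset[of "{}"]\<close>)
  qed
  have inner1: "(\<integral>r. f s r \<partial>M) = u s * (V s - V a)" if s: "s \<in> {a..b}" for s
  proof -
    have "(\<integral>r. f s r \<partial>M) = (\<integral>r. u s * (if r \<in> {a..s} then v r else 0) \<partial>M)"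
      by (rule Bochner_Integration.integral_cong) (auto simp: f_def sp)
    also have "\<dots> = u s * (\<integral>r. (if r \<in> {a..s} then v r else 0) \<partial>M)"
      by simp
    also have "(\<integral>r. (if r \<in> {a..s} then v r else 0) \<partial>M) = integral {a..b} (\<lambda>r. if r \<in> {a..s} then v r else 0)"
      unfolding M_def by (rule integral_lebesgue_on_Icc[OF absI[OF v]]) (use s in auto)
    also have "\<dots> = integral ({a..s} \<inter> {a..b}) v" by (metis (no_types) integral_restrict_Int inf_commute)
    also have "\<dots> = V s - V a" using s V[OF s] by (simp add: min_absorb1)
    finally show ?thesis .
  qed
  have inner2: "(\<integral>s. f s r \<partial>M) = (U b - U r) * v r" if r: "r \<in> {a..b}" for r
  proof -
    have "(\<integral>s. f s r \<partial>M) = (\<integral>s. (if s \<in> {r..b} then u s else 0) * v r \<partial>M)"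
      by (rule Bochner_Integration.integral_cong) (auto simp: f_def sp)
    also have "\<dots> = (\<integral>s. (if s \<in> {r..b} then u s else 0) \<partial>M) * v r"
      by simp
    also have "(\<integral>s. (if s \<in> {r..b} then u s else 0) \<partial>M) = integral {a..b} (\<lambda>s. if s \<in> {r..b} then u s else 0)"
      unfolding M_def by (rule integral_lebesgue_on_Icc[OF absI[OF u]]) (use r in auto)
    also have "\<dots> = integral ({r..b} \<inter> {a..b}) u" by (metis (no_types) integral_restrict_Int inf_commute)
    also have "{r..b} \<inter> {a..b} = {r..b}" using r by auto
    also have "integral {r..b} u = U b - U r"
    proof -
      have "integral {a..r} u + integral {r..b} u = integral {a..b} u"
        using r u by (intro Henstock_Kurzweil_Integration.integral_combine)
          (auto simp: absolutely_integrable_on_def)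
      then show ?thesis using U[OF r] U[of b] \<open>a \<le> b\<close> by (simp add: algebra_simps)
    qed
    finally show ?thesis .
  qed
  have au: "(\<lambda>s. u s * (V s - V a)) absolutely_integrable_on {a..b}"
    by (intro absolutely_integrable_mult_continuous continuous_intros contV u)
  have av: "(\<lambda>r. (U b - U r) * v r) absolutely_integrable_on {a..b}"
    by (intro absolutely_integrable_continuous_mult continuous_intros contU v)
  have "integral {a..b} (\<lambda>s. u s * (V s - V a)) = (\<integral>s. u s * (V s - V a) \<partial>M)"
    using integral_lebesgue_on_Icc[OF au] by (simp add: M_def)
  also have "\<dots> = (\<integral>s. (\<integral>r. f s r \<partial>M) \<partial>M)"
    by (rule Bochner_Integration.integral_cong) (auto simp: inner1 sp)
  also have "\<dots> = (\<integral>r. (\<integral>s. f s r \<partial>M) \<partial>M)"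
    using P.Fubini_integral[OF fint] by simp
  also have "\<dots> = (\<integral>r. (U b - U r) * v r \<partial>M)"
    by (rule Bochner_Integration.integral_cong) (auto simp: inner2 sp)
  also have "\<dots> = integral {a..b} (\<lambda>r. (U b - U r) * v r)"
    using integral_lebesgue_on_Icc[OF av] by (simp add: M_def)
  finally have eq: "integral {a..b} (\<lambda>s. u s * (V s - V a)) = integral {a..b} (\<lambda>r. (U b - U r) * v r)" .
  have i1: "(\<lambda>s. u s * V s) integrable_on {a..b}" "(\<lambda>s. U s * v s) integrable_on {a..b}" "u integrable_on {a..b}" "v integrable_on {a..b}"
    using absolutely_integrable_mult_continuous[OF contV u] absolutely_integrable_continuous_mult[OF contU v] u v
    by (auto simp: absolutely_integrable_on_def)
  have e1: "integral {a..b} (\<lambda>s. u s * (V s - V a)) = integral {a..b} (\<lambda>s. u s * V s) - integral {a..b} u * V a"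
    using i1 by (simp add: right_diff_distrib Henstock_Kurzweil_Integration.integral_diff
      integrable_on_mult_left)
  have e2: "integral {a..b} (\<lambda>s. (U b - U s) * v s) = U b * integral {a..b} v - integral {a..b} (\<lambda>s. U s * v s)"
    using i1 by (simp add: left_diff_distrib Henstock_Kurzweil_Integration.integral_diff
      integrable_on_mult_right)
  have "integral {a..b} (\<lambda>x. u x * V x + U x * v x) = integral {a..b} (\<lambda>s. u s * V s) + integral {a..b} (\<lambda>s. U s * v s)"
    using i1 by (simp add: Henstock_Kurzweil_Integration.integral_add)
  also have "\<dots> = integral {a..b} u * V a + U b * integral {a..b} v"
    using eq[unfolded e1 e2] by (simp add: diff_eq_eq add_ac mult_ac)
  also have "\<dots> = U b * V b - U a * V a"
    using U[of b] V[of b] \<open>a \<le> b\<close> by (simp add: algebra_simps)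
  finally show ?thesis .
qed

section \<open>Local integrability and oriented integrals from 0\<close>

definition locally_integrable :: "(real \<Rightarrow> 'a::euclidean_space) \<Rightarrow> bool" where
  "locally_integrable f \<longleftrightarrow> (\<forall>a b. f absolutely_integrable_on {a..b})"

text \<open>The oriented integral from 0 to \<open>x\<close>: at most one term is nonzero, since
  integrals over empty or one-point intervals are 0. Both signs of \<open>x\<close> matter because
  \<open>hill_solution\<close> refers to all intervals of the line.\<close>

definition signed_integral :: "(real \<Rightarrow> 'a::euclidean_space) \<Rightarrow> real \<Rightarrow> 'a" where
  "signed_integral f x = integral {0..x} f - integral {x..0} f"

lemma locally_integrableD: "locally_integrable f \<Longrightarrow> f absolutely_integrable_on {a..b}"
  by (simp add: locally_integrable_def)

lemma locally_integrable_imp_integrable: "locally_integrable f \<Longrightarrow> f integrable_on {a..b}"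
  using absolutely_integrable_on_def locally_integrableD by blast

lemma locally_integrable_continuous: "continuous_on UNIV f \<Longrightarrow> locally_integrable f"
  unfolding locally_integrable_def
  by (meson absolutely_integrable_continuous_real continuous_on_subset subset_UNIV)

lemma locally_integrable_diff:
  "locally_integrable f \<Longrightarrow> locally_integrable g \<Longrightarrow> locally_integrable (\<lambda>x. f x - g x)"
  by (simp add: locally_integrable_def set_integral_diff)

lemma locally_integrable_mult_continuous:
  fixes f g :: "real \<Rightarrow> 'a::{real_normed_field,euclidean_space}"
  shows "locally_integrable g \<Longrightarrow> continuous_on UNIV f \<Longrightarrow> locally_integrable (\<lambda>x. g x * f x)"
  unfolding locally_integrable_def
  using absolutely_integrable_mult_continuous continuous_on_subset by blast

lemma locally_integrable_norm: "locally_integrable f \<Longrightarrow> locally_integrable (\<lambda>x. norm (f x))"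
  by (simp add: locally_integrable_def absolutely_integrable_norm[unfolded o_def])

lemma locally_integrable_reflect:
  "locally_integrable f \<Longrightarrow> locally_integrable (\<lambda>x. f (- x))"
  unfolding locally_integrable_def by (metis absolutely_integrable_reflect_real minus_minus)

lemma signed_integral_diff:
  assumes "locally_integrable f" "a \<le> b"
  shows "signed_integral f b - signed_integral f a = integral {a..b} f"
proof -
  have c: "integral {r..s} f + integral {s..t} f = integral {r..t} f" if "r \<le> s" "s \<le> t" for r s t
    using that locally_integrable_imp_integrable[OF assms(1)]
    by (intro Henstock_Kurzweil_Integration.integral_combine) auto
  have z: "integral {s..t} f = 0" if "t \<le> s" for s t
    using that by (cases "s = t") auto
  consider "0 \<le> a" "0 \<le> b" | "a \<le> 0" "0 \<le> b" | "a \<le> 0" "b \<le> 0"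
    using assms(2) by linarith
  then show ?thesis
  proof cases
    case 1
    show ?thesis using c[OF 1(1) assms(2)] unfolding signed_integral_def z[OF 1(1)] z[OF 1(2)]
      by (simp add: algebra_simps)
  next
    case 2
    show ?thesis using c[OF 2] unfolding signed_integral_def z[OF 2(1)] z[OF 2(2)]
      by (simp add: algebra_simps)
  next
    case 3
    show ?thesis using c[OF assms(2) 3(2)] unfolding signed_integral_def z[OF 3(1)] z[OF 3(2)]
      by (simp add: algebra_simps)
  qed
qed

lemma signed_integral_eq: "0 \<le> x \<Longrightarrow> signed_integral f x = integral {0..x} f"
  by (cases "x = 0") (auto simp: signed_integral_def)

lemma signed_integral_0 [simp]: "signed_integral f 0 = 0"
  by (simp add: signed_integral_def)

text \<open>Carries estimates proved for \<open>x \<ge> 0\<close> over to negative \<open>x\<close>,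
  with reflected data.\<close>

lemma signed_integral_reflect: "signed_integral f (- x) = - signed_integral (\<lambda>x. f (- x)) x"
  using Henstock_Kurzweil_Integration.integral_reflect_real[of 0 "-x" f]
        Henstock_Kurzweil_Integration.integral_reflect_real[of "-x" 0 f]
  by (simp add: signed_integral_def)

lemma signed_integral_minus_diff:
  "locally_integrable f \<Longrightarrow> locally_integrable g \<Longrightarrow>
    signed_integral (\<lambda>x. f x - g x) x = signed_integral f x - signed_integral g x"
  by (simp add: signed_integral_def Henstock_Kurzweil_Integration.integral_diff
      locally_integrable_imp_integrable)

lemma continuous_on_signed_integral:
  assumes "locally_integrable f"
  shows "continuous_on UNIV (signed_integral f)"
proof -
  have "continuous_on {-n<..<n} (signed_integral f)" for n :: real
  proof (cases "0 < n")
    case True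
    have "continuous_on {-n..n} (signed_integral f)"
    proof (rule indefinite_integral_continuous_on)
      show "f absolutely_integrable_on {-n..n}" using assms by (simp add: locally_integrableD)
      show "signed_integral f x = signed_integral f (-n) + integral {-n..x} f" if "x \<in> {-n..n}" for x
        using signed_integral_diff[OF assms, of "-n" x] that by (simp add: algebra_simps)
    qed
    then show ?thesis by (rule continuous_on_subset) auto
  qed auto
  then have "continuous_on (\<Union>n. {-real n<..<real n}) (signed_integral f)"
    by (intro continuous_on_open_UN) auto
  moreover have "(\<Union>n. {-real n<..<real n}) = UNIV"
  proof -
    have "\<exists>n. x \<in> {-real n<..<real n}" for x
      using reals_Archimedean2[of "\<bar>x\<bar>"] by (auto simp: abs_less_iff) (metis minus_less_iff)
    then show ?thesis by auto
  qed
  ultimately show ?thesis by simp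
qed

lemma signed_integral_has_vector_derivative:
  assumes "continuous_on UNIV f"
  shows "(signed_integral f has_vector_derivative f x) (at x)"
proof -
  let ?a = "x - 1" and ?b = "x + 1"
  have li: "locally_integrable f" using assms by (rule locally_integrable_continuous)
  have 1: "((\<lambda>u. signed_integral f ?a + integral {?a..u} f) has_vector_derivative 0 + f x) (at x within {?a..?b})"
    by (intro derivative_intros integral_has_vector_derivative)
       (auto intro: continuous_on_subset[OF assms])
  have 2: "signed_integral f u = signed_integral f ?a + integral {?a..u} f" if "u \<in> {?a..?b}" for u
    using signed_integral_diff[OF li, of ?a u] that by (simp add: diff_eq_eq add.commute)
  have "(signed_integral f has_vector_derivative 0 + f x) (at x within {?a..?b})"
    by (rule has_vector_derivative_transform[OF _ 2 1]) simp
  then show ?thesis using at_within_Icc_at[of ?a x ?b] by simp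
qed

text \<open>The substitution rule for powers of a primitive W of \<open>w\<close>. As
  \<open>w\<close> is merely integrable, W need not be differentiable everywhere, so the rule is
  derived by induction from the product rule for W and its next lower power.\<close>

lemma integral_power_rule:
  fixes w :: "real \<Rightarrow> real"
  assumes w: "locally_integrable w" and "0 \<le> x"
  shows "signed_integral w x ^ Suc n = real (Suc n) * integral {0..x} (\<lambda>s. w s * signed_integral w s ^ n)"
  using \<open>0 \<le> x\<close>
proof (induction n arbitrary: x)
  case 0
  then show ?case by (simp add: signed_integral_eq)
next
  case (Suc n)
  let ?W = "signed_integral w"
  have cW: "continuous_on S ?W" for S
    using continuous_on_signed_integral[OF w] continuous_on_subset by blast
  have li: "(\<lambda>s. w s * ?W s ^ k) absolutely_integrable_on {a..b}" for a b k
    by (intro absolutely_integrable_mult_continuous continuous_intros cW locally_integrableD w)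
  have i: "(\<lambda>s. w s * ?W s ^ k) integrable_on {a..b}" for a b k
    using li absolutely_integrable_on_def by blast
  have "integral {0..x} (\<lambda>s. w s * (?W s ^ Suc n) + ?W s * (real (Suc n) * (w s * ?W s ^ n)))
      = ?W x * ?W x ^ Suc n - ?W 0 * ?W 0 ^ Suc n"
  proof (rule integral_product_rule[where U = ?W and V = "\<lambda>s. ?W s ^ Suc n"])
    show "(\<lambda>s. real (Suc n) * (w s * ?W s ^ n)) absolutely_integrable_on {0..x}"
      by (rule absolutely_integrable_continuous_mult[OF continuous_on_const li])
    show "?W y ^ Suc n = ?W 0 ^ Suc n + integral {0..y} (\<lambda>s. real (Suc n) * (w s * ?W s ^ n))"
      if "y \<in> {0..x}" for y
      using Suc.IH[of y] that i by (simp add: integral_mult_right)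
    show "?W y = ?W 0 + integral {0..y} w" if "y \<in> {0..x}" for y
      using that by (simp add: signed_integral_eq)
  qed (use Suc.prems w locally_integrableD in auto)
  moreover have "(\<lambda>s. w s * (?W s ^ Suc n) + ?W s * (real (Suc n) * (w s * ?W s ^ n)))
      = (\<lambda>s. real (Suc (Suc n)) * (w s * ?W s ^ Suc n))"
    by (rule ext) (simp add: algebra_simps)
  ultimately show ?case by (simp only: integral_mult_right) simp
qed

section \<open>Volterra equations\<close>

text \<open>Integrating twice from 0 inverts the second derivative with zero initial data. An
  initial value problem with \<open>y'' = p y\<close> plus an inhomogeneity thus becomes
  \<open>y = g + volterra p y\<close>, where \<open>g\<close> collects initial values and
  inhomogeneity.\<close>

definition volterra :: "(real \<Rightarrow> complex) \<Rightarrow> (real \<Rightarrow> complex) \<Rightarrow> real \<Rightarrow> complex" where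
  "volterra p u = signed_integral (signed_integral (\<lambda>s. p s * u s))"

lemma continuous_on_volterra:
  assumes "locally_integrable p" "continuous_on UNIV u"
  shows "continuous_on UNIV (volterra p u)"
  unfolding volterra_def
  by (intro continuous_on_signed_integral locally_integrable_continuous
      locally_integrable_mult_continuous assms)

lemma volterra_reflect:
  "volterra p u (- x) = volterra (\<lambda>s. p (- s)) (\<lambda>s. u (- s)) x"
proof -
  have neg: "signed_integral (\<lambda>x. - f x) y = - signed_integral f y" for f :: "real \<Rightarrow> complex" and y
    by (simp add: signed_integral_def)
  show ?thesis
    by (simp add: volterra_def signed_integral_reflect[of "signed_integral (\<lambda>s. p s * u s)" x]
        signed_integral_reflect[of "\<lambda>s. p s * u s"] neg)
qed

lemma volterra_diff:
  assumes "locally_integrable p" "continuous_on UNIV u" "continuous_on UNIV v"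
  shows "volterra p (\<lambda>s. u s - v s) x = volterra p u x - volterra p v x"
proof -
  have "signed_integral (\<lambda>s. p s * (u s - v s))
      = (\<lambda>x. signed_integral (\<lambda>s. p s * u s) x - signed_integral (\<lambda>s. p s * v s) x)"
    by (rule ext) (simp add: right_diff_distrib signed_integral_minus_diff
        locally_integrable_mult_continuous assms)
  then show ?thesis
    by (simp add: volterra_def signed_integral_minus_diff locally_integrable_continuous
        continuous_on_signed_integral locally_integrable_mult_continuous assms)
qed

text \<open>The inner integration raises the power of the primitive of \<open>norm p\<close> by one
  and yields the factor 1/(n+1), by \<open>integral_power_rule\<close>; the outer one costs at most
  the interval length \<open>N\<close>.\<close>

lemma volterra_power_bound:
  assumes p: "locally_integrable p" and u: "continuous_on UNIV u" and "0 \<le> C" "0 \<le> x" "x \<le> N"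
      and bd: "\<And>s. 0 \<le> s \<Longrightarrow> s \<le> N \<Longrightarrow>
        norm (u s) \<le> C * (N * signed_integral (\<lambda>s. norm (p s)) s) ^ n / fact n"
  shows "norm (volterra p u x) \<le> C * (N * signed_integral (\<lambda>s. norm (p s)) x) ^ Suc n / fact (Suc n)"
proof -
  let ?w = "\<lambda>s. norm (p s)"
  let ?W = "signed_integral ?w"
  have w: "locally_integrable ?w" by (rule locally_integrable_norm[OF p])
  have cW: "continuous_on S ?W" for S
    using continuous_on_signed_integral[OF w] continuous_on_subset by blast
  have Wmono: "?W s \<le> ?W t" if "s \<le> t" for s t
  proof -
    have "0 \<le> integral {s..t} ?w"
      using w by (intro Henstock_Kurzweil_Integration.integral_nonneg locally_integrable_imp_integrable) auto
    then show ?thesis using signed_integral_diff[OF w that] by simp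
  qed
  have W0: "0 \<le> ?W s" if "0 \<le> s" for s using Wmono[OF that] by simp
  have i: "(\<lambda>s. ?w s * ?W s ^ k) integrable_on {a..b}" for a b k
    by (rule locally_integrable_imp_integrable)
       (intro locally_integrable_mult_continuous continuous_intros cW w)
  have inner: "norm (signed_integral (\<lambda>s. p s * u s) s) \<le> C * N ^ n * ?W s ^ Suc n / fact (Suc n)"
    if s: "0 \<le> s" "s \<le> N" for s
  proof -
    have "norm (integral {0..s} (\<lambda>s. p s * u s))
        \<le> integral {0..s} (\<lambda>r. (C * N ^ n / fact n) * (?w r * ?W r ^ n))"
    proof (rule Henstock_Kurzweil_Integration.integral_norm_bound_integral)
      show "(\<lambda>s. p s * u s) integrable_on {0..s}"
        by (intro locally_integrable_imp_integrable locally_integrable_mult_continuous p u)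
      show "(\<lambda>r. (C * N ^ n / fact n) * (?w r * ?W r ^ n)) integrable_on {0..s}"
        using i by (rule integrable_on_mult_right)
      show "norm (p r * u r) \<le> (C * N ^ n / fact n) * (?w r * ?W r ^ n)" if "r \<in> {0..s}" for r
        using mult_left_mono[OF bd[of r], of "norm (p r)"] that s
        by (simp add: norm_mult power_mult_distrib mult_ac)
    qed
    also have "\<dots> = (C * N ^ n / fact n) * integral {0..s} (\<lambda>r. ?w r * ?W r ^ n)"
      by (rule integral_mult_right)
    also have "integral {0..s} (\<lambda>r. ?w r * ?W r ^ n) = ?W s ^ Suc n / real (Suc n)"
      using integral_power_rule[OF w s(1), of n] by (simp add: field_simps del: power_Suc)
    finally show ?thesis using s
      by (simp add: signed_integral_eq fact_Suc field_simps del: power_Suc of_nat_Suc)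
  qed
  have c: "continuous_on UNIV (signed_integral (\<lambda>s. p s * u s))"
    by (intro continuous_on_signed_integral locally_integrable_mult_continuous p u)
  have "norm (integral {0..x} (signed_integral (\<lambda>s. p s * u s)))
      \<le> integral {0..x} (\<lambda>s. C * N ^ n * ?W x ^ Suc n / fact (Suc n))"
  proof (rule Henstock_Kurzweil_Integration.integral_norm_bound_integral)
    show "(signed_integral (\<lambda>s. p s * u s)) integrable_on {0..x}"
      using c by (intro locally_integrable_imp_integrable locally_integrable_continuous)
    show "norm (signed_integral (\<lambda>s. p s * u s) s) \<le> C * N ^ n * ?W x ^ Suc n / fact (Suc n)"
      if s: "s \<in> {0..x}" for s
    proof -
      \<comment> \<open>The inner bound increases with \<open>s\<close>, so its value at
        \<open>x\<close> serves on all of [0, x] and the outer integrand becomes constant.\<close>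
      have "C * N ^ n * ?W s ^ Suc n \<le> C * N ^ n * ?W x ^ Suc n"
        using s assms W0[of s] Wmono[of s x] by (intro mult_left_mono power_mono) auto
      then have "C * N ^ n * ?W s ^ Suc n / fact (Suc n) \<le> C * N ^ n * ?W x ^ Suc n / fact (Suc n)"
        by (rule divide_right_mono) simp
      then show ?thesis using inner[of s] s assms by (meson atLeastAtMost_iff order_trans)
    qed
  qed auto
  also have "\<dots> = x * (C * N ^ n * ?W x ^ Suc n / fact (Suc n))"
    using assms by simp
  also have "\<dots> \<le> N * (C * N ^ n * ?W x ^ Suc n / fact (Suc n))"
    using assms W0[of x] by (intro mult_right_mono) auto
  also have "\<dots> = C * (N * ?W x) ^ Suc n / fact (Suc n)"
    by (simp add: power_mult_distrib mult_ac)
  finally show ?thesis using \<open>0 \<le> x\<close> by (simp add: volterra_def signed_integral_eq)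
qed

primrec volterra_iterate :: "(real \<Rightarrow> complex) \<Rightarrow> (real \<Rightarrow> complex) \<Rightarrow> nat \<Rightarrow> real \<Rightarrow> complex" where
  "volterra_iterate p g 0 = g"
| "volterra_iterate p g (Suc n) = volterra p (volterra_iterate p g n)"

lemma continuous_on_volterra_iterate:
  "locally_integrable p \<Longrightarrow> continuous_on UNIV g \<Longrightarrow> continuous_on UNIV (volterra_iterate p g n)"
  by (induction n) (auto intro: continuous_on_volterra)

lemma volterra_iterate_reflect:
  "volterra_iterate p g n (- x) = volterra_iterate (\<lambda>s. p (- s)) (\<lambda>s. g (- s)) n x"
  by (induction n arbitrary: x) (simp_all add: volterra_reflect)

lemma volterra_iterate_bound_pos:
  assumes p: "locally_integrable p" and g: "continuous_on UNIV g" and "0 \<le> C"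
      and C: "\<And>s. 0 \<le> s \<Longrightarrow> s \<le> N \<Longrightarrow> norm (g s) \<le> C" and x: "0 \<le> x" "x \<le> N"
  shows "norm (volterra_iterate p g n x) \<le> C * (N * signed_integral (\<lambda>s. norm (p s)) x) ^ n / fact n"
  using x
proof (induction n arbitrary: x)
  case (Suc n)
  show ?case unfolding volterra_iterate.simps
    by (rule volterra_power_bound[OF p continuous_on_volterra_iterate[OF p g] \<open>0 \<le> C\<close> Suc.prems Suc.IH])
qed (use C in auto)

text \<open>One bound for all of [-N, N], the negative half being obtained by reflection. The
  factorial makes the series of iterates summable whatever the size of \<open>p\<close>.\<close>

lemma volterra_iterate_bound:
  assumes p: "locally_integrable p" and g: "continuous_on UNIV g" and "0 \<le> C"
      and C: "\<And>s. \<bar>s\<bar> \<le> N \<Longrightarrow> norm (g s) \<le> C" and x: "\<bar>x\<bar> \<le> N"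
  shows "norm (volterra_iterate p g n x) \<le> C * (N * integral {-N..N} (\<lambda>s. norm (p s))) ^ n / fact n"
proof -
  let ?I = "integral {-N..N} (\<lambda>s. norm (p s))"
  have w: "locally_integrable (\<lambda>s. norm (p s))" by (rule locally_integrable_norm[OF p])
  have N: "0 \<le> N" using x by linarith
  have sub: "0 \<le> integral {a..b} (\<lambda>s. norm (p s))" "integral {a..b} (\<lambda>s. norm (p s)) \<le> ?I"
    if "{a..b} \<subseteq> {-N..N}" for a b
    using that w by (auto intro!: Henstock_Kurzweil_Integration.integral_nonneg integral_subset_le
        locally_integrable_imp_integrable)
  have fin: "C * (N * J) ^ n / fact n \<le> C * (N * ?I) ^ n / fact n" if "0 \<le> J" "J \<le> ?I" for J
    using that N \<open>0 \<le> C\<close> by (intro divide_right_mono mult_left_mono power_mono) auto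
  show ?thesis
  proof (cases "0 \<le> x")
    case True
    then have "norm (volterra_iterate p g n x) \<le> C * (N * signed_integral (\<lambda>s. norm (p s)) x) ^ n / fact n"
      using volterra_iterate_bound_pos[OF p g \<open>0 \<le> C\<close>, of N x n] C x by auto
    also have "\<dots> \<le> C * (N * ?I) ^ n / fact n"
      using True x N by (intro fin) (auto simp: signed_integral_eq intro!: sub)
    finally show ?thesis .
  next
    case False
    have g': "continuous_on UNIV (\<lambda>s. g (- s))"
      by (rule continuous_on_compose2[OF g]) (auto intro: continuous_intros)
    have "norm (volterra_iterate p g n x) = norm (volterra_iterate (\<lambda>s. p (- s)) (\<lambda>s. g (- s)) n (- x))"
      using volterra_iterate_reflect[of p g n "- x"] by simp
    also have "\<dots> \<le> C * (N * signed_integral (\<lambda>s. norm (p (- s))) (- x)) ^ n / fact n"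
      using volterra_iterate_bound_pos[OF locally_integrable_reflect[OF p] g' \<open>0 \<le> C\<close>, of N "- x" n]
        C x False by auto
    also have "signed_integral (\<lambda>s. norm (p (- s))) (- x) = integral {x..0} (\<lambda>s. norm (p s))"
      using False Henstock_Kurzweil_Integration.integral_reflect_real[of 0 x "\<lambda>s. norm (p s)"]
      by (simp add: signed_integral_eq)
    also have "C * (N * \<dots>) ^ n / fact n \<le> C * (N * ?I) ^ n / fact n"
      using False x N by (intro fin sub) auto
    finally show ?thesis .
  qed
qed

text \<open>Neumann series. Its uniform convergence on every bounded interval gives a single
  continuous solution on the whole line.\<close>

theorem volterra_solvable:
  assumes p: "locally_integrable p" and g: "continuous_on UNIV g"
  obtains y where "continuous_on UNIV y" "\<And>x. y x = g x + volterra p y x"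
proof -
  define u where "u = volterra_iterate p g"
  define y where "y x = (\<Sum>n. u n x)" for x
  have cu: "continuous_on UNIV (u n)" for n
    unfolding u_def by (rule continuous_on_volterra_iterate[OF p g])
  have unif: "uniform_limit {-N..N} (\<lambda>n x. \<Sum>i<n. u i x) y sequentially" for N :: real
  proof -
    have "compact (g ` {-N..N})"
      by (intro compact_continuous_image continuous_on_subset[OF g]) auto
    then obtain C where C: "0 < C" "\<And>s. s \<in> {-N..N} \<Longrightarrow> norm (g s) \<le> C"
      using compact_imp_bounded[OF \<open>compact _\<close>] unfolding bounded_pos by auto
    show ?thesis
      unfolding y_def
    proof (rule Weierstrass_m_test)
      show "norm (u n x) \<le> C * ((N * integral {-N..N} (\<lambda>s. norm (p s))) ^ n / fact n)"
        if "x \<in> {-N..N}" for n x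
        using volterra_iterate_bound[OF p g less_imp_le[OF C(1)], of N x n] C(2) that
        by (simp add: u_def abs_le_iff)
      show "summable (\<lambda>n. C * ((N * integral {-N..N} (\<lambda>s. norm (p s))) ^ n / fact n))"
        using summable_exp[of "N * integral {-N..N} (\<lambda>s. norm (p s))"]
        by (intro summable_mult) (simp add: field_simps)
    qed
  qed
  have cpart: "continuous_on UNIV (\<lambda>x. \<Sum>i<n. u i x)" for n
    by (intro continuous_intros cu)
  have cyN: "continuous_on {-N..N} y" for N :: real
    by (rule uniform_limit_theorem[OF _ unif])
       (auto intro!: always_eventually continuous_on_subset[OF cpart])
  have cy: "continuous_on UNIV y"
  proof -
    have "isCont y x" for x
    proof (rule continuous_on_interior[OF cyN[of "\<bar>x\<bar> + 1"]])
      show "x \<in> interior {- (\<bar>x\<bar> + 1)..\<bar>x\<bar> + 1}" by (simp add: abs_if)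
    qed
    then show ?thesis by (simp add: continuous_at_imp_continuous_on)
  qed
  \<comment> \<open>The partial sums satisfy the equation up to an index shift, so the fixed point
    equation is the limit of these identities.\<close>
  have rec: "(\<Sum>i<Suc n. u i x) = g x + volterra p (\<lambda>x. \<Sum>i<n. u i x) x" for n x
  proof (induction n arbitrary: x)
    case 0
    have "signed_integral (\<lambda>_. 0) = (\<lambda>_. 0::complex)" by (rule ext) (simp add: signed_integral_def)
    then show ?case by (simp add: u_def volterra_def)
  next
    case (Suc n)
    have "u (Suc n) x = volterra p (\<lambda>x. (\<Sum>i<Suc n. u i x) - (\<Sum>i<n. u i x)) x"
      by (simp add: u_def)
    also have "\<dots> = volterra p (\<lambda>x. \<Sum>i<Suc n. u i x) x - volterra p (\<lambda>x. \<Sum>i<n. u i x) x"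
      by (rule volterra_diff[OF p cpart cpart])
    finally show ?case using Suc.IH[of x] by simp
  qed
  have "y x = g x + volterra p y x" for x
  proof -
    define N where "N = \<bar>x\<bar>"
    define K where "K = N * integral {-N..N} (\<lambda>s. norm (p s))"
    have N: "0 \<le> N" "\<bar>x\<bar> \<le> N" by (auto simp: N_def)
    have K: "0 \<le> K" unfolding K_def
      using N by (intro mult_nonneg_nonneg Henstock_Kurzweil_Integration.integral_nonneg
        locally_integrable_imp_integrable locally_integrable_norm p) auto
    \<comment> \<open>The case n = 1 of the iterate bound: \<open>volterra p\<close> is Lipschitz
      for the supremum norm on [-N, N], which allows the limit to be taken inside it.\<close>
    have small: "norm (volterra p v x) \<le> e * K"
      if v: "continuous_on UNIV v" "0 \<le> e" "\<And>s. \<bar>s\<bar> \<le> N \<Longrightarrow> norm (v s) \<le> e" for v e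
      using volterra_iterate_bound[OF p v N(2), of 1] by (simp add: K_def)
    have "(\<lambda>n. volterra p (\<lambda>x. \<Sum>i<n. u i x) x) \<longlonglongrightarrow> volterra p y x"
    proof (rule LIMSEQ_I)
      fix r :: real assume "0 < r"
      \<comment> \<open>\<open>K\<close> may be 0, hence the denominator
        \<open>K + 1\<close>.\<close>
      define e where "e = r / (K + 1)"
      have e: "0 < e" "e * K < r" using \<open>0 < r\<close> K by (auto simp: e_def field_simps)
      obtain n0 where n0: "\<And>n s. n \<ge> n0 \<Longrightarrow> s \<in> {-N..N} \<Longrightarrow> dist (\<Sum>i<n. u i s) (y s) < e"
        using uniform_limitD[OF unif e(1)] unfolding eventually_sequentially by blast
      have "norm (volterra p (\<lambda>x. \<Sum>i<n. u i x) x - volterra p y x) < r" if "n \<ge> n0" for n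
      proof -
        have "norm (volterra p (\<lambda>s. (\<Sum>i<n. u i s) - y s) x) \<le> e * K"
          using n0[OF that] e(1)
          by (intro small continuous_on_diff cpart cy) (auto simp: dist_norm abs_le_iff intro: less_imp_le)
        then show ?thesis using e volterra_diff[OF p cpart cy, of n x] by simp
      qed
      then show "\<exists>n0. \<forall>n\<ge>n0. norm (volterra p (\<lambda>x. \<Sum>i<n. u i x) x - volterra p y x) < r" by blast
    qed
    then have "(\<lambda>n. \<Sum>i<Suc n. u i x) \<longlonglongrightarrow> g x + volterra p y x"
      unfolding rec by (intro tendsto_intros)
    moreover have "(\<lambda>n. \<Sum>i<n. u i x) \<longlonglongrightarrow> y x"
      using tendsto_uniform_limitI[OF unif[of N], of x] N(2) by (simp add: abs_le_iff)
    ultimately show ?thesis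
      using LIMSEQ_unique LIMSEQ_Suc by blast
  qed
  with cy show ?thesis by (rule that)
qed

section \<open>Twice differentiable functions with absolutely continuous derivative\<close>

text \<open>\<open>hill_expr\<close> with its existential witnesses as arguments: \<open>y1\<close>
  is the derivative and \<open>h\<close> a version of the second derivative. The clause holding
  almost everywhere is absorbed into the choice of \<open>h\<close>, see
  \<open>hill_expr_iff\<close>.\<close>

definition has_ac_derivative ::
    "real \<Rightarrow> real \<Rightarrow> (real \<Rightarrow> complex) \<Rightarrow> (real \<Rightarrow> complex) \<Rightarrow> (real \<Rightarrow> complex) \<Rightarrow> bool" where
  "has_ac_derivative a b y y1 h \<longleftrightarrow>
     (\<forall>x\<in>{a..b}. (y has_vector_derivative y1 x) (at x within {a..b})) \<and>
     h absolutely_integrable_on {a..b} \<and>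
     (\<forall>x\<in>{a..b}. y1 x = y1 a + integral {a..x} h)"

lemma has_ac_derivativeD:
  assumes "has_ac_derivative a b y y1 h"
  shows "\<And>x. x \<in> {a..b} \<Longrightarrow> (y has_vector_derivative y1 x) (at x within {a..b})"
    and "h absolutely_integrable_on {a..b}"
    and "\<And>x. x \<in> {a..b} \<Longrightarrow> y1 x = y1 a + integral {a..x} h"
  using assms unfolding has_ac_derivative_def by blast+

lemma has_ac_derivative_continuous:
  assumes "has_ac_derivative a b y y1 h"
  shows "continuous_on {a..b} y" "continuous_on {a..b} y1"
proof -
  show "continuous_on {a..b} y"
    using has_ac_derivativeD(1)[OF assms] continuous_on_eq_continuous_within
      has_vector_derivative_continuous by blast
  show "continuous_on {a..b} y1"
    using has_ac_derivativeD[OF assms] indefinite_integral_continuous_on by blast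
qed

lemma has_ac_derivative_spike:
  assumes "has_ac_derivative a b y y1 h" "negligible N" "\<And>x. x \<in> {a..b} - N \<Longrightarrow> k x = h x"
  shows "has_ac_derivative a b y y1 k"
proof -
  have "k absolutely_integrable_on {a..b}"
    using has_ac_derivativeD(2)[OF assms(1)] assms(2,3) by (rule absolutely_integrable_spike)
  moreover have "integral {a..x} k = integral {a..x} h" if "x \<in> {a..b}" for x
    by (rule integral_spike[OF assms(2)]) (use that assms(3) in auto)
  ultimately show ?thesis
    using has_ac_derivativeD[OF assms(1)] unfolding has_ac_derivative_def by metis
qed

lemma has_ac_derivative_cong:
  assumes "has_ac_derivative a b y y1 h" "\<And>x. x \<in> {a..b} \<Longrightarrow> k x = h x"
  shows "has_ac_derivative a b y y1 k"
  using has_ac_derivative_spike[OF assms(1), of "{}" k] assms(2) by auto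

lemma has_ac_derivative_cong_fun:
  assumes "has_ac_derivative a b y y1 h"
      and "\<And>x. x \<in> {a..b} \<Longrightarrow> z x = y x" "\<And>x. x \<in> {a..b} \<Longrightarrow> z1 x = y1 x"
  shows "has_ac_derivative a b z z1 h"
  unfolding has_ac_derivative_def
proof (intro conjI ballI)
  show "(z has_vector_derivative z1 x) (at x within {a..b})" if "x \<in> {a..b}" for x
    using has_vector_derivative_transform[OF that assms(2) has_ac_derivativeD(1)[OF assms(1) that]]
      assms(3)[OF that] by simp
  show "z1 x = z1 a + integral {a..x} h" if "x \<in> {a..b}" for x
  proof -
    have "a \<in> {a..b}" using that by auto
    then show ?thesis using has_ac_derivativeD(3)[OF assms(1) that] assms(3) that by simp
  qed
qed (use has_ac_derivativeD(2)[OF assms(1)] in auto)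

lemma has_ac_derivative_initial:
  assumes "has_ac_derivative a b y y1 h" "c \<le> b"
  shows "has_ac_derivative a c y y1 h"
  unfolding has_ac_derivative_def
proof (intro conjI ballI)
  show "(y has_vector_derivative y1 x) (at x within {a..c})" if "x \<in> {a..c}" for x
    using has_ac_derivativeD(1)[OF assms(1), of x] that assms(2)
    by (auto intro: has_vector_derivative_within_subset)
  show "h absolutely_integrable_on {a..c}"
    using has_ac_derivativeD(2)[OF assms(1)] assms(2)
    by (auto intro: absolutely_integrable_on_subinterval)
  show "y1 x = y1 a + integral {a..x} h" if "x \<in> {a..c}" for x
    by (rule has_ac_derivativeD(3)[OF assms(1)]) (use that assms(2) in auto)
qed

lemma has_ac_derivative_lincomb:
  assumes "has_ac_derivative a b y y1 h" "has_ac_derivative a b z z1 k"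
  shows "has_ac_derivative a b (\<lambda>x. c * y x + d * z x) (\<lambda>x. c * y1 x + d * z1 x) (\<lambda>x. c * h x + d * k x)"
  unfolding has_ac_derivative_def
proof (intro conjI ballI)
  note D1 = has_ac_derivativeD[OF assms(1)] and D2 = has_ac_derivativeD[OF assms(2)]
  show "((\<lambda>x. c * y x + d * z x) has_vector_derivative c * y1 x + d * z1 x) (at x within {a..b})"
    if "x \<in> {a..b}" for x
    by (intro has_vector_derivative_add has_vector_derivative_mult_right D1(1) D2(1) that)
  show "(\<lambda>x. c * h x + d * k x) absolutely_integrable_on {a..b}"
    by (intro set_integral_add(1) absolutely_integrable_continuous_mult continuous_intros D1(2) D2(2))
  show "c * y1 x + d * z1 x = c * y1 a + d * z1 a + integral {a..x} (\<lambda>x. c * h x + d * k x)"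
    if "x \<in> {a..b}" for x
  proof -
    have "h integrable_on {a..x}" "k integrable_on {a..x}"
      using D1(2) D2(2) that by (auto simp: absolutely_integrable_on_def intro: integrable_on_subinterval)
    then have "integral {a..x} (\<lambda>x. c * h x + d * k x) = c * integral {a..x} h + d * integral {a..x} k"
      by (simp add: Henstock_Kurzweil_Integration.integral_add integrable_on_mult_right)
    then show ?thesis by (subst D1(3)[OF that], subst D2(3)[OF that]) (simp add: algebra_simps)
  qed
qed

text \<open>The second derivative matters only up to a null set, so the representative
  \<open>q y - f\<close> may be chosen, for which the differential equation holds at every
  point.\<close>

lemma hill_expr_iff:
  "hill_expr q a b y f \<longleftrightarrow> (\<exists>y1. has_ac_derivative a b y y1 (\<lambda>x. q x * y x - f x))"
proof
  assume "hill_expr q a b y f"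
  then obtain y1 y2 where y: "has_ac_derivative a b y y1 y2"
      and ae: "AE x in lebesgue_on {a..b}. f x = - y2 x + q x * y x"
    unfolding hill_expr_def has_ac_derivative_def by blast
  from ae have "AE x in lebesgue. x \<in> {a..b} \<longrightarrow> f x = - y2 x + q x * y x"
    by (simp add: AE_restrict_space_iff)
  then obtain N where "negligible N" "{x. \<not> (x \<in> {a..b} \<longrightarrow> f x = - y2 x + q x * y x)} \<subseteq> N"
    unfolding eventually_ae_filter_negligible by blast
  then have "has_ac_derivative a b y y1 (\<lambda>x. q x * y x - f x)"
    by (intro has_ac_derivative_spike[OF y]) auto
  then show "\<exists>y1. has_ac_derivative a b y y1 (\<lambda>x. q x * y x - f x)" by blast
next
  assume "\<exists>y1. has_ac_derivative a b y y1 (\<lambda>x. q x * y x - f x)"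
  then obtain y1 where y1: "has_ac_derivative a b y y1 (\<lambda>x. q x * y x - f x)" by blast
  show "hill_expr q a b y f"
  proof -
    have "AE x in lebesgue_on {a..b}. f x = - (q x * y x - f x) + q x * y x" by simp
    with y1 show ?thesis unfolding hill_expr_def has_ac_derivative_def by blast
  qed
qed

text \<open>The product rule for \<open>y1 z\<close> and for \<open>y z1\<close> produces the same
  term \<open>y1 z1\<close>, which cancels on subtraction.\<close>

lemma lagrange_identity:
  assumes "a \<le> b" and y: "has_ac_derivative a b y y1 h" and z: "has_ac_derivative a b z z1 k"
  shows "integral {a..b} (\<lambda>x. h x * z x - y x * k x)
       = (y1 b * z b - y b * z1 b) - (y1 a * z a - y a * z1 a)"
proof -
  note Dy = has_ac_derivativeD[OF y] and Dz = has_ac_derivativeD[OF z]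
  note cy = has_ac_derivative_continuous[OF y] and cz = has_ac_derivative_continuous[OF z]
  \<comment> \<open>To be factors in the product rule, \<open>y\<close> and \<open>z\<close> must
    themselves be presented as indefinite integrals of \<open>y1\<close> and
    \<open>z1\<close>.\<close>
  have ftc: "u x = u a + integral {a..x} u1"
    if u: "has_ac_derivative a b u u1 v" and x: "x \<in> {a..b}" for u u1 v x
  proof -
    have "(u1 has_integral u x - u a) {a..x}"
      using x has_ac_derivativeD(1)[OF u]
      by (intro fundamental_theorem_of_calculus)
         (auto intro: has_vector_derivative_within_subset[of u _ _ "{a..b}"])
    then show ?thesis by (simp add: integral_unique)
  qed
  have ai: "y1 absolutely_integrable_on {a..b}" "z1 absolutely_integrable_on {a..b}"
    using cy cz by (auto intro: absolutely_integrable_continuous_real)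
  have 1: "integral {a..b} (\<lambda>x. h x * z x + y1 x * z1 x) = y1 b * z b - y1 a * z a"
    by (rule integral_product_rule[OF \<open>a \<le> b\<close> Dy(2) ai(2) Dy(3) ftc[OF z]])
  have 2: "integral {a..b} (\<lambda>x. y1 x * z1 x + y x * k x) = y b * z1 b - y a * z1 a"
    by (rule integral_product_rule[OF \<open>a \<le> b\<close> ai(1) Dz(2) ftc[OF y] Dz(3)])
  have i: "(\<lambda>x. h x * z x) integrable_on {a..b}" "(\<lambda>x. y x * k x) integrable_on {a..b}"
       "(\<lambda>x. y1 x * z1 x) integrable_on {a..b}"
    using absolutely_integrable_mult_continuous[OF cz(1) Dy(2)]
      absolutely_integrable_continuous_mult[OF cy(1) Dz(2)]
    by (auto simp: absolutely_integrable_on_def intro: integrable_continuous_real continuous_on_mult cy cz)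
  have "integral {a..b} (\<lambda>x. h x * z x - y x * k x)
      = integral {a..b} (\<lambda>x. h x * z x + y1 x * z1 x) - integral {a..b} (\<lambda>x. y1 x * z1 x + y x * k x)"
    using i by (simp add: Henstock_Kurzweil_Integration.integral_add
        Henstock_Kurzweil_Integration.integral_diff)
  then show ?thesis unfolding 1 2 by (simp add: algebra_simps)
qed

section \<open>The fundamental solutions\<close>

locale hill_potential =
  fixes q :: "real \<Rightarrow> complex"
  assumes periodic: "\<And>x. q (x + 1) = q x"
    and integrable: "q absolutely_integrable_on {0..1}"
begin

lemma locally_integrable_potential: "locally_integrable q"
proof -
  have per: "q (x + real n) = q x" for x n
    using periodic[of "x + real k" for k] by (induction n) (auto simp: add_ac)
  have unit: "q absolutely_integrable_on {c..c + 1}" if "c \<in> \<int>" for c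
  proof -
    obtain k :: int where k: "c = of_int k" using \<open>c \<in> \<int>\<close> by (auto simp: Ints_def)
    have q: "q (x - c) = q x" for x
    proof (cases "0 \<le> k")
      case True
      then show ?thesis using per[of "x - c" "nat k"] k by simp
    next
      case False
      then show ?thesis using per[of x "nat (- k)"] k by simp
    qed
    have "q integrable_on {c..c + 1}" "(\<lambda>x. norm (q x)) integrable_on {c..c + 1}"
      using integrable_shift_cbox[of q 0 1 "- c"] integrable_shift_cbox[of "\<lambda>x. norm (q x)" 0 1 "- c"]
        integrable q by (simp_all add: add.commute absolutely_integrable_on_def)
    then show ?thesis by (simp add: absolutely_integrable_on_def)
  qed
  have big: "q absolutely_integrable_on {- real n..real n}" for n
  proof (induction n)
    case 0
    show ?case using absolutely_integrable_negligible[of "{0::real}" q] by simp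
  next
    case (Suc n)
    have "q absolutely_integrable_on {- real (Suc n)..- real n}"
      using unit[of "- real (Suc n)"] by simp
    moreover have "q absolutely_integrable_on {real n..real (Suc n)}"
      using unit[of "real n"] by (simp add: add.commute)
    ultimately show ?case
      using absolutely_integrable_on_combine[where f = q and a = "- real (Suc n)" and c = "- real n" and b = "real (Suc n)"]
        absolutely_integrable_on_combine[where f = q and a = "- real n" and c = "real n" and b = "real (Suc n)"] Suc
      by simp
  qed
  show ?thesis
    unfolding locally_integrable_def
  proof (intro allI)
    fix a b :: real
    obtain n :: nat where "max \<bar>a\<bar> \<bar>b\<bar> \<le> real n" using real_arch_simple by blast
    then show "q absolutely_integrable_on {a..b}"
      by (intro absolutely_integrable_on_subinterval[OF big[of n]]) auto
  qed
qed

text \<open>\<open>f\<close> is the inhomogeneity in l(y) = \<mu> y + f: zero for the fundamental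
  solutions, and a cut-off right-hand side when an equation for \<open>L_t\<close> is solved. The
  derivative is read off from the Volterra equation, whose outer integrands are continuous.\<close>

lemma solution_exists:
  assumes f: "locally_integrable f"
  obtains y y1 where "\<And>x. (y has_vector_derivative y1 x) (at x)" "y 0 = \<alpha>" "y1 0 = \<beta>"
    "\<And>a b. has_ac_derivative a b y y1 (\<lambda>x. (q x - \<mu>) * y x - f x)"
proof -
  let ?p = "\<lambda>x. q x - \<mu>"
  have p: "locally_integrable ?p"
    by (intro locally_integrable_diff locally_integrable_potential locally_integrable_continuous
        continuous_intros)
  have cF: "continuous_on UNIV (signed_integral f)" by (rule continuous_on_signed_integral[OF f])
  have cg: "continuous_on UNIV (\<lambda>x. \<alpha> + \<beta> * of_real x - signed_integral (signed_integral f) x)"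
    by (intro continuous_intros continuous_on_signed_integral locally_integrable_continuous cF)
  obtain y where cy: "continuous_on UNIV y"
    and y: "\<And>x. y x = \<alpha> + \<beta> * of_real x - signed_integral (signed_integral f) x + volterra ?p y x"
    using volterra_solvable[OF p cg] by blast
  have py: "locally_integrable (\<lambda>x. ?p x * y x)" by (intro locally_integrable_mult_continuous p cy)
  define y1 where "y1 x = \<beta> - signed_integral f x + signed_integral (\<lambda>x. ?p x * y x) x" for x
  have y': "(y has_vector_derivative y1 x) (at x)" for x
  proof -
    have of_real: "(of_real has_vector_derivative (1::complex)) (at x)"
      using has_vector_derivative_of_real[OF DERIV_ident[of "at x"]] by simp
    have "((\<lambda>x. \<alpha> + \<beta> * of_real x - signed_integral (signed_integral f) x
         + signed_integral (signed_integral (\<lambda>x. ?p x * y x)) x) has_vector_derivative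
         0 + \<beta> * 1 - signed_integral f x + signed_integral (\<lambda>x. ?p x * y x) x) (at x)"
      by (intro has_vector_derivative_add has_vector_derivative_diff has_vector_derivative_mult_right
         has_vector_derivative_const signed_integral_has_vector_derivative cF
         continuous_on_signed_integral py of_real)
    moreover have "y = (\<lambda>x. \<alpha> + \<beta> * of_real x - signed_integral (signed_integral f) x
         + signed_integral (signed_integral (\<lambda>x. ?p x * y x)) x)"
      using y unfolding volterra_def by blast
    ultimately show ?thesis unfolding y1_def by (metis add_0 mult_1_right)
  qed
  have "has_ac_derivative a b y y1 (\<lambda>x. ?p x * y x - f x)" for a b
    unfolding has_ac_derivative_def
  proof (intro conjI ballI)
    show "(y has_vector_derivative y1 x) (at x within {a..b})" for x
      using y' by (rule has_vector_derivative_at_within)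
    show "(\<lambda>x. ?p x * y x - f x) absolutely_integrable_on {a..b}"
      by (intro locally_integrableD locally_integrable_diff py f)
    show "y1 x = y1 a + integral {a..x} (\<lambda>x. ?p x * y x - f x)" if "x \<in> {a..b}" for x
      unfolding y1_def
      using signed_integral_diff[OF locally_integrable_diff[OF py f], of a x] that
      unfolding signed_integral_minus_diff[OF py f] by (simp add: diff_eq_eq add_ac)
  qed
  moreover have "y 0 = \<alpha>" "y1 0 = \<beta>" using y[of 0] by (auto simp: y1_def volterra_def)
  ultimately show ?thesis using that y' by blast
qed

lemma wronskian_constant:
  assumes "a \<le> b" and "has_ac_derivative a b y y1 (\<lambda>x. (q x - \<mu>) * y x)"
      and "has_ac_derivative a b z z1 (\<lambda>x. (q x - \<mu>) * z x)"
  shows "y1 b * z b - y b * z1 b = y1 a * z a - y a * z1 a"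
proof -
  have "(\<lambda>x. (q x - \<mu>) * y x * z x - y x * ((q x - \<mu>) * z x)) = (\<lambda>x. 0)" by (rule ext) simp
  then show ?thesis using lagrange_identity[OF assms] by simp
qed

lemma hill_solution_iff:
  "hill_solution q \<mu> y \<longleftrightarrow>
    (\<forall>a b. has_ac_derivative a b y (\<lambda>x. vector_derivative y (at x)) (\<lambda>x. (q x - \<mu>) * y x))"
proof
  assume *: "hill_solution q \<mu> y"
  show "\<forall>a b. has_ac_derivative a b y (\<lambda>x. vector_derivative y (at x)) (\<lambda>x. (q x - \<mu>) * y x)"
  proof (intro allI)
    fix a b :: real
    \<comment> \<open>On the enlarged interval every point of [a, b] is interior, so the
      one-interval derivative is the two-sided one. The maximum covers the empty intervals with b <
      a.\<close>
    obtain z1 where z1: "has_ac_derivative (a - 1) (max a b + 1) y z1 (\<lambda>x. q x * y x - \<mu> * y x)"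
    proof -
      have "a - 1 < max a b + 1" by simp
      then have "hill_expr q (a - 1) (max a b + 1) y (\<lambda>x. \<mu> * y x)"
        using * unfolding hill_solution_def by blast
      then show ?thesis using that unfolding hill_expr_iff by blast
    qed
    have vd: "vector_derivative y (at x) = z1 x" if "x \<in> {a..max a b}" for x
      using has_ac_derivativeD(1)[OF z1, of x] at_within_Icc_at[of "a - 1" x "max a b + 1"] that
      by (auto intro!: vector_derivative_at)
    have h: "(\<lambda>x. q x * y x - \<mu> * y x) integrable_on {a - 1..max a b + 1}"
      using has_ac_derivativeD(2)[OF z1] absolutely_integrable_on_def by blast
    have "has_ac_derivative a b y z1 (\<lambda>x. q x * y x - \<mu> * y x)"
      unfolding has_ac_derivative_def
    proof (intro conjI ballI)
      show "(y has_vector_derivative z1 x) (at x within {a..b})" if "x \<in> {a..b}" for x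
        using has_ac_derivativeD(1)[OF z1, of x] that
        by (auto intro: has_vector_derivative_within_subset)
      show "(\<lambda>x. q x * y x - \<mu> * y x) absolutely_integrable_on {a..b}"
        by (rule absolutely_integrable_on_subinterval[OF has_ac_derivativeD(2)[OF z1]]) auto
      show "z1 x = z1 a + integral {a..x} (\<lambda>x. q x * y x - \<mu> * y x)" if x: "x \<in> {a..b}" for x
      proof -
        have "integral {a - 1..a} (\<lambda>x. q x * y x - \<mu> * y x) + integral {a..x} (\<lambda>x. q x * y x - \<mu> * y x)
            = integral {a - 1..x} (\<lambda>x. q x * y x - \<mu> * y x)"
          using x by (intro Henstock_Kurzweil_Integration.integral_combine)
            (auto intro: integrable_on_subinterval[OF h])
        then show ?thesis
          using x by (subst has_ac_derivativeD(3)[OF z1, of x], simp,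
              subst has_ac_derivativeD(3)[OF z1, of a]) (simp_all add: algebra_simps)
      qed
    qed
    then have "has_ac_derivative a b y z1 (\<lambda>x. (q x - \<mu>) * y x)"
      by (simp add: left_diff_distrib)
    then show "has_ac_derivative a b y (\<lambda>x. vector_derivative y (at x)) (\<lambda>x. (q x - \<mu>) * y x)"
      by (rule has_ac_derivative_cong_fun) (use vd in auto)
  qed
next
  assume "\<forall>a b. has_ac_derivative a b y (\<lambda>x. vector_derivative y (at x)) (\<lambda>x. (q x - \<mu>) * y x)"
  then show "hill_solution q \<mu> y"
    unfolding hill_solution_def hill_expr_iff left_diff_distrib by blast
qed

text \<open>The Wronskians of \<open>y\<close> with \<open>u\<close> and with \<open>v\<close> are
  constant, hence known from the data at 0. Cramer's rule, with the Wronskian of \<open>u\<close>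
  and \<open>v\<close>, recovers \<open>y x\<close> and \<open>y1 x\<close>. This gives uniqueness
  without Gronwall's lemma, on either side of 0.\<close>

lemma solution_representation:
  assumes y: "has_ac_derivative (min 0 x) (max 0 x) y y1 (\<lambda>x. (q x - \<mu>) * y x)"
      and u: "\<And>a b. has_ac_derivative a b u u1 (\<lambda>x. (q x - \<mu>) * u x)" "u 0 = 1" "u1 0 = 0"
      and v: "\<And>a b. has_ac_derivative a b v v1 (\<lambda>x. (q x - \<mu>) * v x)" "v 0 = 0" "v1 0 = 1"
  shows "y x = y 0 * u x + y1 0 * v x" "y1 x = y 0 * u1 x + y1 0 * v1 x"
proof -
  have W: "z1 x * w x - z x * w1 x = z1 0 * w 0 - z 0 * w1 0"
    if z: "has_ac_derivative (min 0 x) (max 0 x) z z1 (\<lambda>x. (q x - \<mu>) * z x)"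
      and w: "\<And>a b. has_ac_derivative a b w w1 (\<lambda>x. (q x - \<mu>) * w x)" for z z1 w w1
    using wronskian_constant[OF _ z w] by (cases "0 \<le> x") (auto simp: min_def max_def)
  have 1: "y1 x * u x - y x * u1 x = y1 0"
    using W[OF y u(1)] u by simp
  have 2: "y1 x * v x - y x * v1 x = - y 0"
    using W[OF y v(1)] v by simp
  have 3: "u1 x * v x - u x * v1 x = - 1"
    using W[OF u(1) v(1)] u v by simp
  have "y x = y x * - (u1 x * v x - u x * v1 x)" unfolding 3 by simp
  also have "\<dots> = (y1 x * u x - y x * u1 x) * v x - (y1 x * v x - y x * v1 x) * u x"
    by (simp add: algebra_simps)
  finally show "y x = y 0 * u x + y1 0 * v x" unfolding 1 2 by simp
  have "y1 x = y1 x * - (u1 x * v x - u x * v1 x)" unfolding 3 by simp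
  also have "\<dots> = (y1 x * u x - y x * u1 x) * v1 x - (y1 x * v x - y x * v1 x) * u1 x"
    by (simp add: algebra_simps)
  finally show "y1 x = y 0 * u1 x + y1 0 * v1 x" unfolding 1 2 by simp
qed

text \<open>Justifies the definite descriptions in \<open>theta\<close> and \<open>phi\<close>. For
  uniqueness every solution is written as the same combination of two fixed ones.\<close>

lemma fundamental_solution:
  "\<exists>!y. hill_solution q \<mu> y \<and> y 0 = \<alpha> \<and> vector_derivative y (at 0) = \<beta>"
proof (rule ex_ex1I)
  have ex: "\<exists>y. hill_solution q \<mu> y \<and> y 0 = \<alpha> \<and> vector_derivative y (at 0) = \<beta>" for \<alpha> \<beta>
  proof -
    have "locally_integrable (\<lambda>_::real. 0::complex)"
      by (intro locally_integrable_continuous continuous_intros)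
    then obtain y y1 where y: "\<And>x. (y has_vector_derivative y1 x) (at x)" "y 0 = \<alpha>" "y1 0 = \<beta>"
       "\<And>a b. has_ac_derivative a b y y1 (\<lambda>x. (q x - \<mu>) * y x - 0)"
      by (rule solution_exists[of "\<lambda>_. 0" \<alpha> \<beta> \<mu>]) blast
    have "y1 = (\<lambda>x. vector_derivative y (at x))"
      by (rule ext) (rule vector_derivative_at[OF y(1), symmetric])
    with y show ?thesis unfolding hill_solution_iff by auto
  qed
  then show "\<exists>y. hill_solution q \<mu> y \<and> y 0 = \<alpha> \<and> vector_derivative y (at 0) = \<beta>" .
  obtain u where u: "hill_solution q \<mu> u" "u 0 = 1" "vector_derivative u (at 0) = 0"
    using ex by blast
  obtain v where v: "hill_solution q \<mu> v" "v 0 = 0" "vector_derivative v (at 0) = 1"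
    using ex by blast
  have rep: "y = (\<lambda>x. \<alpha> * u x + \<beta> * v x)"
    if "hill_solution q \<mu> y \<and> y 0 = \<alpha> \<and> vector_derivative y (at 0) = \<beta>" for y
  proof
    fix x
    show "y x = \<alpha> * u x + \<beta> * v x"
    proof -
      have ac: "has_ac_derivative a b w (\<lambda>x. vector_derivative w (at x)) (\<lambda>x. (q x - \<mu>) * w x)"
        if "hill_solution q \<mu> w" for a b w
        using that unfolding hill_solution_iff by blast
      from that have y: "hill_solution q \<mu> y" "y 0 = \<alpha>" "vector_derivative y (at 0) = \<beta>" by blast+
      from solution_representation(1)[OF ac[OF y(1)] ac[OF u(1)] u(2,3) ac[OF v(1)] v(2,3), of x]
      show ?thesis unfolding y(2,3) .
    qed
  qed
  show "y = z" if "hill_solution q \<mu> y \<and> y 0 = \<alpha> \<and> vector_derivative y (at 0) = \<beta>"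
    "hill_solution q \<mu> z \<and> z 0 = \<alpha> \<and> vector_derivative z (at 0) = \<beta>" for y z
    using rep[OF that(1)] rep[OF that(2)] by simp
qed

abbreviation "th \<equiv> theta q"
abbreviation "ph \<equiv> phi q"
abbreviation "th1 \<mu> x \<equiv> vector_derivative (theta q \<mu>) (at x)"
abbreviation "ph1 \<mu> x \<equiv> vector_derivative (phi q \<mu>) (at x)"

lemma theta_solution:
  "hill_solution q \<mu> (th \<mu>) \<and> th \<mu> 0 = 1 \<and> th1 \<mu> 0 = 0"
  using theI'[OF fundamental_solution[of \<mu> 1 0]] unfolding theta_def .

lemma phi_solution:
  "hill_solution q \<mu> (ph \<mu>) \<and> ph \<mu> 0 = 0 \<and> ph1 \<mu> 0 = 1"
  using theI'[OF fundamental_solution[of \<mu> 0 1]] unfolding phi_def .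

lemma theta_0 [simp]: "th \<mu> 0 = 1" "th1 \<mu> 0 = 0"
  using theta_solution by blast+

lemma phi_0 [simp]: "ph \<mu> 0 = 0" "ph1 \<mu> 0 = 1"
  using phi_solution by blast+

lemma theta_ac: "has_ac_derivative a b (th \<mu>) (th1 \<mu>) (\<lambda>x. (q x - \<mu>) * th \<mu> x)"
  using theta_solution[of \<mu>] unfolding hill_solution_iff by blast

lemma phi_ac: "has_ac_derivative a b (ph \<mu>) (ph1 \<mu>) (\<lambda>x. (q x - \<mu>) * ph \<mu> x)"
  using phi_solution[of \<mu>] unfolding hill_solution_iff by blast

lemma continuous_on_fundamental [continuous_intros]:
  "continuous_on {a..b} (th \<mu>)" "continuous_on {a..b} (ph \<mu>)"
  using has_ac_derivative_continuous theta_ac phi_ac by blast+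

lemma wronskian: "th \<mu> x * ph1 \<mu> x - th1 \<mu> x * ph \<mu> x = 1"
proof (cases "0 \<le> x")
  case True
  show ?thesis using wronskian_constant[OF True theta_ac phi_ac, of \<mu>] by (simp add: algebra_simps)
next
  case False
  then have "x \<le> 0" by simp
  show ?thesis using wronskian_constant[OF \<open>x \<le> 0\<close> theta_ac phi_ac, of \<mu>] by (simp add: algebra_simps)
qed

text \<open>For eigenfunctions, which solve the equation on [0, 1] only.\<close>

lemma solution_on_unit_interval:
  assumes "has_ac_derivative 0 1 y y1 (\<lambda>x. (q x - \<mu>) * y x)" "x \<in> {0..1}"
  shows "y x = y 0 * th \<mu> x + y1 0 * ph \<mu> x" "y1 x = y 0 * th1 \<mu> x + y1 0 * ph1 \<mu> x"
proof -
  have *: "has_ac_derivative (min 0 x) (max 0 x) y y1 (\<lambda>x. (q x - \<mu>) * y x)"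
    using has_ac_derivative_initial[OF assms(1), of x] assms(2) by (simp add: min_absorb1 max_absorb2)
  show "y x = y 0 * th \<mu> x + y1 0 * ph \<mu> x" "y1 x = y 0 * th1 \<mu> x + y1 0 * ph1 \<mu> x"
    using solution_representation[OF * theta_ac theta_0 phi_ac phi_0] by blast+
qed

lemma vector_derivative_endpoints:
  assumes "has_ac_derivative 0 1 y y1 h"
  shows "vector_derivative y (at 0 within {0..1}) = y1 0"
        "vector_derivative y (at 1 within {0..1}) = y1 1"
  by (rule vector_derivative_within_closed_interval;
      use has_ac_derivativeD(1)[OF assms] in simp)+


section \<open>Dependence on the spectral parameter\<close>

text \<open>The Lagrange identity with a combination c \<theta> + d \<phi>. If c and -d are the
  values of \<phi> and \<theta> at \<open>x\<close>, the combination vanishes at \<open>x\<close>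
  with derivative -1, which isolates \<open>y x\<close>; if they are the values of the derivatives,
  it equals 1 at \<open>x\<close> with derivative 0, which isolates \<open>y1 x\<close>.\<close>

lemma variation_of_constants:
  assumes "0 \<le> x" and y: "has_ac_derivative 0 x y y1 (\<lambda>s. (q s - \<mu>) * y s - f s)"
  shows "y x = y 0 * th \<mu> x + y1 0 * ph \<mu> x
           - integral {0..x} (\<lambda>s. f s * (ph \<mu> x * th \<mu> s - th \<mu> x * ph \<mu> s))"
    and "y1 x = y 0 * th1 \<mu> x + y1 0 * ph1 \<mu> x
           - integral {0..x} (\<lambda>s. f s * (ph1 \<mu> x * th \<mu> s - th1 \<mu> x * ph \<mu> s))"
proof -
  have L: "- integral {0..x} (\<lambda>s. f s * (c * th \<mu> s + d * ph \<mu> s))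
      = (y1 x * (c * th \<mu> x + d * ph \<mu> x) - y x * (c * th1 \<mu> x + d * ph1 \<mu> x))
        - (y1 0 * c - y 0 * d)" for c d
  proof -
    have "(\<lambda>s. ((q s - \<mu>) * y s - f s) * (c * th \<mu> s + d * ph \<mu> s)
          - y s * (c * ((q s - \<mu>) * th \<mu> s) + d * ((q s - \<mu>) * ph \<mu> s)))
        = (\<lambda>s. - (f s * (c * th \<mu> s + d * ph \<mu> s)))"
      by (rule ext) (simp add: algebra_simps)
    then show ?thesis
      using lagrange_identity[OF \<open>0 \<le> x\<close> y has_ac_derivative_lincomb[OF theta_ac[where \<mu> = \<mu>] phi_ac[where \<mu> = \<mu>]], of c d]
      by simp
  qed
  have W: "th \<mu> x * ph1 \<mu> x = 1 + th1 \<mu> x * ph \<mu> x"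
    using wronskian[of \<mu> x] by (simp add: algebra_simps)
  have K: "ph \<mu> x * th1 \<mu> x + - th \<mu> x * ph1 \<mu> x = - 1" "ph \<mu> x * th \<mu> x + - th \<mu> x * ph \<mu> x = 0"
    using W by (simp_all add: algebra_simps)
  show "y x = y 0 * th \<mu> x + y1 0 * ph \<mu> x
           - integral {0..x} (\<lambda>s. f s * (ph \<mu> x * th \<mu> s - th \<mu> x * ph \<mu> s))"
    using L[of "ph \<mu> x" "- th \<mu> x"] unfolding K by (simp add: algebra_simps)
  have K: "ph1 \<mu> x * th \<mu> x + - th1 \<mu> x * ph \<mu> x = 1" "ph1 \<mu> x * th1 \<mu> x + - th1 \<mu> x * ph1 \<mu> x = 0"
    using W by (simp_all add: algebra_simps)
  show "y1 x = y 0 * th1 \<mu> x + y1 0 * ph1 \<mu> x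
           - integral {0..x} (\<lambda>s. f s * (ph1 \<mu> x * th \<mu> s - th1 \<mu> x * ph \<mu> s))"
    using L[of "ph1 \<mu> x" "- th1 \<mu> x"] unfolding K by (simp add: algebra_simps)
qed

text \<open>A solution for \<open>z\<close> solves the equation for \<mu> with inhomogeneity
  \<open>(z - \<mu>) * y\<close>. The resulting formula is exact, not an expansion.\<close>

lemma solution_difference:
  assumes "0 \<le> x" and y: "has_ac_derivative 0 x y y1 (\<lambda>s. (q s - z) * y s)"
  shows "y x = y 0 * th \<mu> x + y1 0 * ph \<mu> x
           - (z - \<mu>) * integral {0..x} (\<lambda>s. y s * (ph \<mu> x * th \<mu> s - th \<mu> x * ph \<mu> s))"
    and "y1 x = y 0 * th1 \<mu> x + y1 0 * ph1 \<mu> x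
           - (z - \<mu>) * integral {0..x} (\<lambda>s. y s * (ph1 \<mu> x * th \<mu> s - th1 \<mu> x * ph \<mu> s))"
proof -
  have "has_ac_derivative 0 x y y1 (\<lambda>s. (q s - \<mu>) * y s - (z - \<mu>) * y s)"
    by (rule has_ac_derivative_cong[OF y]) (simp add: algebra_simps)
  from variation_of_constants[OF assms(1) this]
  show "y x = y 0 * th \<mu> x + y1 0 * ph \<mu> x
           - (z - \<mu>) * integral {0..x} (\<lambda>s. y s * (ph \<mu> x * th \<mu> s - th \<mu> x * ph \<mu> s))"
    and "y1 x = y 0 * th1 \<mu> x + y1 0 * ph1 \<mu> x
           - (z - \<mu>) * integral {0..x} (\<lambda>s. y s * (ph1 \<mu> x * th \<mu> s - th1 \<mu> x * ph \<mu> s))"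
    by (simp_all add: mult.assoc)
qed

lemma bounded_continuous_Icc:
  fixes f :: "real \<Rightarrow> complex"
  assumes "continuous_on {0..1} f"
  obtains B where "0 < B" "\<And>s. s \<in> {0..1} \<Longrightarrow> norm (f s) \<le> B"
  using compact_imp_bounded[OF compact_continuous_image[OF assms compact_Icc]]
  unfolding bounded_pos by auto

text \<open>The difference formula bounds the change of the solution by norm (z - \<mu>) times B
  times the maximum of the solution for \<open>z\<close>. For norm (z - \<mu>) < 1/(2 B) this is at
  most half that maximum, which is therefore bounded uniformly in \<open>z\<close>.\<close>

lemma solution_lipschitz_in_parameter:
  assumes y: "\<And>z. has_ac_derivative 0 1 (y z) (y1 z) (\<lambda>s. (q s - z) * y z s)"
      and y0: "\<And>z. y z 0 = \<alpha>" "\<And>z. y1 z 0 = \<beta>"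
  shows "\<exists>C. \<exists>\<delta>>0. \<forall>z x. norm (z - \<mu>) < \<delta> \<longrightarrow> x \<in> {0..1} \<longrightarrow>
     norm (y z x - y \<mu> x) \<le> C * norm (z - \<mu>)"
proof -
  obtain A where A: "0 < A" "\<And>s. s \<in> {0..1} \<Longrightarrow> norm (th \<mu> s) \<le> A"
    by (rule bounded_continuous_Icc[of "th \<mu>"]) (auto intro: continuous_intros)
  obtain A' where A': "0 < A'" "\<And>s. s \<in> {0..1} \<Longrightarrow> norm (ph \<mu> s) \<le> A'"
    by (rule bounded_continuous_Icc[of "ph \<mu>"]) (auto intro: continuous_intros)
  have cy: "continuous_on {0..1} (y z)" for z
    using has_ac_derivative_continuous[OF y] by blast
  obtain M where M: "0 < M" "\<And>s. s \<in> {0..1} \<Longrightarrow> norm (y \<mu> s) \<le> M"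
    by (rule bounded_continuous_Icc[of "y \<mu>"]) (auto intro: cy)
  define B where "B = A' * A + A * A'"
  have "0 < B" using A A' by (simp add: B_def add_pos_pos)
  have diff: "norm (y z x - y \<mu> x) \<le> norm (z - \<mu>) * (S * B)"
    if x: "x \<in> {0..1}" and S: "\<And>s. s \<in> {0..1} \<Longrightarrow> norm (y z s) \<le> S" for z x S
  proof -
    have "0 \<le> S" using S[of 0] norm_ge_zero[of "y z 0"] by (simp del: norm_ge_zero)
    let ?k = "\<lambda>s. y z s * (ph \<mu> x * th \<mu> s - th \<mu> x * ph \<mu> s)"
    have "norm (integral {0..x} ?k) \<le> integral {0..x} (\<lambda>s. S * B)"
    proof (rule Henstock_Kurzweil_Integration.integral_norm_bound_integral)
      show "?k integrable_on {0..x}" using x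
        by (intro integrable_continuous_real continuous_intros continuous_on_subset[OF cy]) auto
      show "norm (?k s) \<le> S * B" if "s \<in> {0..x}" for s
      proof -
        have s: "s \<in> {0..1}" using that x by auto
        have "norm (ph \<mu> x * th \<mu> s - th \<mu> x * ph \<mu> s) \<le> norm (ph \<mu> x * th \<mu> s) + norm (th \<mu> x * ph \<mu> s)"
          by (rule norm_triangle_ineq4)
        also have "\<dots> \<le> B" unfolding B_def norm_mult
          using A A' x s by (intro add_mono mult_mono) auto
        finally show ?thesis unfolding norm_mult using S[OF s] \<open>0 \<le> S\<close> by (intro mult_mono) auto
      qed
    qed auto
    also have "\<dots> \<le> S * B" 
      using mult_right_mono[of x 1 "S * B"] x \<open>0 \<le> S\<close> \<open>0 < B\<close>
      by (simp add: mult_ac)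
    finally have *: "norm (integral {0..x} ?k) \<le> S * B" .
    have "y z x - y \<mu> x = - ((z - \<mu>) * integral {0..x} ?k)"
      using solution_difference(1)[OF _ has_ac_derivative_initial[OF y], of x z \<mu>]
        solution_on_unit_interval(1)[OF y x, of \<mu>] x y0 by simp
    then show ?thesis using * by (simp add: norm_mult mult_left_mono)
  qed
  show ?thesis
  proof (rule exI[of _ "2 * M * B"], rule exI[of _ "1 / (2 * B)"], intro conjI allI impI)
    fix z x assume z: "norm (z - \<mu>) < 1 / (2 * B)" and x: "x \<in> {0..1::real}"
    have "\<exists>m\<in>{0..1}. \<forall>s\<in>{0..1}. norm (y z s) \<le> norm (y z m)"
      by (intro continuous_attains_sup continuous_intros cy) auto
    then obtain m where m: "m \<in> {0..1}" "\<And>s. s \<in> {0..1} \<Longrightarrow> norm (y z s) \<le> norm (y z m)"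
      by blast
    have "norm (y z m) \<le> norm (y \<mu> m) + norm (y z m - y \<mu> m)" by norm
    also have "\<dots> \<le> M + norm (z - \<mu>) * (norm (y z m) * B)"
      by (intro add_mono M m diff) auto
    also have "norm (z - \<mu>) * (norm (y z m) * B) \<le> 1 / (2 * B) * (norm (y z m) * B)"
      using z \<open>0 < B\<close> by (intro mult_right_mono) auto
    also have "\<dots> = norm (y z m) / 2" using \<open>0 < B\<close> by simp
    finally have "norm (y z m) \<le> 2 * M" by simp
    then have "norm (y z s) \<le> 2 * M" if "s \<in> {0..1}" for s
      using m(2)[OF that] by simp
    then show "norm (y z x - y \<mu> x) \<le> 2 * M * B * norm (z - \<mu>)"
      using diff[OF x, of z "2 * M"] by (simp add: mult_ac)
  qed (use \<open>0 < B\<close> in simp)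
qed

text \<open>The Lipschitz bound in the parameter is uniform in the space variable, so continuity in
  the latter is needed only at the fixed parameter \<mu>.\<close>

lemma solution_jointly_continuous:
  assumes y: "\<And>z. has_ac_derivative 0 1 (y z) (y1 z) (\<lambda>s. (q s - z) * y z s)"
      and y0: "\<And>z. y z 0 = \<alpha>" "\<And>z. y1 z 0 = \<beta>"
  shows "continuous_on (UNIV \<times> {0..1}) (\<lambda>p. y (fst p) (snd p))"
  unfolding continuous_on_def
proof
  fix p :: "complex \<times> real" assume "p \<in> UNIV \<times> {0..1}"
  then obtain \<mu> x where p: "p = (\<mu>, x)" "x \<in> {0..1}" by (cases p) auto
  let ?F = "at p within UNIV \<times> {0..1}"
  obtain C \<delta> where C: "0 < \<delta>" "\<And>z x. norm (z - \<mu>) < \<delta> \<Longrightarrow> x \<in> {0..1} \<Longrightarrow>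
     norm (y z x - y \<mu> x) \<le> C * norm (z - \<mu>)"
    using solution_lipschitz_in_parameter[where y = y, OF y y0, of \<mu>] by metis
  have fst: "((\<lambda>p. fst p) \<longlongrightarrow> \<mu>) ?F" using tendsto_fst[OF tendsto_ident_at, of p] p by simp
  have 1: "((\<lambda>p. y (fst p) (snd p) - y \<mu> (snd p)) \<longlongrightarrow> 0) ?F"
  proof (rule Lim_null_comparison)
    have "((\<lambda>p. C * norm (fst p - \<mu>)) \<longlongrightarrow> C * norm (\<mu> - \<mu>)) ?F" by (intro tendsto_intros fst)
    then show "((\<lambda>p. C * norm (fst p - \<mu>)) \<longlongrightarrow> 0) ?F" by simp
    have "eventually (\<lambda>p. dist (fst p) \<mu> < \<delta>) ?F" using fst C(1) by (rule tendstoD)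
    moreover have "eventually (\<lambda>p. p \<in> UNIV \<times> {0..1}) ?F" by (simp add: eventually_at_filter)
    ultimately show "eventually (\<lambda>p. norm (y (fst p) (snd p) - y \<mu> (snd p)) \<le> C * norm (fst p - \<mu>)) ?F"
      by eventually_elim (use C(2) in \<open>auto simp: dist_norm\<close>)
  qed
  have "continuous_on (UNIV \<times> {0..1}) (\<lambda>p::complex \<times> real. y \<mu> (snd p))"
    by (rule continuous_on_compose2[OF has_ac_derivative_continuous(1)[OF y[of \<mu>]]])
       (auto intro: continuous_intros)
  then have "((\<lambda>p. y \<mu> (snd p)) \<longlongrightarrow> y \<mu> (snd p)) ?F"
    using \<open>p \<in> _\<close> unfolding continuous_on_def by blast
  from tendsto_add[OF 1 this] show "((\<lambda>p. y (fst p) (snd p)) \<longlongrightarrow> y (fst p) (snd p)) ?F"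
    using p by simp
qed

lemma continuous_on_theta:
  assumes "continuous_on A f" "continuous_on A g" "g ` A \<subseteq> {0..1}"
  shows "continuous_on A (\<lambda>s. th (f s) (g s))"
proof -
  have "continuous_on (UNIV \<times> {0..1}) (\<lambda>p. th (fst p) (snd p))"
    by (rule solution_jointly_continuous[where y = th, OF theta_ac]) simp_all
  from continuous_on_compose2[OF this continuous_on_Pair[OF assms(1,2)]]
  show ?thesis using assms(3) by auto
qed

lemma continuous_on_phi:
  assumes "continuous_on A f" "continuous_on A g" "g ` A \<subseteq> {0..1}"
  shows "continuous_on A (\<lambda>s. ph (f s) (g s))"
proof -
  have "continuous_on (UNIV \<times> {0..1}) (\<lambda>p. ph (fst p) (snd p))"
    by (rule solution_jointly_continuous[where y = ph, OF phi_ac]) simp_all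
  from continuous_on_compose2[OF this continuous_on_Pair[OF assms(1,2)]]
  show ?thesis using assms(3) by auto
qed

lemma continuous_on_integral_param:
  fixes f :: "'z::topological_space \<Rightarrow> real \<Rightarrow> 'y::banach"
  assumes "continuous_on (U \<times> {0..1}) (\<lambda>p. f (fst p) (snd p))"
  shows "continuous_on U (\<lambda>s. integral {0..1} (f s))"
  using integral_continuous_on_param[of U 0 1 f] assms by (simp add: case_prod_beta')

text \<open>By the exact difference formula the difference quotient is itself an integral depending
  continuously on \<open>z\<close>; its value at \<mu> is the derivative. Nothing is differentiated
  under the integral sign.\<close>

lemma solution_has_parameter_derivative:
  assumes y: "\<And>z. has_ac_derivative 0 1 (y z) (y1 z) (\<lambda>s. (q s - z) * y z s)"
      and y0: "\<And>z. y z 0 = \<alpha>" "\<And>z. y1 z 0 = \<beta>"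
  shows "((\<lambda>z. y z 1) has_field_derivative
            - integral {0..1} (\<lambda>s. y \<mu> s * (ph \<mu> 1 * th \<mu> s - th \<mu> 1 * ph \<mu> s))) (at \<mu>)"
    and "((\<lambda>z. y1 z 1) has_field_derivative
            - integral {0..1} (\<lambda>s. y \<mu> s * (ph1 \<mu> 1 * th \<mu> s - th1 \<mu> 1 * ph \<mu> s))) (at \<mu>)"
proof -
  have lim: "((\<lambda>z. - integral {0..1} (\<lambda>s. y z s * (c * th \<mu> s - d * ph \<mu> s))) \<longlongrightarrow>
        - integral {0..1} (\<lambda>s. y \<mu> s * (c * th \<mu> s - d * ph \<mu> s))) (at \<mu>)" for c d
  proof -
    have "continuous_on (UNIV \<times> {0..1}) (\<lambda>p. y (fst p) (snd p) * (c * th \<mu> (snd p) - d * ph \<mu> (snd p)))"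
      by (intro continuous_on_mult continuous_on_diff continuous_on_const
          solution_jointly_continuous[where y = y, OF y y0]
          continuous_on_theta continuous_on_phi continuous_on_snd continuous_on_id) auto
    then have "continuous_on UNIV (\<lambda>z. integral {0..1} (\<lambda>s. y z s * (c * th \<mu> s - d * ph \<mu> s)))"
      by (rule continuous_on_integral_param)
    then have "isCont (\<lambda>z. integral {0..1} (\<lambda>s. y z s * (c * th \<mu> s - d * ph \<mu> s))) \<mu>"
      by (simp add: continuous_on_eq_continuous_at)
    then show ?thesis by (intro tendsto_minus) (simp add: isCont_def)
  qed
  have e: "y z 1 - y \<mu> 1 = (z - \<mu>) * - integral {0..1} (\<lambda>s. y z s * (ph \<mu> 1 * th \<mu> s - th \<mu> 1 * ph \<mu> s))"
       "y1 z 1 - y1 \<mu> 1 = (z - \<mu>) * - integral {0..1} (\<lambda>s. y z s * (ph1 \<mu> 1 * th \<mu> s - th1 \<mu> 1 * ph \<mu> s))" for z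
    using solution_difference[OF _ y, of z \<mu>] solution_on_unit_interval[OF y, of 1 \<mu>] y0 by auto
  show "((\<lambda>z. y z 1) has_field_derivative
            - integral {0..1} (\<lambda>s. y \<mu> s * (ph \<mu> 1 * th \<mu> s - th \<mu> 1 * ph \<mu> s))) (at \<mu>)"
    unfolding has_field_derivative_iff
    by (rule Lim_transform_eventually[OF lim[of "ph \<mu> 1" "th \<mu> 1"]])
       (auto simp: eventually_at_filter e)
  show "((\<lambda>z. y1 z 1) has_field_derivative
            - integral {0..1} (\<lambda>s. y \<mu> s * (ph1 \<mu> 1 * th \<mu> s - th1 \<mu> 1 * ph \<mu> s))) (at \<mu>)"
    unfolding has_field_derivative_iff
    by (rule Lim_transform_eventually[OF lim[of "ph1 \<mu> 1" "th1 \<mu> 1"]])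
       (auto simp: eventually_at_filter e)
qed

text \<open>With the next two: the Gram matrix of the fundamental solutions for the bilinear
  pairing, without conjugation. For complex \<open>q\<close> its diagonal entries and its
  determinant may vanish.\<close>

definition "Itt \<mu> = integral {0..1} (\<lambda>s. th \<mu> s * th \<mu> s)"
definition "Itp \<mu> = integral {0..1} (\<lambda>s. th \<mu> s * ph \<mu> s)"
definition "Ipp \<mu> = integral {0..1} (\<lambda>s. ph \<mu> s * ph \<mu> s)"

lemma continuous_on_gram:
  "continuous_on UNIV Itt" "continuous_on UNIV Itp" "continuous_on UNIV Ipp"
  unfolding Itt_def[abs_def] Itp_def[abs_def] Ipp_def[abs_def]
  by (intro continuous_on_integral_param continuous_on_mult continuous_on_theta continuous_on_phi
      continuous_on_fst continuous_on_snd continuous_on_id; auto)+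

lemma integral_lincomb:
  fixes u v :: "real \<Rightarrow> complex"
  assumes "continuous_on {0..1} u" "continuous_on {0..1} v"
  shows "integral {0..1} (\<lambda>s. c * u s + d * v s) = c * integral {0..1} u + d * integral {0..1} v"
proof -
  have "u integrable_on {0..1}" "v integrable_on {0..1}"
    using assms by (auto intro: integrable_continuous_real)
  then show ?thesis
    by (simp add: Henstock_Kurzweil_Integration.integral_add integrable_on_mult_right)
qed

lemma integral_gram:
  "integral {0..1} (\<lambda>s. th \<mu> s * (c * th \<mu> s - d * ph \<mu> s)) = c * Itt \<mu> - d * Itp \<mu>"
  "integral {0..1} (\<lambda>s. ph \<mu> s * (c * th \<mu> s - d * ph \<mu> s)) = c * Itp \<mu> - d * Ipp \<mu>"
  using integral_lincomb[of "\<lambda>s. th \<mu> s * th \<mu> s" "\<lambda>s. th \<mu> s * ph \<mu> s" c "- d"]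
    integral_lincomb[of "\<lambda>s. th \<mu> s * ph \<mu> s" "\<lambda>s. ph \<mu> s * ph \<mu> s" c "- d"]
  by (simp_all add: Itt_def Itp_def Ipp_def continuous_intros algebra_simps)

lemma monodromy_derivative:
  "((\<lambda>z. th z 1) has_field_derivative - (ph \<mu> 1 * Itt \<mu> - th \<mu> 1 * Itp \<mu>)) (at \<mu>)"
  "((\<lambda>z. ph z 1) has_field_derivative - (ph \<mu> 1 * Itp \<mu> - th \<mu> 1 * Ipp \<mu>)) (at \<mu>)"
  "((\<lambda>z. th1 z 1) has_field_derivative - (ph1 \<mu> 1 * Itt \<mu> - th1 \<mu> 1 * Itp \<mu>)) (at \<mu>)"
  "((\<lambda>z. ph1 z 1) has_field_derivative - (ph1 \<mu> 1 * Itp \<mu> - th1 \<mu> 1 * Ipp \<mu>)) (at \<mu>)"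
  using solution_has_parameter_derivative[where y = th, OF theta_ac theta_0, of \<mu>]
    solution_has_parameter_derivative[where y = ph, OF phi_ac phi_0, of \<mu>]
  unfolding integral_gram by blast+

abbreviation "F \<equiv> hill_discriminant q"

text \<open>The sum of the derivatives of \<theta>(1) and \<phi>'(1) in closed form. Its
  coefficients are the entries of the monodromy matrix that vanish, or cancel, when that matrix is
  scalar.\<close>

definition "F' \<mu> = - (ph \<mu> 1 * Itt \<mu> + (ph1 \<mu> 1 - th \<mu> 1) * Itp \<mu> - th1 \<mu> 1 * Ipp \<mu>)"

lemma discriminant_eq: "F \<mu> = ph1 \<mu> 1 + th \<mu> 1"
  by (simp add: hill_discriminant_def)

lemma discriminant_derivative: "(F has_field_derivative F' \<mu>) (at \<mu>)"
proof -
  have "F = (\<lambda>\<mu>. ph1 \<mu> 1 + th \<mu> 1)" by (rule ext) (rule discriminant_eq)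
  moreover have "((\<lambda>\<mu>. ph1 \<mu> 1 + th \<mu> 1) has_field_derivative F' \<mu>) (at \<mu>)"
    by (rule DERIV_cong[OF DERIV_add[OF monodromy_derivative(4,1)]]) (simp add: F'_def algebra_simps)
  ultimately show ?thesis by simp
qed

lemma deriv_discriminant: "deriv F \<mu> = F' \<mu>"
  using discriminant_derivative by (rule DERIV_imp_deriv)

lemma holomorphic_discriminant: "F holomorphic_on A"
  using discriminant_derivative
  by (meson field_differentiable_at_within field_differentiable_def holomorphic_on_def)

lemma continuous_on_monodromy:
  "continuous_on UNIV (\<lambda>z. th z 1)" "continuous_on UNIV (\<lambda>z. ph z 1)"
  "continuous_on UNIV (\<lambda>z. th1 z 1)" "continuous_on UNIV (\<lambda>z. ph1 z 1)"
  by (rule DERIV_continuous_on, rule monodromy_derivative)+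

lemma continuous_on_F': "continuous_on UNIV F'"
  unfolding F'_def[abs_def]
  by (intro continuous_intros continuous_on_gram continuous_on_monodromy)

end

section \<open>Square integrable functions on the unit interval\<close>

lemma L2_01_imp_absolutely_integrable:
  assumes "L2_01 f"
  shows "f absolutely_integrable_on {0..1}"
proof (rule measurable_bounded_by_integrable_imp_absolutely_integrable)
  show "f \<in> borel_measurable (lebesgue_on {0..1})" using assms by (simp add: L2_01_def)
  show "(\<lambda>x. 1 + (norm (f x))\<^sup>2) integrable_on {0..1}"
    using assms by (intro integrable_add) (auto simp: L2_01_def absolutely_integrable_on_def)
  show "norm (f x) \<le> 1 + (norm (f x))\<^sup>2" for x
    using zero_le_power2[of "norm (f x) - 1 / 2"] by (simp add: power2_eq_square algebra_simps)
qed auto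

lemma L2_01_mult_absolutely_integrable:
  assumes "L2_01 f" "L2_01 g"
  shows "(\<lambda>x. f x * g x) absolutely_integrable_on {0..1}"
proof (rule measurable_bounded_by_integrable_imp_absolutely_integrable)
  show "(\<lambda>x. f x * g x) \<in> borel_measurable (lebesgue_on {0..1})"
    using assms by (intro borel_measurable_times) (auto simp: L2_01_def)
  show "(\<lambda>x. (norm (f x))\<^sup>2 + (norm (g x))\<^sup>2) integrable_on {0..1}"
    using assms by (intro integrable_add) (auto simp: L2_01_def absolutely_integrable_on_def)
  show "norm (f x * g x) \<le> (norm (f x))\<^sup>2 + (norm (g x))\<^sup>2" for x
  proof -
    have "0 \<le> norm (f x) * norm (g x)" by simp
    then show ?thesis
      using sum_squares_bound[of "norm (f x)" "norm (g x)"] unfolding norm_mult by linarith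
  qed
qed auto

lemma L2_01_add:
  assumes "L2_01 f" "L2_01 g"
  shows "L2_01 (\<lambda>x. f x + g x)"
  unfolding L2_01_def
proof
  show m: "(\<lambda>x. f x + g x) \<in> borel_measurable (lebesgue_on {0..1})"
    using assms by (intro borel_measurable_add) (auto simp: L2_01_def)
  show "(\<lambda>x. (norm (f x + g x))\<^sup>2) absolutely_integrable_on {0..1}"
  proof (rule measurable_bounded_by_integrable_imp_absolutely_integrable)
    show "(\<lambda>x. (norm (f x + g x))\<^sup>2) \<in> borel_measurable (lebesgue_on {0..1})"
      using m by measurable
    show "(\<lambda>x. 2 * (norm (f x))\<^sup>2 + 2 * (norm (g x))\<^sup>2) integrable_on {0..1}"
      using assms by (intro integrable_add integrable_on_mult_right)
        (auto simp: L2_01_def absolutely_integrable_on_def)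
    show "norm ((norm (f x + g x))\<^sup>2) \<le> 2 * (norm (f x))\<^sup>2 + 2 * (norm (g x))\<^sup>2" for x
    proof -
      have "(norm (f x + g x))\<^sup>2 \<le> (norm (f x) + norm (g x))\<^sup>2"
        by (intro power_mono norm_triangle_ineq) auto
      also have "\<dots> \<le> 2 * (norm (f x))\<^sup>2 + 2 * (norm (g x))\<^sup>2"
        using sum_squares_bound[of "norm (f x)" "norm (g x)"] by (simp add: power2_sum)
      finally show ?thesis by simp
    qed
  qed auto
qed

lemma L2_01_cmult:
  assumes "L2_01 f"
  shows "L2_01 (\<lambda>x. c * f x)"
proof -
  have "(\<lambda>x. (norm c)\<^sup>2 * (norm (f x))\<^sup>2) absolutely_integrable_on {0..1}"
    using assms by (intro absolutely_integrable_continuous_mult continuous_intros) (auto simp: L2_01_def)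
  then show ?thesis
    using assms unfolding L2_01_def by (auto simp: norm_mult power_mult_distrib)
qed

lemma L2_01_cnj: "L2_01 f \<Longrightarrow> L2_01 (\<lambda>x. cnj (f x))"
proof -
  have "cnj \<in> borel_measurable borel" by (intro borel_measurable_continuous_onI continuous_intros)
  then show "L2_01 f \<Longrightarrow> L2_01 (\<lambda>x. cnj (f x))"
    unfolding L2_01_def by (auto intro: measurable_compose)
qed

lemma L2_01_continuous:
  assumes "continuous_on {0..1} f"
  shows "L2_01 f"
  unfolding L2_01_def using assms
  by (auto intro!: absolutely_integrable_continuous_real continuous_intros
      simp: continuous_imp_measurable_on_sets_lebesgue)

text \<open>An element of the domain of the adjoint is known only through inner products, so
  equality up to a null set is all that can be concluded about it.\<close>

lemma L2_01_null:
  assumes "L2_01 g" "integral {0..1} (\<lambda>x. g x * cnj (g x)) = 0"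
  shows "negligible {x \<in> {0..1}. g x \<noteq> 0}"
proof -
  have i: "(\<lambda>x. (norm (g x))\<^sup>2) integrable_on {0..1}"
    using assms(1) by (simp add: L2_01_def absolutely_integrable_on_def)
  have "complex_of_real (integral {0..1} (\<lambda>x. (norm (g x))\<^sup>2)) = integral {0..1} (\<lambda>x. g x * cnj (g x))"
    using integral_linear[OF i bounded_linear_of_real[where ?'a = complex]]
    by (simp add: o_def complex_norm_square[symmetric])
  then have "integral {0..1} (\<lambda>x. (norm (g x))\<^sup>2) = 0"
    using assms(2) by (metis of_real_eq_0_iff)
  moreover have ai: "(\<lambda>x. (norm (g x))\<^sup>2) absolutely_integrable_on {0..1}"
    using assms(1) by (simp add: L2_01_def)
  ultimately have "integral\<^sup>L (lebesgue_on {0..1}) (\<lambda>x. (norm (g x))\<^sup>2) = 0"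
    by (simp add: integral_lebesgue_on_Icc)
  then have "AE x in lebesgue_on {0..1}. (norm (g x))\<^sup>2 = 0"
    by (subst (asm) integral_nonneg_eq_0_iff_AE)
       (use absolutely_integrable_imp_integrable[OF ai] in auto)
  then have "AE x in lebesgue. x \<in> {0..1} \<longrightarrow> g x = 0"
    by (simp add: AE_restrict_space_iff)
  then obtain N where "negligible N" "{x. \<not> (x \<in> {0..1} \<longrightarrow> g x = 0)} \<subseteq> N"
    unfolding eventually_ae_filter_negligible by blast
  then show ?thesis by (elim negligible_subset) auto
qed

context hill_potential begin

section \<open>Bloch solutions\<close>

text \<open>The coefficients form an eigenvector of the monodromy matrix for the multiplier
  \<open>e\<close>: the condition on values at 1 holds for every \<open>e\<close>, the one on
  derivatives by the characteristic equation. Not dividing by \<phi>(1) keeps the expression defined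
  for all \<mu>, at the price of being 0 when the monodromy is \<open>e\<close> times the
  identity.\<close>

definition bloch :: "complex \<Rightarrow> complex \<Rightarrow> real \<Rightarrow> complex" where
  "bloch e \<mu> x = ph \<mu> 1 * th \<mu> x + (e - th \<mu> 1) * ph \<mu> x"

definition bloch_norm2 :: "complex \<Rightarrow> complex \<Rightarrow> real" where
  "bloch_norm2 e \<mu> = integral {0..1} (\<lambda>x. (norm (bloch e \<mu> x))\<^sup>2)"

lemma continuous_on_bloch [continuous_intros]: "continuous_on {0..1} (bloch e \<mu>)"
  unfolding bloch_def[abs_def] by (intro continuous_intros)

text \<open>The Bloch solution is continuous and has the value \<open>ph \<mu> 1\<close> at
  0.\<close>

lemma bloch_norm2_pos:
  assumes "ph \<mu> 1 \<noteq> 0"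
  shows "0 < bloch_norm2 e \<mu>"
proof -
  have c: "continuous_on {0..1} (\<lambda>x. (norm (bloch e \<mu> x))\<^sup>2)" by (intro continuous_intros)
  have "bloch_norm2 e \<mu> \<noteq> 0"
  proof
    assume "bloch_norm2 e \<mu> = 0"
    then have "((\<lambda>x. (norm (bloch e \<mu> x))\<^sup>2) has_integral 0) {0..1}"
      using integrable_continuous_real[OF c] unfolding bloch_norm2_def by (metis integrable_integral)
    then have "(norm (bloch e \<mu> 0))\<^sup>2 = 0"
      using has_integral_0_cbox_imp_0[of 0 1 "\<lambda>x. (norm (bloch e \<mu> x))\<^sup>2" 0] c by auto
    then show False using assms by (simp add: bloch_def)
  qed
  moreover have "0 \<le> bloch_norm2 e \<mu>"
    unfolding bloch_norm2_def
    by (intro Henstock_Kurzweil_Integration.integral_nonneg integrable_continuous_real c) auto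
  ultimately show ?thesis by simp
qed

text \<open>Expanding the product gives a combination of the Gram integrals, whose coefficients are
  those of \<open>F'\<close> times -\<phi>(1) once the trace and determinant of the monodromy are
  inserted.\<close>

lemma integral_bloch_mult:
  assumes "e * e' = 1" "e + e' = F \<mu>"
  shows "integral {0..1} (\<lambda>x. bloch e \<mu> x * bloch e' \<mu> x) = - ph \<mu> 1 * F' \<mu>"
proof -
  let ?p = "ph \<mu> 1" and ?T = "th \<mu> 1" and ?P = "ph1 \<mu> 1" and ?S = "th1 \<mu> 1"
  have FF: "e + e' = ?P + ?T" using assms(2) by (simp add: discriminant_eq)
  have i: "(\<lambda>x. th \<mu> x * th \<mu> x) integrable_on {0..1}" "(\<lambda>x. th \<mu> x * ph \<mu> x) integrable_on {0..1}"
     "(\<lambda>x. ph \<mu> x * ph \<mu> x) integrable_on {0..1}"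
    by (intro integrable_continuous_real continuous_intros)+
  have "(\<lambda>x. bloch e \<mu> x * bloch e' \<mu> x) = (\<lambda>x. (?p * ?p) * (th \<mu> x * th \<mu> x)
     + (?p * (e + e' - 2 * ?T)) * (th \<mu> x * ph \<mu> x) + ((e - ?T) * (e' - ?T)) * (ph \<mu> x * ph \<mu> x))"
    by (rule ext) (simp add: bloch_def algebra_simps)
  then have "integral {0..1} (\<lambda>x. bloch e \<mu> x * bloch e' \<mu> x)
     = (?p * ?p) * Itt \<mu> + (?p * (e + e' - 2 * ?T)) * Itp \<mu> + ((e - ?T) * (e' - ?T)) * Ipp \<mu>"
    using i by (simp add: Itt_def Itp_def Ipp_def Henstock_Kurzweil_Integration.integral_add
        integrable_on_mult_right integrable_add)
  \<comment> \<open>The left side is the characteristic polynomial of the monodromy matrix evaluated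
    at its entry \<theta>(1).\<close>
  also have "(e - ?T) * (e' - ?T) = - ?S * ?p"
  proof -
    have "(e - ?T) * (e' - ?T) = e * e' - ?T * (e + e') + ?T * ?T" by (simp add: algebra_simps)
    also have "\<dots> = 1 - ?T * ?P" unfolding FF assms(1) by (simp add: algebra_simps)
    also have "\<dots> = - ?S * ?p" using wronskian[of \<mu> 1] by (simp add: algebra_simps)
    finally show ?thesis .
  qed
  also have "e + e' - 2 * ?T = ?P - ?T" using FF by (simp add: algebra_simps)
  finally show ?thesis by (simp add: F'_def algebra_simps)
qed

lemma Lt_op_eq_iff:
  "Lt_op q t y f \<longleftrightarrow> L2_01 f \<and> (\<exists>y1. has_ac_derivative 0 1 y y1 (\<lambda>x. q x * y x - f x) \<and>
     y 1 = exp (\<i> * t) * y 0 \<and> y1 1 = exp (\<i> * t) * y1 0)"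
proof
  assume *: "Lt_op q t y f"
  then obtain y1 where y1: "has_ac_derivative 0 1 y y1 (\<lambda>x. q x * y x - f x)"
    unfolding Lt_op_def hill_expr_iff by blast
  with * show "L2_01 f \<and> (\<exists>y1. has_ac_derivative 0 1 y y1 (\<lambda>x. q x * y x - f x) \<and>
     y 1 = exp (\<i> * t) * y 0 \<and> y1 1 = exp (\<i> * t) * y1 0)"
    unfolding Lt_op_def vector_derivative_endpoints[OF y1] by blast
next
  assume *: "L2_01 f \<and> (\<exists>y1. has_ac_derivative 0 1 y y1 (\<lambda>x. q x * y x - f x) \<and>
     y 1 = exp (\<i> * t) * y 0 \<and> y1 1 = exp (\<i> * t) * y1 0)"
  then obtain y1 where y1: "has_ac_derivative 0 1 y y1 (\<lambda>x. q x * y x - f x)"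
     "y 1 = exp (\<i> * t) * y 0" "y1 1 = exp (\<i> * t) * y1 0" by blast
  have "L2_01 y" using has_ac_derivative_continuous[OF y1(1)] L2_01_continuous by blast
  with * y1 show "Lt_op q t y f"
    unfolding Lt_op_def vector_derivative_endpoints[OF y1(1)] hill_expr_iff by blast
qed

text \<open>Reduces the eigenvalue problem to linear algebra: the pair a = y(0), b = y'(0) is mapped
  by the monodromy matrix to exp(i t) times itself.\<close>

lemma Lt_op_eigen_iff:
  "Lt_op q t y (\<lambda>x. \<mu> * y x) \<longleftrightarrow> (\<exists>a b. (\<forall>x\<in>{0..1}. y x = a * th \<mu> x + b * ph \<mu> x) \<and>
     a * th \<mu> 1 + b * ph \<mu> 1 = exp (\<i> * t) * a \<and> a * th1 \<mu> 1 + b * ph1 \<mu> 1 = exp (\<i> * t) * b)"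
proof
  assume "Lt_op q t y (\<lambda>x. \<mu> * y x)"
  then obtain y1 where y1: "has_ac_derivative 0 1 y y1 (\<lambda>x. q x * y x - \<mu> * y x)"
     "y 1 = exp (\<i> * t) * y 0" "y1 1 = exp (\<i> * t) * y1 0"
    unfolding Lt_op_eq_iff by blast
  then have ac: "has_ac_derivative 0 1 y y1 (\<lambda>x. (q x - \<mu>) * y x)" by (simp add: left_diff_distrib)
  note r = solution_on_unit_interval[OF ac]
  show "\<exists>a b. (\<forall>x\<in>{0..1}. y x = a * th \<mu> x + b * ph \<mu> x) \<and>
     a * th \<mu> 1 + b * ph \<mu> 1 = exp (\<i> * t) * a \<and> a * th1 \<mu> 1 + b * ph1 \<mu> 1 = exp (\<i> * t) * b"
  proof (intro exI conjI ballI)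
    show "y x = y 0 * th \<mu> x + y1 0 * ph \<mu> x" if "x \<in> {0..1}" for x by (rule r(1)[OF that])
    show "y 0 * th \<mu> 1 + y1 0 * ph \<mu> 1 = exp (\<i> * t) * y 0" using r(1)[of 1] y1 by simp
    show "y 0 * th1 \<mu> 1 + y1 0 * ph1 \<mu> 1 = exp (\<i> * t) * y1 0" using r(2)[of 1] y1 by simp
  qed
next
  assume "\<exists>a b. (\<forall>x\<in>{0..1}. y x = a * th \<mu> x + b * ph \<mu> x) \<and>
     a * th \<mu> 1 + b * ph \<mu> 1 = exp (\<i> * t) * a \<and> a * th1 \<mu> 1 + b * ph1 \<mu> 1 = exp (\<i> * t) * b"
  then obtain a b where y: "\<And>x. x \<in> {0..1} \<Longrightarrow> y x = a * th \<mu> x + b * ph \<mu> x"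
    and bc: "a * th \<mu> 1 + b * ph \<mu> 1 = exp (\<i> * t) * a" "a * th1 \<mu> 1 + b * ph1 \<mu> 1 = exp (\<i> * t) * b"
    by blast
  have ac: "has_ac_derivative 0 1 y (\<lambda>x. a * th1 \<mu> x + b * ph1 \<mu> x) (\<lambda>x. q x * y x - \<mu> * y x)"
    by (rule has_ac_derivative_cong[OF has_ac_derivative_cong_fun[OF
          has_ac_derivative_lincomb[OF theta_ac[where \<mu> = \<mu>] phi_ac[where \<mu> = \<mu>], of _ _ a b]]])
       (auto simp: y algebra_simps)
  have "L2_01 (\<lambda>x. \<mu> * y x)"
    by (intro L2_01_cmult L2_01_continuous has_ac_derivative_continuous(1)[OF ac])
  then show "Lt_op q t y (\<lambda>x. \<mu> * y x)"
    unfolding Lt_op_eq_iff using ac bc y[of 0] y[of 1] by auto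
qed

text \<open>If \<phi>(1) \<noteq> 0, the boundary condition on values already determines y'(0) from
  y(0), so the eigenspace is at most one-dimensional.\<close>

lemma eigenfunction_eq_bloch:
  assumes "Lt_op q t y (\<lambda>x. \<mu> * y x)" "ph \<mu> 1 \<noteq> 0"
  obtains c where "\<And>x. x \<in> {0..1} \<Longrightarrow> y x = c * bloch (exp (\<i> * t)) \<mu> x"
proof -
  obtain a b where y: "\<And>x. x \<in> {0..1} \<Longrightarrow> y x = a * th \<mu> x + b * ph \<mu> x"
    and bc: "a * th \<mu> 1 + b * ph \<mu> 1 = exp (\<i> * t) * a"
    using assms(1) unfolding Lt_op_eigen_iff by blast
  have b: "b = a * (exp (\<i> * t) - th \<mu> 1) / ph \<mu> 1"
    using bc assms(2) by (simp add: field_simps)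
  have "y x = (a / ph \<mu> 1) * bloch (exp (\<i> * t)) \<mu> x" if "x \<in> {0..1}" for x
    unfolding y[OF that] b bloch_def using assms(2) by (simp add: field_simps)
  then show ?thesis by (rule that)
qed

text \<open>The solution is sought with \<open>y(0) = 0\<close>: the free parameter \<open>y'(0)\<close> is used to achieve \<open>y(1) = 0\<close>,
  and the orthogonality relation then yields \<open>y'(1) = e\<^sup>i\<^sup>t y'(0)\<close>.\<close>

lemma Lt_op_solvable:
  assumes g: "L2_01 g" and p: "ph \<mu> 1 \<noteq> 0" and e': "exp (\<i> * t) * e' = 1"
      and orth: "integral {0..1} (\<lambda>x. g x * bloch e' \<mu> x) = 0"
  obtains y where "Lt_op q t y (\<lambda>x. \<mu> * y x + g x)"
proof -
  let ?p = "ph \<mu> 1" and ?T = "th \<mu> 1" and ?P = "ph1 \<mu> 1" and ?S = "th1 \<mu> 1" and ?e = "exp (\<i> * t)"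
  \<comment> \<open>Solutions are constructed on the whole line, whereas \<open>g\<close> is
    controlled on [0, 1] only; hence the cut-off.\<close>
  define f where "f x = (if x \<in> {0..1} then g x else 0)" for x :: real
  have gi: "g absolutely_integrable_on {0..1}" by (rule L2_01_imp_absolutely_integrable[OF g])
  have "f absolutely_integrable_on {a..b}" for a b
  proof -
    have "f absolutely_integrable_on UNIV"
    proof (rule absolutely_integrable_spike_set)
      show "f absolutely_integrable_on {0..1}"
        by (rule absolutely_integrable_spike[OF gi negligible_empty]) (simp add: f_def)
    qed (auto simp: f_def intro: negligible_subset[OF negligible_empty])
    then show ?thesis by (rule absolutely_integrable_on_subinterval) simp
  qed
  then have lf: "locally_integrable f" by (simp add: locally_integrable_def)
  define G where "G = integral {0..1} (\<lambda>s. g s * th \<mu> s)"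
  define H where "H = integral {0..1} (\<lambda>s. g s * ph \<mu> s)"
  have gint: "(\<lambda>s. g s * th \<mu> s) integrable_on {0..1}" "(\<lambda>s. g s * ph \<mu> s) integrable_on {0..1}"
    using absolutely_integrable_mult_continuous[OF _ gi] absolutely_integrable_on_def continuous_on_fundamental
    by blast+
  have lin: "integral {0..1} (\<lambda>s. g s * (c * th \<mu> s + d * ph \<mu> s)) = c * G + d * H" for c d
  proof -
    have "(\<lambda>s. g s * (c * th \<mu> s + d * ph \<mu> s)) = (\<lambda>s. c * (g s * th \<mu> s) + d * (g s * ph \<mu> s))"
      by (rule ext) (simp add: algebra_simps)
    then show ?thesis using gint
      by (simp add: G_def H_def Henstock_Kurzweil_Integration.integral_add integrable_on_mult_right)
  qed
  have fg: "integral {0..1} (\<lambda>s. f s * k s) = integral {0..1} (\<lambda>s. g s * k s)" for k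
    by (rule integral_cong) (simp add: f_def)
  have o: "?p * G = (?T - e') * H"
    using orth lin[of ?p "e' - ?T"] by (simp add: bloch_def algebra_simps)
  \<comment> \<open>The initial slope is forced: y(1) is \<phi>(1) y'(0) minus \<phi>(1) G -
    \<theta>(1) H, and by orthogonality the latter equals - e' H.\<close>
  obtain y y1 where y: "y 0 = 0" "y1 0 = - e' * H / ?p"
     "\<And>a b. has_ac_derivative a b y y1 (\<lambda>x. (q x - \<mu>) * y x - f x)"
    using solution_exists[OF lf, of 0 "- e' * H / ?p" \<mu>] by metis
  have "y 1 = - e' * H - (?p * G - ?T * H)"
    using variation_of_constants(1)[OF _ y(3), of 1] y(1,2) lin[of ?p "- ?T"] p
    by (simp add: fg)
  then have y1: "y 1 = 0" unfolding o by (simp add: algebra_simps)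
  have "y1 1 = - e' * H / ?p * ?P - (?P * G - ?S * H)"
    using variation_of_constants(2)[OF _ y(3), of 1] y(1,2) lin[of ?P "- ?S"]
    by (simp add: fg)
  then have "?p * y1 1 = - e' * H * ?P - (?P * (?p * G) - ?S * ?p * H)"
    using p by (simp add: field_simps)
  also have "\<dots> = - (?T * ?P - ?S * ?p) * H" unfolding o by (simp add: algebra_simps)
  also have "\<dots> = - H" using wronskian[of \<mu> 1] by simp
  also have "\<dots> = - (?e * e') * H" using e' by simp
  also have "\<dots> = ?p * (?e * y1 0)" using y(2) p by (simp add: algebra_simps)
  finally have y1': "y1 1 = ?e * y1 0" using p by simp
  have ac: "has_ac_derivative 0 1 y y1 (\<lambda>x. q x * y x - (\<mu> * y x + g x))"
    by (rule has_ac_derivative_cong[OF y(3)]) (simp add: f_def algebra_simps)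
  have "L2_01 (\<lambda>x. \<mu> * y x + g x)"
    by (intro L2_01_add L2_01_cmult L2_01_continuous has_ac_derivative_continuous(1)[OF ac] g)
  then show ?thesis
    using ac y(1) y1 y1' by (intro that[of y]) (auto simp: Lt_op_eq_iff)
qed

text \<open>Subtracting from \<open>z\<close> its projection on the conjugate Bloch solution leaves a right-hand side
  for which the equation is solvable, hence a function orthogonal to itself.\<close>

lemma adjoint_eigenfunction_eq_bloch:
  assumes z: "Lt_adj q t z (\<lambda>x. cnj \<mu> * z x)" and p: "ph \<mu> 1 \<noteq> 0" and e': "exp (\<i> * t) * e' = 1"
  obtains \<kappa> where "negligible {x \<in> {0..1}. z x \<noteq> \<kappa> * cnj (bloch e' \<mu> x)}"
proof -
  let ?v = "bloch e' \<mu>"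
  have zL: "L2_01 z" using z by (simp add: Lt_adj_def)
  have vL: "L2_01 ?v" by (intro L2_01_continuous continuous_intros)
  define \<kappa> where "\<kappa> = integral {0..1} (\<lambda>x. z x * ?v x) / of_real (bloch_norm2 e' \<mu>)"
  define g where "g x = z x + - \<kappa> * cnj (?v x)" for x
  have gL: "L2_01 g" unfolding g_def[abs_def] by (intro L2_01_add zL L2_01_cmult L2_01_cnj vL)
  have ii: "(\<lambda>x. f x * h x) integrable_on {0..1}" if "L2_01 f" "L2_01 h" for f h
    using L2_01_mult_absolutely_integrable[OF that] absolutely_integrable_on_def by blast
  have vv: "integral {0..1} (\<lambda>x. cnj (?v x) * ?v x) = of_real (bloch_norm2 e' \<mu>)"
  proof -
    have "(\<lambda>x. (norm (?v x))\<^sup>2) integrable_on {0..1}"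
      by (intro integrable_continuous_real continuous_intros)
    from integral_linear[OF this bounded_linear_of_real[where ?'a = complex]] show ?thesis
      by (simp add: o_def bloch_norm2_def complex_norm_square[symmetric] mult.commute)
  qed
  have gv: "integral {0..1} (\<lambda>x. g x * ?v x) = 0"
  proof -
    have "(\<lambda>x. g x * ?v x) = (\<lambda>x. z x * ?v x + - \<kappa> * (cnj (?v x) * ?v x))"
      by (rule ext) (simp add: g_def algebra_simps)
    then have "integral {0..1} (\<lambda>x. g x * ?v x)
        = integral {0..1} (\<lambda>x. z x * ?v x) + - \<kappa> * integral {0..1} (\<lambda>x. cnj (?v x) * ?v x)"
      by (simp only: Henstock_Kurzweil_Integration.integral_add ii[OF zL vL] ii[OF L2_01_cnj[OF vL] vL]
          integrable_on_mult_right integral_mult_right)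
    then show ?thesis unfolding vv \<kappa>_def using bloch_norm2_pos[OF p, of e'] by simp
  qed
  obtain y where y: "Lt_op q t y (\<lambda>x. \<mu> * y x + g x)"
    using Lt_op_solvable[OF gL p e' gv] by blast
  have yL: "L2_01 y" using y by (simp add: Lt_op_def)
  have zc: "L2_01 (\<lambda>x. cnj (z x))" by (rule L2_01_cnj[OF zL])
  \<comment> \<open>The adjoint relation for \<open>y\<close>: the terms with \<mu> cancel and leave
    \<open>g\<close> orthogonal to \<open>z\<close>.\<close>
  have "integral {0..1} (\<lambda>x. (\<mu> * y x + g x) * cnj (z x)) = integral {0..1} (\<lambda>x. y x * cnj (cnj \<mu> * z x))"
    using z y unfolding Lt_adj_def L2_inner_def by blast
  moreover have "(\<lambda>x. (\<mu> * y x + g x) * cnj (z x)) = (\<lambda>x. \<mu> * (y x * cnj (z x)) + g x * cnj (z x))"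
     "(\<lambda>x. y x * cnj (cnj \<mu> * z x)) = (\<lambda>x. \<mu> * (y x * cnj (z x)))"
    by (auto simp: algebra_simps)
  ultimately have gz: "integral {0..1} (\<lambda>x. g x * cnj (z x)) = 0"
    by (simp add: Henstock_Kurzweil_Integration.integral_add ii[OF yL zc] ii[OF gL zc]
          integrable_on_mult_right)
  \<comment> \<open>Only the second factor is expanded: \<open>g\<close> is a combination of
    \<open>z\<close> and the conjugate Bloch solution and is orthogonal to both.\<close>
  have "(\<lambda>x. g x * cnj (g x)) = (\<lambda>x. g x * cnj (z x) + - cnj \<kappa> * (g x * ?v x))"
    by (rule ext) (simp add: g_def algebra_simps)
  then have "integral {0..1} (\<lambda>x. g x * cnj (g x))
      = integral {0..1} (\<lambda>x. g x * cnj (z x)) + - cnj \<kappa> * integral {0..1} (\<lambda>x. g x * ?v x)"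
    by (simp only: Henstock_Kurzweil_Integration.integral_add ii[OF gL zc] ii[OF gL vL]
          integrable_on_mult_right integral_mult_right)
  then have "integral {0..1} (\<lambda>x. g x * cnj (g x)) = 0" using gz gv by simp
  from L2_01_null[OF gL this] show ?thesis
    by (intro that[of \<kappa>]) (simp add: g_def)
qed

lemma exp_quasimomentum:
  "exp (\<i> * t) * exp (- (\<i> * t)) = 1" "exp (\<i> * t) + exp (- (\<i> * t)) = 2 * cos (t::complex)"
  by (auto simp: exp_minus_inverse cos_exp_eq)

text \<open>Normalization fixes the moduli of the two scalar factors, and their phases drop out. The
  conjugate in the adjoint eigenfunction cancels the one in the inner product, leaving the bilinear
  integral of two Bloch solutions.\<close>

lemma norm_bloch_alpha:
  assumes \<psi>: "Lt_eigenfunction q t \<mu> \<psi>" "L2_norm \<psi> = 1"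
      and \<psi>s: "Lt_adj q t \<psi>s (\<lambda>x. cnj \<mu> * \<psi>s x)" "L2_norm \<psi>s = 1"
      and p: "ph \<mu> 1 \<noteq> 0" and F: "F \<mu> = 2 * cos t"
  shows "norm (L2_inner \<psi> \<psi>s) = norm (ph \<mu> 1 * F' \<mu>) /
    sqrt (bloch_norm2 (exp (\<i> * t)) \<mu> * bloch_norm2 (exp (- (\<i> * t))) \<mu>)"
proof -
  let ?e = "exp (\<i> * t)" and ?e' = "exp (- (\<i> * t))"
  obtain c where c: "\<And>x. x \<in> {0..1} \<Longrightarrow> \<psi> x = c * bloch ?e \<mu> x"
    using \<psi>(1) eigenfunction_eq_bloch[OF _ p] unfolding Lt_eigenfunction_def by blast
  obtain \<kappa> where \<kappa>: "negligible {x \<in> {0..1}. \<psi>s x \<noteq> \<kappa> * cnj (bloch ?e' \<mu> x)}"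
    using adjoint_eigenfunction_eq_bloch[OF \<psi>s(1) p exp_quasimomentum(1)] by blast
  have "integral {0..1} (\<lambda>x. (norm (\<psi> x))\<^sup>2) = integral {0..1} (\<lambda>x. (norm c)\<^sup>2 * (norm (bloch ?e \<mu> x))\<^sup>2)"
    by (rule integral_cong) (simp add: c norm_mult power_mult_distrib)
  then have "(norm c)\<^sup>2 * bloch_norm2 ?e \<mu> = 1"
    using \<psi>(2) by (simp add: L2_norm_def bloch_norm2_def)
  then have c1: "norm c * sqrt (bloch_norm2 ?e \<mu>) = 1"
    by (metis abs_norm_cancel real_sqrt_abs real_sqrt_mult real_sqrt_one)
  have "integral {0..1} (\<lambda>x. (norm (\<psi>s x))\<^sup>2) = integral {0..1} (\<lambda>x. (norm \<kappa>)\<^sup>2 * (norm (bloch ?e' \<mu> x))\<^sup>2)"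
    by (rule integral_spike[OF \<kappa>]) (auto simp: norm_mult power_mult_distrib)
  then have "(norm \<kappa>)\<^sup>2 * bloch_norm2 ?e' \<mu> = 1"
    using \<psi>s(2) by (simp add: L2_norm_def bloch_norm2_def)
  then have k1: "norm \<kappa> * sqrt (bloch_norm2 ?e' \<mu>) = 1"
    by (metis abs_norm_cancel real_sqrt_abs real_sqrt_mult real_sqrt_one)
  have "L2_inner \<psi> \<psi>s = integral {0..1} (\<lambda>x. (c * cnj \<kappa>) * (bloch ?e \<mu> x * bloch ?e' \<mu> x))"
    unfolding L2_inner_def by (rule integral_spike[OF \<kappa>]) (auto simp: c)
  also have "\<dots> = (c * cnj \<kappa>) * (- ph \<mu> 1 * F' \<mu>)"
    by (simp add: integral_bloch_mult[OF exp_quasimomentum(1)] exp_quasimomentum F)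
  finally have "norm (L2_inner \<psi> \<psi>s) = norm c * norm \<kappa> * norm (ph \<mu> 1 * F' \<mu>)"
    by (simp add: norm_mult)
  moreover have "norm c = 1 / sqrt (bloch_norm2 ?e \<mu>)" "norm \<kappa> = 1 / sqrt (bloch_norm2 ?e' \<mu>)"
    by (rule eq_divide_imp; use c1 k1 in auto)+
  ultimately show ?thesis by (simp add: real_sqrt_mult)
qed

end

section \<open>Asymptotics for large spectral parameter\<close>

lemma has_ac_derivative_C2:
  assumes "\<And>x. (y has_vector_derivative y1 x) (at x)" "\<And>x. (y1 has_vector_derivative h x) (at x)"
      and "continuous_on UNIV h"
  shows "has_ac_derivative a b y y1 h"
  unfolding has_ac_derivative_def
proof (intro conjI ballI)
  show "(y has_vector_derivative y1 x) (at x within {a..b})" for x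
    using assms(1) by (rule has_vector_derivative_at_within)
  show "h absolutely_integrable_on {a..b}"
    using assms(3) continuous_on_subset by (blast intro: absolutely_integrable_continuous_real)
  show "y1 x = y1 a + integral {a..x} h" if "x \<in> {a..b}" for x
  proof -
    have "(h has_integral y1 x - y1 a) {a..x}"
      by (rule fundamental_theorem_of_calculus[OF _ has_vector_derivative_at_within[OF assms(2)]])
         (use that in simp)
    then show ?thesis by (simp add: integral_unique)
  qed
qed

text \<open>The upper bounds control the free solutions. The lower bound for the cosine serves to
  bound the imaginary part of s once cos s is bounded.\<close>

lemma norm_cos_le_exp: "norm (cos z) \<le> exp \<bar>Im z\<bar>"
  and norm_sin_le_exp: "norm (sin z) \<le> exp \<bar>Im z\<bar>"
  and norm_cos_ge_exp: "(exp \<bar>Im z\<bar> - 1) / 2 \<le> norm (cos z)" for z :: complex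
proof -
  have n: "norm (exp (\<i> * z)) = exp (- Im z)" "norm (exp (- (\<i> * z))) = exp (Im z)" by simp_all
  have e: "exp (- Im z) \<le> exp \<bar>Im z\<bar>" "exp (Im z) \<le> exp \<bar>Im z\<bar>" by auto
  have "norm (exp (\<i> * z) + exp (- (\<i> * z))) \<le> exp (- Im z) + exp (Im z)"
    by (metis n norm_triangle_ineq)
  also have "\<dots> \<le> 2 * exp \<bar>Im z\<bar>" using e by linarith
  finally show "norm (cos z) \<le> exp \<bar>Im z\<bar>" by (simp add: cos_exp_eq norm_divide)
  have "norm (exp (\<i> * z) - exp (- (\<i> * z))) \<le> exp (- Im z) + exp (Im z)"
    by (metis n norm_triangle_ineq4)
  also have "\<dots> \<le> 2 * exp \<bar>Im z\<bar>" using e by linarith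
  finally show "norm (sin z) \<le> exp \<bar>Im z\<bar>" by (simp add: sin_exp_eq norm_divide norm_mult)
  have "\<bar>exp (- Im z) - exp (Im z)\<bar> \<le> norm (exp (\<i> * z) + exp (- (\<i> * z)))"
    using norm_triangle_ineq3[of "exp (\<i> * z)" "- exp (- (\<i> * z))"] n by simp
  moreover have "exp \<bar>Im z\<bar> - 1 \<le> \<bar>exp (- Im z) - exp (Im z)\<bar>"
    by (cases "0 \<le> Im z") auto
  ultimately show "(exp \<bar>Im z\<bar> - 1) / 2 \<le> norm (cos z)" by (simp add: cos_exp_eq norm_divide)
qed

lemma sin_cos_vector_derivative:
  fixes s :: complex and x t :: real
  shows "((\<lambda>\<xi>. sin (s * of_real (x - \<xi>))) has_vector_derivative - s * cos (s * of_real (x - t))) (at t)"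
    "((\<lambda>\<xi>. cos (s * of_real (x - \<xi>))) has_vector_derivative s * sin (s * of_real (x - t))) (at t)"
proof -
  have l: "((\<lambda>\<xi>. s * of_real (x - \<xi>)) has_vector_derivative s * of_real (- 1)) (at t)"
    by (intro has_vector_derivative_mult_right has_vector_derivative_of_real) (auto intro!: derivative_eq_intros)
  show "((\<lambda>\<xi>. sin (s * of_real (x - \<xi>))) has_vector_derivative - s * cos (s * of_real (x - t))) (at t)"
    using field_vector_diff_chain_at[OF l DERIV_sin] by (simp add: o_def)
  show "((\<lambda>\<xi>. cos (s * of_real (x - \<xi>))) has_vector_derivative s * sin (s * of_real (x - t))) (at t)"
    using field_vector_diff_chain_at[OF l DERIV_cos] by (simp add: o_def)
qed

text \<open>Test functions for the Lagrange identity: solutions of the free equation in \<xi> with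
  prescribed data at \<xi> = x.\<close>

lemma sin_cos_has_ac_derivative:
  fixes s :: complex and x :: real
  shows "has_ac_derivative a b (\<lambda>\<xi>. sin (s * of_real (x - \<xi>))) (\<lambda>\<xi>. - s * cos (s * of_real (x - \<xi>)))
       (\<lambda>\<xi>. - s * (s * sin (s * of_real (x - \<xi>))))"
    and "has_ac_derivative a b (\<lambda>\<xi>. cos (s * of_real (x - \<xi>))) (\<lambda>\<xi>. s * sin (s * of_real (x - \<xi>)))
       (\<lambda>\<xi>. s * (- s * cos (s * of_real (x - \<xi>))))"
  by (intro has_ac_derivative_C2 has_vector_derivative_mult_right sin_cos_vector_derivative continuous_intros)+

text \<open>The Gram integrals for zero potential, up to powers of s: for large s in a horizontal
  strip they are close to 1/2, 1/2 and 0.\<close>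

lemma integral_cos_sin:
  fixes s :: complex
  assumes "s \<noteq> 0"
  shows "integral {0..1} (\<lambda>x. cos (s * of_real x) * cos (s * of_real x)) = 1 / 2 + sin s * cos s / (2 * s)"
    and "integral {0..1} (\<lambda>x. sin (s * of_real x) * sin (s * of_real x)) = 1 / 2 - sin s * cos s / (2 * s)"
    and "integral {0..1} (\<lambda>x. cos (s * of_real x) * sin (s * of_real x)) = sin s * sin s / (2 * s)"
proof -
  have l: "((\<lambda>x. s * of_real x) has_vector_derivative s * of_real 1) (at t)" for t
    by (intro has_vector_derivative_mult_right has_vector_derivative_of_real) (auto intro!: derivative_eq_intros)
  have S: "((\<lambda>x. sin (s * of_real x)) has_vector_derivative s * cos (s * of_real t)) (at t)" for t
    using field_vector_diff_chain_at[OF l DERIV_sin] by (simp add: o_def)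
  have C: "((\<lambda>x. cos (s * of_real x)) has_vector_derivative - (s * sin (s * of_real t))) (at t)" for t
    using field_vector_diff_chain_at[OF l DERIV_cos] by (simp add: o_def)
  have X: "((\<lambda>x. complex_of_real x / 2) has_vector_derivative 1 / 2) (at t)" for t
  proof -
    have "((\<lambda>x. (1 / 2) * complex_of_real x) has_vector_derivative (1 / 2) * of_real 1) (at t)"
      by (intro has_vector_derivative_mult_right has_vector_derivative_of_real DERIV_ident)
    then show ?thesis by simp
  qed
  have sc: "sin w * sin w = 1 - cos w * cos w" for w :: complex
    using sin_cos_squared_add[of w] by (simp add: power2_eq_square algebra_simps)
  define G where "G x = sin (s * of_real x) * cos (s * of_real x)" for x :: real
  have G: "(G has_vector_derivative s * (2 * (cos (s * of_real t) * cos (s * of_real t)) - 1)) (at t)" for t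
    unfolding G_def[abs_def]
    by (rule has_vector_derivative_eq_rhs[OF has_vector_derivative_mult[OF S C]])
       (simp add: sc algebra_simps)
  have G2: "((\<lambda>x. G x / (2 * s)) has_vector_derivative (cos (s * of_real t) * cos (s * of_real t)) - 1 / 2) (at t)" for t
    by (rule has_vector_derivative_eq_rhs[OF has_vector_derivative_divide[OF G]])
       (use assms in \<open>simp add: field_simps\<close>)
  have P: "((\<lambda>x. of_real x / 2 + G x / (2 * s)) has_vector_derivative cos (s * of_real t) * cos (s * of_real t)) (at t)"
    and M: "((\<lambda>x. of_real x / 2 - G x / (2 * s)) has_vector_derivative sin (s * of_real t) * sin (s * of_real t)) (at t)" for t
    using has_vector_derivative_add[OF X G2] has_vector_derivative_diff[OF X G2] by (simp_all add: sc)
  have "((\<lambda>x. cos (s * of_real x) * cos (s * of_real x)) has_integral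
      (of_real 1 / 2 + G 1 / (2 * s)) - (of_real 0 / 2 + G 0 / (2 * s))) {0..1}"
    by (rule fundamental_theorem_of_calculus[OF _ has_vector_derivative_at_within[OF P]]) simp
  then show "integral {0..1} (\<lambda>x. cos (s * of_real x) * cos (s * of_real x)) = 1 / 2 + sin s * cos s / (2 * s)"
    by (simp add: integral_unique G_def)
  have "((\<lambda>x. sin (s * of_real x) * sin (s * of_real x)) has_integral
      (of_real 1 / 2 - G 1 / (2 * s)) - (of_real 0 / 2 - G 0 / (2 * s))) {0..1}"
    by (rule fundamental_theorem_of_calculus[OF _ has_vector_derivative_at_within[OF M]]) simp
  then show "integral {0..1} (\<lambda>x. sin (s * of_real x) * sin (s * of_real x)) = 1 / 2 - sin s * cos s / (2 * s)"
    by (simp add: integral_unique G_def)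
  have S2: "((\<lambda>x. (sin (s * of_real x) * sin (s * of_real x)) / (2 * s)) has_vector_derivative
      cos (s * of_real t) * sin (s * of_real t)) (at t)" for t
    by (rule has_vector_derivative_eq_rhs[OF has_vector_derivative_divide[OF has_vector_derivative_mult[OF S S]]])
       (use assms in \<open>simp add: field_simps\<close>)
  have "((\<lambda>x. cos (s * of_real x) * sin (s * of_real x)) has_integral
      (sin (s * of_real 1) * sin (s * of_real 1)) / (2 * s) - (sin (s * of_real 0) * sin (s * of_real 0)) / (2 * s)) {0..1}"
    by (rule fundamental_theorem_of_calculus[OF _ has_vector_derivative_at_within[OF S2]]) simp
  then show "integral {0..1} (\<lambda>x. cos (s * of_real x) * sin (s * of_real x)) = sin s * sin s / (2 * s)"
    by (simp add: integral_unique)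
qed

lemma norm_mult_diff_le:
  fixes a b c d :: complex
  assumes "norm (a - c) \<le> \<delta>" "norm (b - d) \<le> \<delta>" "norm b \<le> B" "norm c \<le> C"
  shows "norm (a * b - c * d) \<le> \<delta> * (B + C)"
proof -
  have "a * b - c * d = (a - c) * b + c * (b - d)" by (simp add: algebra_simps)
  then have "norm (a * b - c * d) \<le> norm (a - c) * norm b + norm c * norm (b - d)"
    by (metis norm_mult norm_triangle_ineq)
  also have "\<dots> \<le> \<delta> * B + C * \<delta>"
    using assms by (intro add_mono mult_mono) (auto intro: order_trans[OF norm_ge_zero])
  finally show ?thesis by (simp add: algebra_simps)
qed

context hill_potential begin

text \<open>Variation of constants around the zero potential, with the whole term \<open>q y\<close>
  treated as inhomogeneity and \<mu> = s^2.\<close>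

lemma perturbed_free_solution:
  assumes "0 \<le> x" and y: "has_ac_derivative 0 x y y1 (\<lambda>t. (q t - s * s) * y t)"
  shows "s * y x - (s * y 0 * cos (s * of_real x) + y1 0 * sin (s * of_real x))
          = integral {0..x} (\<lambda>t. (q t * y t) * sin (s * of_real (x - t)))"
    and "y1 x - (y1 0 * cos (s * of_real x) - s * y 0 * sin (s * of_real x))
          = integral {0..x} (\<lambda>t. (q t * y t) * cos (s * of_real (x - t)))"
proof -
  have "(\<lambda>t. (q t - s * s) * y t * sin (s * of_real (x - t)) - y t * (- s * (s * sin (s * of_real (x - t)))))
     = (\<lambda>t. (q t * y t) * sin (s * of_real (x - t)))"
    by (rule ext) (simp add: algebra_simps)
  with lagrange_identity[OF assms sin_cos_has_ac_derivative(1)[where s = s and x = x]]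
  show "s * y x - (s * y 0 * cos (s * of_real x) + y1 0 * sin (s * of_real x))
          = integral {0..x} (\<lambda>t. (q t * y t) * sin (s * of_real (x - t)))"
    by (simp add: algebra_simps)
  have "(\<lambda>t. (q t - s * s) * y t * cos (s * of_real (x - t)) - y t * (s * (- s * cos (s * of_real (x - t)))))
     = (\<lambda>t. (q t * y t) * cos (s * of_real (x - t)))"
    by (rule ext) (simp add: algebra_simps)
  with lagrange_identity[OF assms sin_cos_has_ac_derivative(2)[where s = s and x = x]]
  show "y1 x - (y1 0 * cos (s * of_real x) - s * y 0 * sin (s * of_real x))
          = integral {0..x} (\<lambda>t. (q t * y t) * cos (s * of_real (x - t)))"
    by (simp add: algebra_simps)
qed

definition "Q = integral {0..1} (\<lambda>t. norm (q t))"

lemma Q_nonneg: "0 \<le> Q"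
  unfolding Q_def using integrable
  by (auto intro!: Henstock_Kurzweil_Integration.integral_nonneg simp: absolutely_integrable_on_def)

text \<open>The growth rates exp(|Im s| t) of \<open>y\<close> and exp(|Im s| (x - t)) of the kernel
  multiply to a factor independent of t, so only the integral of \<open>norm q\<close> remains.
  \<open>T\<close> stands for sine or cosine.\<close>

lemma weighted_integral_bound:
  fixes T :: "complex \<Rightarrow> complex"
  assumes x: "x \<in> {0..1}" and y: "continuous_on {0..1} y"
      and S: "\<And>t. t \<in> {0..1} \<Longrightarrow> norm (y t) \<le> S * exp (\<bar>Im s\<bar> * t)"
      and T: "\<And>w. norm (T w) \<le> exp \<bar>Im w\<bar>" "continuous_on UNIV T"
  shows "norm (integral {0..x} (\<lambda>t. (q t * y t) * T (s * of_real (x - t)))) \<le> Q * S * exp (\<bar>Im s\<bar> * x)"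
proof -
  have S0: "0 \<le> S" using S[of 0] norm_ge_zero[of "y 0"] by (simp del: norm_ge_zero)
  have qi: "(\<lambda>t. norm (q t)) integrable_on {0..1}" using integrable by (simp add: absolutely_integrable_on_def)
  then have qx: "(\<lambda>t. norm (q t)) integrable_on {0..x}" using x by (auto intro: integrable_on_subinterval)
  have "q absolutely_integrable_on {0..x}" using integrable x by (auto intro: absolutely_integrable_on_subinterval)
  moreover have "continuous_on {0..x} (\<lambda>t. y t * T (s * of_real (x - t)))"
    using x by (intro continuous_on_mult continuous_on_subset[OF y]
        continuous_on_compose2[OF T(2)] continuous_intros) auto
  ultimately have "(\<lambda>t. q t * (y t * T (s * of_real (x - t)))) absolutely_integrable_on {0..x}"
    by (intro absolutely_integrable_mult_continuous)
  then have ki: "(\<lambda>t. (q t * y t) * T (s * of_real (x - t))) integrable_on {0..x}"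
    by (simp add: absolutely_integrable_on_def mult.assoc)
  have "norm (integral {0..x} (\<lambda>t. (q t * y t) * T (s * of_real (x - t))))
      \<le> integral {0..x} (\<lambda>t. norm (q t) * (S * exp (\<bar>Im s\<bar> * x)))"
  proof (rule Henstock_Kurzweil_Integration.integral_norm_bound_integral[OF ki])
    show "(\<lambda>t. norm (q t) * (S * exp (\<bar>Im s\<bar> * x))) integrable_on {0..x}"
      using qx by (rule integrable_on_mult_left)
    show "norm ((q t * y t) * T (s * of_real (x - t))) \<le> norm (q t) * (S * exp (\<bar>Im s\<bar> * x))"
      if t: "t \<in> {0..x}" for t
    proof -
      have "norm (T (s * of_real (x - t))) \<le> exp (\<bar>Im s\<bar> * (x - t))"
        using T(1)[of "s * of_real (x - t)"] t by (simp add: abs_mult)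
      then have "norm (y t) * norm (T (s * of_real (x - t)))
          \<le> (S * exp (\<bar>Im s\<bar> * t)) * exp (\<bar>Im s\<bar> * (x - t))"
        using S[of t] t x S0 by (intro mult_mono) auto
      also have "\<dots> = S * exp (\<bar>Im s\<bar> * x)"
        by (simp add: mult.assoc exp_add[symmetric] algebra_simps)
      finally show ?thesis
        by (simp add: norm_mult mult.assoc mult_left_mono)
    qed
  qed
  also have "\<dots> = integral {0..x} (\<lambda>t. norm (q t)) * (S * exp (\<bar>Im s\<bar> * x))" by simp
  also have "\<dots> \<le> Q * (S * exp (\<bar>Im s\<bar> * x))"
    unfolding Q_def using x S0 qi qx by (intro mult_right_mono integral_subset_le) auto
  finally show ?thesis by (simp add: mult.assoc)
qed

text \<open>The maximum of \<open>\<bar>y\<bar>\<close> relative to the growth rate of the free solutions satisfies a linear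
  inequality, which replaces Gronwall's lemma.\<close>

lemma weighted_solution_bound:
  assumes y: "has_ac_derivative 0 1 y y1 (\<lambda>t. (q t - s * s) * y t)"
      and s: "2 * Q \<le> norm s" "s \<noteq> 0" and x: "x \<in> {0..1}"
  shows "norm (y x) \<le> 2 * (norm (y 0) + norm (y1 0) / norm s) * exp (\<bar>Im s\<bar> * x)"
proof -
  have cy: "continuous_on {0..1} y" using has_ac_derivative_continuous[OF y] by blast
  let ?m = "\<lambda>t. norm (y t) / exp (\<bar>Im s\<bar> * t)"
  have "\<exists>m\<in>{0..1}. \<forall>t\<in>{0..1}. ?m t \<le> ?m m"
    by (intro continuous_attains_sup continuous_intros cy) auto
  then obtain m where m: "m \<in> {0..1}" "\<And>t. t \<in> {0..1} \<Longrightarrow> ?m t \<le> ?m m" by blast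
  define S where "S = ?m m"
  have S: "norm (y t) \<le> S * exp (\<bar>Im s\<bar> * t)" if "t \<in> {0..1}" for t
    using m(2)[OF that] by (simp add: S_def field_simps)
  have b: "norm (cos (s * of_real m)) \<le> exp (\<bar>Im s\<bar> * m)" "norm (sin (s * of_real m)) \<le> exp (\<bar>Im s\<bar> * m)"
    using norm_cos_le_exp[of "s * of_real m"] norm_sin_le_exp[of "s * of_real m"] m(1)
    by (simp_all add: abs_mult)
  let ?r = "integral {0..m} (\<lambda>t. (q t * y t) * sin (s * of_real (m - t)))"
  have r: "norm ?r \<le> Q * S * exp (\<bar>Im s\<bar> * m)"
    by (intro weighted_integral_bound m(1) cy S norm_sin_le_exp continuous_intros)
  have "norm s * (S * exp (\<bar>Im s\<bar> * m)) = norm (s * y m)" by (simp add: S_def norm_mult)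
  also have "s * y m = s * y 0 * cos (s * of_real m) + y1 0 * sin (s * of_real m) + ?r"
    using perturbed_free_solution(1)[where x = m and s = s, OF _ has_ac_derivative_initial[OF y]] m(1)
    by (simp add: algebra_simps)
  also have "norm \<dots> \<le> norm (s * y 0 * cos (s * of_real m)) + norm (y1 0 * sin (s * of_real m)) + norm ?r"
    by (intro norm_triangle_mono) auto
  also have "\<dots> \<le> norm s * norm (y 0) * exp (\<bar>Im s\<bar> * m) + norm (y1 0) * exp (\<bar>Im s\<bar> * m)
       + Q * S * exp (\<bar>Im s\<bar> * m)"
    unfolding norm_mult[of _ "cos _"] norm_mult[of _ "sin _"] norm_mult[of s]
    by (intro add_mono mult_left_mono b r) auto
  also have "\<dots> = (norm s * norm (y 0) + norm (y1 0) + Q * S) * exp (\<bar>Im s\<bar> * m)"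
    by (simp add: algebra_simps)
  finally have "norm s * S * exp (\<bar>Im s\<bar> * m)
      \<le> (norm s * norm (y 0) + norm (y1 0) + Q * S) * exp (\<bar>Im s\<bar> * m)" by (simp add: mult_ac)
  then have 1: "norm s * S \<le> norm s * norm (y 0) + norm (y1 0) + Q * S" by simp
  have "0 \<le> S" by (simp add: S_def)
  \<comment> \<open>The assumption 2 Q \<le> norm s is what lets the potential term be absorbed into
    the left side.\<close>
  then have "Q * S \<le> norm s / 2 * S" using s by (intro mult_right_mono) auto
  with 1 have "norm s * S \<le> 2 * (norm s * norm (y 0) + norm (y1 0))" by simp
  also have "\<dots> = norm s * (2 * (norm (y 0) + norm (y1 0) / norm s))"
    using s(2) by (simp add: field_simps)
  finally have "S \<le> 2 * (norm (y 0) + norm (y1 0) / norm s)" using s(2) by simp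
  then show ?thesis using S[OF x] by (smt (verit) exp_ge_zero mult_right_mono)
qed

lemma theta_bound:
  assumes "2 * Q \<le> norm s" "s \<noteq> 0" "x \<in> {0..1}"
  shows "norm (th (s * s) x) \<le> 2 * exp (\<bar>Im s\<bar> * x)"
  using weighted_solution_bound[OF theta_ac assms] by simp

lemma phi_bound:
  assumes "2 * Q \<le> norm s" "s \<noteq> 0" "x \<in> {0..1}"
  shows "norm (ph (s * s) x) \<le> 2 / norm s * exp (\<bar>Im s\<bar> * x)"
  using weighted_solution_bound[OF phi_ac assms] by simp

text \<open>The a priori bound, inserted into the integral equation, gains a factor 1/s.\<close>

lemma theta_asymptotic:
  assumes s: "2 * Q \<le> norm s" "s \<noteq> 0" and x: "x \<in> {0..1}"
  shows "norm (th (s * s) x - cos (s * of_real x)) \<le> 2 * Q / norm s * exp (\<bar>Im s\<bar> * x)"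
proof -
  have "s * (th (s * s) x - cos (s * of_real x))
      = integral {0..x} (\<lambda>t. (q t * th (s * s) t) * sin (s * of_real (x - t)))"
    using perturbed_free_solution(1)[OF _ theta_ac, of x s] x by (simp add: algebra_simps)
  also have "norm \<dots> \<le> Q * 2 * exp (\<bar>Im s\<bar> * x)"
    by (intro weighted_integral_bound x theta_bound s norm_sin_le_exp continuous_intros)
  finally have "norm s * norm (th (s * s) x - cos (s * of_real x)) \<le> Q * 2 * exp (\<bar>Im s\<bar> * x)"
    unfolding norm_mult .
  then show ?thesis using s(2) by (simp add: field_simps)
qed

lemma phi_asymptotic:
  assumes s: "2 * Q \<le> norm s" "s \<noteq> 0" and x: "x \<in> {0..1}"
  shows "norm (s * ph (s * s) x - sin (s * of_real x)) \<le> 2 * Q / norm s * exp (\<bar>Im s\<bar> * x)"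
proof -
  have "s * ph (s * s) x - sin (s * of_real x)
      = integral {0..x} (\<lambda>t. (q t * ph (s * s) t) * sin (s * of_real (x - t)))"
    using perturbed_free_solution(1)[OF _ phi_ac, of x s] x by simp
  also have "norm \<dots> \<le> Q * (2 / norm s) * exp (\<bar>Im s\<bar> * x)"
    by (intro weighted_integral_bound x phi_bound s norm_sin_le_exp continuous_intros)
  finally show ?thesis by (simp add: mult_ac)
qed

lemma phi1_asymptotic:
  assumes s: "2 * Q \<le> norm s" "s \<noteq> 0" and x: "x \<in> {0..1}"
  shows "norm (ph1 (s * s) x - cos (s * of_real x)) \<le> 2 * Q / norm s * exp (\<bar>Im s\<bar> * x)"
proof -
  have "ph1 (s * s) x - cos (s * of_real x)
      = integral {0..x} (\<lambda>t. (q t * ph (s * s) t) * cos (s * of_real (x - t)))"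
    using perturbed_free_solution(2)[OF _ phi_ac, of x s] x by simp
  also have "norm \<dots> \<le> Q * (2 / norm s) * exp (\<bar>Im s\<bar> * x)"
    by (intro weighted_integral_bound x phi_bound s norm_cos_le_exp continuous_intros)
  finally show ?thesis by (simp add: mult_ac)
qed

lemma discriminant_asymptotic:
  assumes s: "2 * Q \<le> norm s" "s \<noteq> 0"
  shows "norm (F (s * s) - 2 * cos s) \<le> 4 * Q / norm s * exp \<bar>Im s\<bar>"
proof -
  have "norm ((ph1 (s * s) 1 - cos s) + (th (s * s) 1 - cos s)) \<le>
     2 * Q / norm s * exp \<bar>Im s\<bar> + 2 * Q / norm s * exp \<bar>Im s\<bar>"
    using phi1_asymptotic[OF s, of 1] theta_asymptotic[OF s, of 1] by (intro norm_triangle_mono) auto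
  then show ?thesis by (simp add: discriminant_eq algebra_simps)
qed

text \<open>Ensures that F - c is not identically zero, so that its zeros have finite order. For
  real s, F(s^2) follows 2 cos s, which takes both values 2 and -2.\<close>

lemma discriminant_nonconstant: "\<exists>w. F w \<noteq> c"
proof -
  \<comment> \<open>From \<open>k\<close> on, 4 Q / s < 1. The points 2 pi k and 2 pi k + pi used
    below lie beyond \<open>k\<close> since 2 pi > 1.\<close>
  obtain k :: nat where k: "8 * Q + 1 \<le> real k" using real_arch_simple by blast
  have "norm (F (of_real s * of_real s) - 2 * of_real (cos s)) < 1" if s: "real k \<le> s" for s
  proof -
    have ss: "2 * Q \<le> norm (complex_of_real s)" "complex_of_real s \<noteq> 0" using s k Q_nonneg by auto
    have "norm (F (of_real s * of_real s) - 2 * cos (of_real s)) \<le> 4 * Q / s"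
      using discriminant_asymptotic[OF ss] s by simp
    also have "\<dots> < 1" using s k Q_nonneg by (simp add: field_simps)
    finally show ?thesis by (simp add: cos_of_real)
  qed
  note * = this
  have ge: "real k \<le> real k * (2 * pi)" using mult_left_mono[of 1 "2 * pi" "real k"] pi_gt3 by simp
  have c1: "cos (real k * (2 * pi)) = 1" using cos_2npi[of k] by (simp add: mult_ac)
  moreover have "cos (real k * (2 * pi) + pi) = - 1" using c1 by (simp only: cos_periodic_pi)
  ultimately have c: "cos (real k * (2 * pi)) = 1" "cos (real k * (2 * pi) + pi) = - 1" by blast+
  let ?w = "complex_of_real (real k * (2 * pi)) * complex_of_real (real k * (2 * pi))"
  let ?v = "complex_of_real (real k * (2 * pi) + pi) * complex_of_real (real k * (2 * pi) + pi)"
  have "norm (F ?w - 2) < 1" using *[OF ge] unfolding c by simp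
  moreover have "norm (F ?v + 2) < 1"
    using *[of "real k * (2 * pi) + pi"] ge pi_gt_zero unfolding c by simp
  moreover have "norm ((2::complex) - - 2) \<le> norm (F ?w - 2) + norm (F ?v + 2)" if "F ?w = F ?v"
    using norm_triangle_ineq4[of "F ?v + 2" "F ?w - 2"] that by simp
  ultimately have "F ?w \<noteq> F ?v" by fastforce
  then show ?thesis by metis
qed

text \<open>If F is 2 or -2, then cos s and hence Im s are bounded, so the exponential weights in
  the asymptotics become constants. The integrals then differ from those for zero potential by
  O(1/s). The factors s compensate for \<phi> being of size 1/s.\<close>

lemma gram_asymptotic:
  assumes s: "8 * (216 * Q + 18) < norm s" and F: "F (s * s) = 2 \<or> F (s * s) = - 2"
  shows "norm (Itt (s * s) - 1 / 2) \<le> 1 / 8" "norm (s * s * Ipp (s * s) - 1 / 2) \<le> 1 / 8"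
    "norm (s * Itp (s * s)) \<le> 1 / 8"
proof -
  let ?\<mu> = "s * s"
  let ?E = "exp \<bar>Im s\<bar>"
  have s1: "2 * Q \<le> norm s" "s \<noteq> 0" "8 * Q \<le> norm s" using s Q_nonneg by auto
  have "4 * Q / norm s * ?E \<le> 1 / 2 * ?E"
    using s1 by (intro mult_right_mono) (auto simp: field_simps)
  then have "norm (F ?\<mu> - 2 * cos s) \<le> ?E / 2" using discriminant_asymptotic[OF s1(1,2)] by simp
  moreover have "norm (2 * cos s) \<le> norm (F ?\<mu>) + norm (F ?\<mu> - 2 * cos s)"
    using norm_triangle_ineq4[of "F ?\<mu>" "F ?\<mu> - 2 * cos s"] by simp
  moreover have "norm (F ?\<mu>) = 2" using F by auto
  \<comment> \<open>Combines (E - 1) / 2 \<le> norm (cos s) with 2 norm (cos s) \<le> 2 + E /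
    2.\<close>
  ultimately have E: "?E \<le> 6" using norm_cos_ge_exp[of s] by (simp add: norm_mult)
  have Ex: "exp (\<bar>Im s\<bar> * x) \<le> 6" if "x \<in> {0..1}" for x
  proof -
    have "\<bar>Im s\<bar> * x \<le> \<bar>Im s\<bar> * 1" using that by (intro mult_left_mono) auto
    then show ?thesis using E by (smt (verit) exp_le_cancel_iff mult_1_right)
  qed
  define \<delta> where "\<delta> = 12 * Q / norm s"
  have \<delta>: "2 * Q / norm s * exp (\<bar>Im s\<bar> * x) \<le> \<delta>" if "x \<in> {0..1}" for x
  proof -
    have "2 * Q / norm s * exp (\<bar>Im s\<bar> * x) \<le> 2 * Q / norm s * 6"
      using Ex[OF that] Q_nonneg by (intro mult_left_mono) auto
    then show ?thesis by (simp add: \<delta>_def)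
  qed
  have dt: "norm (th ?\<mu> x - cos (s * of_real x)) \<le> \<delta>" if "x \<in> {0..1}" for x
    using theta_asymptotic[OF s1(1,2) that] \<delta>[OF that] by linarith
  have dp: "norm (s * ph ?\<mu> x - sin (s * of_real x)) \<le> \<delta>" if "x \<in> {0..1}" for x
    using phi_asymptotic[OF s1(1,2) that] \<delta>[OF that] by linarith
  have nt: "norm (th ?\<mu> x) \<le> 12" if "x \<in> {0..1}" for x
    using theta_bound[OF s1(1,2) that] Ex[OF that] by linarith
  have np: "norm (s * ph ?\<mu> x) \<le> 12" if "x \<in> {0..1}" for x
  proof -
    have "norm (s * ph ?\<mu> x) \<le> norm s * (2 / norm s * exp (\<bar>Im s\<bar> * x))"
      unfolding norm_mult by (intro mult_left_mono phi_bound s1 that) auto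
    then show ?thesis using Ex[OF that] s1(2) by simp
  qed
  have nc: "norm (cos (s * of_real x)) \<le> 6" "norm (sin (s * of_real x)) \<le> 6" if "x \<in> {0..1}" for x
    using norm_cos_le_exp[of "s * of_real x"] norm_sin_le_exp[of "s * of_real x"] Ex[OF that] that
    by (simp_all add: abs_mult)
  \<comment> \<open>In products, 12 bounds the solutions and 6 the trigonometric functions; \<delta>
    bounds the error of each factor.\<close>
  have close: "norm (integral {0..1} u - integral {0..1} v) \<le> \<delta> * (12 + 6)"
    if "continuous_on {0..1} u" "continuous_on {0..1} v"
      "\<And>x. x \<in> {0..1} \<Longrightarrow> norm (u x - v x) \<le> \<delta> * (12 + 6)" for u v :: "real \<Rightarrow> complex"
  proof -
    have i: "u integrable_on {0..1}" "v integrable_on {0..1}" using that by (auto intro: integrable_continuous_real)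
    have "norm (integral {0..1} (\<lambda>x. u x - v x)) \<le> integral {0..1} (\<lambda>x::real. \<delta> * (12 + 6))"
    proof (rule Henstock_Kurzweil_Integration.integral_norm_bound_integral)
      show "(\<lambda>x. u x - v x) integrable_on {0..1}" using i by (rule Henstock_Kurzweil_Integration.integrable_diff)
    qed (use that(3) in auto)
    then show ?thesis using i by (simp add: Henstock_Kurzweil_Integration.integral_diff)
  qed
  let ?c = "\<lambda>x. cos (s * complex_of_real x)" and ?s = "\<lambda>x. sin (s * complex_of_real x)"
  have a1: "norm (Itt ?\<mu> - integral {0..1} (\<lambda>x. ?c x * ?c x)) \<le> \<delta> * (12 + 6)"
    unfolding Itt_def
    by (intro close norm_mult_diff_le continuous_intros dt nt nc)
  have a2: "norm (integral {0..1} (\<lambda>x. (s * ph ?\<mu> x) * (s * ph ?\<mu> x)) - integral {0..1} (\<lambda>x. ?s x * ?s x)) \<le> \<delta> * (12 + 6)"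
    by (intro close norm_mult_diff_le continuous_intros dp np nc)
  have a3: "norm (integral {0..1} (\<lambda>x. th ?\<mu> x * (s * ph ?\<mu> x)) - integral {0..1} (\<lambda>x. ?c x * ?s x)) \<le> \<delta> * (12 + 6)"
    by (intro close norm_mult_diff_le continuous_intros dp dt np nc)
  have e2: "integral {0..1} (\<lambda>x. (s * ph ?\<mu> x) * (s * ph ?\<mu> x)) = s * s * Ipp ?\<mu>"
  proof -
    have "(\<lambda>x. (s * ph ?\<mu> x) * (s * ph ?\<mu> x)) = (\<lambda>x. (s * s) * (ph ?\<mu> x * ph ?\<mu> x))"
      by (rule ext) (simp add: mult_ac)
    then show ?thesis by (simp only: Ipp_def integral_mult_right)
  qed
  have e3: "integral {0..1} (\<lambda>x. th ?\<mu> x * (s * ph ?\<mu> x)) = s * Itp ?\<mu>"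
  proof -
    have "(\<lambda>x. th ?\<mu> x * (s * ph ?\<mu> x)) = (\<lambda>x. s * (th ?\<mu> x * ph ?\<mu> x))"
      by (rule ext) (simp add: mult_ac)
    then show ?thesis by (simp only: Itp_def integral_mult_right)
  qed
  have n1: "norm (cos s) \<le> 6" "norm (sin s) \<le> 6" using nc[of 1] by auto
  have f: "norm (u * v / (2 * s)) \<le> 18 / norm s" if "norm u \<le> 6" "norm v \<le> 6" for u v :: complex
  proof -
    have "norm u * norm v \<le> 6 * 6" using that by (intro mult_mono) auto
    then show ?thesis using s1(2) by (simp add: norm_divide norm_mult field_simps)
  qed
  \<comment> \<open>Origin of the constant in the hypothesis: \<delta> * 18 is 216 Q / norm s, and
    18 / norm s bounds the correction terms in \<open>integral_cos_sin\<close>, whose trigonometric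
    factors are at most 6.\<close>
  have K: "\<delta> * (12 + 6) + 18 / norm s \<le> 1 / 8"
    using s s1(2) by (simp add: \<delta>_def field_simps)
  show "norm (Itt ?\<mu> - 1 / 2) \<le> 1 / 8"
    using norm_triangle_mono[OF a1 f[OF n1(2,1)]] K
    unfolding integral_cos_sin[OF s1(2)] by simp
  show "norm (s * s * Ipp ?\<mu> - 1 / 2) \<le> 1 / 8"
    using norm_triangle_mono[of _ _ "- (sin s * cos s / (2 * s))", OF a2] f[OF n1(2,1)] K
    unfolding integral_cos_sin[OF s1(2)] e2 by fastforce
  show "norm (s * Itp ?\<mu>) \<le> 1 / 8"
    using norm_triangle_mono[OF a3 f[OF n1(2,2)]] K
    unfolding integral_cos_sin[OF s1(2)] e3 by simp
qed

text \<open>After scaling, the diagonal integrals have modulus at least 1/2 - 1/8 = 3/8 and the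
  mixed one at most 1/8, so the determinant cannot vanish.\<close>

lemma gram_nondegenerate:
  obtains R where "0 < R" "\<And>\<mu>. R < norm \<mu> \<Longrightarrow> F \<mu> = 2 \<or> F \<mu> = - 2 \<Longrightarrow>
    Itt \<mu> \<noteq> 0 \<and> Ipp \<mu> \<noteq> 0 \<and> Itt \<mu> * Ipp \<mu> \<noteq> Itp \<mu> * Itp \<mu>"
proof
  define r where "r = 8 * (216 * Q + 18)"
  have r: "0 < r" using Q_nonneg by (simp add: r_def)
  then show "0 < r\<^sup>2" by simp
  fix \<mu> assume \<mu>: "r\<^sup>2 < norm \<mu>" "F \<mu> = 2 \<or> F \<mu> = - 2"
  define s where "s = csqrt \<mu>"
  have ss: "s * s = \<mu>" by (simp add: s_def power2_eq_square[symmetric])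
  have "r\<^sup>2 < (norm s)\<^sup>2" using \<mu>(1) by (simp add: ss[symmetric] norm_mult power2_eq_square)
  then have "r < norm s" by (rule power2_less_imp_less) simp
  then have s: "8 * (216 * Q + 18) < norm s" by (simp add: r_def)
  note g = gram_asymptotic[OF s, unfolded ss, OF \<mu>(2)]
  have half: "norm (1 / 2 :: complex) = 1 / 2" by (simp add: norm_divide)
  have 1: "3 / 8 \<le> norm (Itt \<mu>)" using norm_triangle_ineq4[of "Itt \<mu>" "Itt \<mu> - 1 / 2"] g(1) half by simp
  have 2: "3 / 8 \<le> norm (\<mu> * Ipp \<mu>)"
    using norm_triangle_ineq4[of "\<mu> * Ipp \<mu>" "\<mu> * Ipp \<mu> - 1 / 2"] g(2) half by simp
  have 3: "norm (s * Itp \<mu>) * norm (s * Itp \<mu>) \<le> 1 / 8 * (1 / 8)" using g(3) by (intro mult_mono) auto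
  have 4: "3 / 8 * (3 / 8) \<le> norm (Itt \<mu>) * norm (\<mu> * Ipp \<mu>)" using 1 2 by (intro mult_mono) auto
  have "Itt \<mu> * Ipp \<mu> \<noteq> Itp \<mu> * Itp \<mu>"
  proof
    assume eq: "Itt \<mu> * Ipp \<mu> = Itp \<mu> * Itp \<mu>"
    have "Itt \<mu> * (\<mu> * Ipp \<mu>) = \<mu> * (Itt \<mu> * Ipp \<mu>)" by (simp add: mult_ac)
    also have "\<dots> = (s * s) * (Itp \<mu> * Itp \<mu>)" by (simp only: eq ss)
    also have "\<dots> = (s * Itp \<mu>) * (s * Itp \<mu>)" by (simp only: mult_ac)
    finally have "norm (Itt \<mu>) * norm (\<mu> * Ipp \<mu>) = norm (s * Itp \<mu>) * norm (s * Itp \<mu>)"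
      by (metis norm_mult)
    then show False using 3 4 by simp
  qed
  then show "Itt \<mu> \<noteq> 0 \<and> Ipp \<mu> \<noteq> 0 \<and> Itt \<mu> * Ipp \<mu> \<noteq> Itp \<mu> * Itp \<mu>"
    using 1 2 by auto
qed


section \<open>Multiple eigenvalues\<close>

text \<open>Covers points that are not roots as well: there the order is 0.\<close>

lemma multiplicity_zero_order:
  obtains r g where "0 < r" "g holomorphic_on cball \<mu> r"
    "\<And>w. w \<in> cball \<mu> r \<Longrightarrow> F w - 2 * cos t = g w * (w - \<mu>) ^ Lt_multiplicity q t \<mu> \<and> g w \<noteq> 0"
proof -
  have "\<exists>w\<in>UNIV. F w - 2 * cos t \<noteq> 0" using discriminant_nonconstant[of "2 * cos t"] by auto
  then have "\<exists>r>0. cball \<mu> r \<subseteq> UNIV \<and> zor_poly (\<lambda>z. F z - 2 * cos t) \<mu> holomorphic_on cball \<mu> r \<and>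
     (\<forall>w\<in>cball \<mu> r. F w - 2 * cos t = zor_poly (\<lambda>z. F z - 2 * cos t) \<mu> w *
        (w - \<mu>) ^ nat (zorder (\<lambda>z. F z - 2 * cos t) \<mu>) \<and> zor_poly (\<lambda>z. F z - 2 * cos t) \<mu> w \<noteq> 0)"
    by (intro zorder_exist_zero[THEN conjunct2] holomorphic_intros holomorphic_discriminant) auto
  then show ?thesis using that unfolding Lt_multiplicity_def by metis
qed

lemma multiplicity_pos_imp_root:
  assumes "0 < Lt_multiplicity q t \<mu>"
  shows "F \<mu> = 2 * cos t"
proof -
  obtain r g where "0 < r"
    "\<And>w. w \<in> cball \<mu> r \<Longrightarrow> F w - 2 * cos t = g w * (w - \<mu>) ^ Lt_multiplicity q t \<mu> \<and> g w \<noteq> 0"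
    using multiplicity_zero_order by metis
  from this(2)[of \<mu>] this(1) show ?thesis using assms by (simp add: zero_power)
qed

text \<open>At a zero of order \<open>k \<ge> 2\<close> the derivative has order \<open>k - 1\<close>, and \<open>2 (k - 1) \<ge> k\<close>.\<close>

lemma multiple_root_estimate:
  assumes "2 \<le> Lt_multiplicity q t \<mu>"
  shows "F \<mu> = 2 * cos t" "F' \<mu> = 0"
    and "\<exists>C. eventually (\<lambda>w. (w \<noteq> \<mu> \<longrightarrow> F w \<noteq> 2 * cos t \<and> F' w \<noteq> 0) \<and>
           (norm (F' w))\<^sup>2 \<le> C * norm (F w - 2 * cos t)) (nhds \<mu>)"
proof -
  define k where "k = Lt_multiplicity q t \<mu>"
  obtain r g where r: "0 < r" and g: "g holomorphic_on cball \<mu> r"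
    and Fg: "\<And>w. w \<in> cball \<mu> r \<Longrightarrow> F w - 2 * cos t = g w * (w - \<mu>) ^ k \<and> g w \<noteq> 0"
    using multiplicity_zero_order[of \<mu> t] unfolding k_def by metis
  have k: "2 \<le> k" "k = Suc (k - 1)" using assms by (auto simp: k_def)
  have gb: "g holomorphic_on ball \<mu> r" using g by (rule holomorphic_on_subset) auto
  \<comment> \<open>The cofactor of \<open>F'\<close> after splitting off the power k - 1; its value
    at \<mu> is k g(\<mu>), hence nonzero.\<close>
  define h where "h w = deriv g w * (w - \<mu>) + of_nat k * g w" for w
  have F'h: "F' w = (w - \<mu>) ^ (k - 1) * h w" if w: "w \<in> ball \<mu> r" for w
  proof -
    have "((\<lambda>w. g w * (w - \<mu>) ^ k) has_field_derivative
        deriv g w * (w - \<mu>) ^ k + g w * (of_nat k * (w - \<mu>) ^ (k - 1))) (at w)"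
      using holomorphic_derivI[OF gb open_ball w]
      by (auto intro!: derivative_eq_intros)
    moreover have "((\<lambda>w. F w - 2 * cos t) has_field_derivative F' w) (at w)"
      using DERIV_diff[OF discriminant_derivative DERIV_const] by simp
    then have "((\<lambda>w. g w * (w - \<mu>) ^ k) has_field_derivative F' w) (at w)"
      by (rule has_field_derivative_transform_within_open[OF _ open_ball w])
         (use Fg in auto)
    ultimately have "F' w = deriv g w * (w - \<mu>) ^ k + g w * (of_nat k * (w - \<mu>) ^ (k - 1))"
      using DERIV_unique by blast
    moreover have "(w - \<mu>) ^ k = (w - \<mu>) * (w - \<mu>) ^ (k - 1)" by (subst k(2)) simp
    ultimately show ?thesis by (simp add: h_def algebra_simps)
  qed
  show "F \<mu> = 2 * cos t" using Fg[of \<mu>] r k by (simp add: power_0_left)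
  show "F' \<mu> = 0" using F'h[of \<mu>] r k by (simp add: power_0_left)
  have ch: "isCont h \<mu>" "isCont g \<mu>"
  proof -
    have "deriv g holomorphic_on ball \<mu> r" by (rule holomorphic_deriv[OF gb open_ball])
    then have "continuous_on (ball \<mu> r) h" unfolding h_def[abs_def]
      by (intro continuous_intros holomorphic_on_imp_continuous_on gb)
    then show "isCont h \<mu>" using r by (simp add: continuous_on_eq_continuous_at)
    show "isCont g \<mu>" using holomorphic_on_imp_continuous_on[OF gb] r
      by (simp add: continuous_on_eq_continuous_at)
  qed
  have g0: "g \<mu> \<noteq> 0" using Fg[of \<mu>] r by simp
  have h0: "h \<mu> \<noteq> 0" using g0 k by (simp add: h_def)
  define A where "A = norm (h \<mu>) + 1"
  define B where "B = norm (g \<mu>) / 2"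
  have B: "0 < B" using g0 by (simp add: B_def)
  have nh: "((\<lambda>w. norm (h w)) \<longlongrightarrow> norm (h \<mu>)) (nhds \<mu>)" "((\<lambda>w. norm (g w)) \<longlongrightarrow> norm (g \<mu>)) (nhds \<mu>)"
    using ch by (auto intro!: tendsto_norm simp: isCont_def tendsto_at_iff_tendsto_nhds)
  have "eventually (\<lambda>w. norm (h w) < A) (nhds \<mu>)" "eventually (\<lambda>w. 0 < norm (h w)) (nhds \<mu>)"
    "eventually (\<lambda>w. B < norm (g w)) (nhds \<mu>)"
    using order_tendstoD(2)[OF nh(1), of A] order_tendstoD(1)[OF nh(1), of 0]
      order_tendstoD(1)[OF nh(2), of B] h0 g0 by (simp_all add: A_def B_def)
  moreover have "eventually (\<lambda>w. w \<in> ball \<mu> (min r 1)) (nhds \<mu>)"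
    using r by (intro eventually_nhds_in_open) auto
  ultimately have "eventually (\<lambda>w. (w \<noteq> \<mu> \<longrightarrow> F w \<noteq> 2 * cos t \<and> F' w \<noteq> 0) \<and>
           (norm (F' w))\<^sup>2 \<le> A\<^sup>2 / B * norm (F w - 2 * cos t)) (nhds \<mu>)"
  proof eventually_elim
    case (elim w)
    then have w: "w \<in> ball \<mu> r" "w \<in> cball \<mu> r" "norm (w - \<mu>) < 1"
      by (auto simp: dist_norm norm_minus_commute)
    have e1: "F w - 2 * cos t = g w * (w - \<mu>) ^ k" "g w \<noteq> 0" using Fg[OF w(2)] by auto
    have "w \<noteq> \<mu> \<longrightarrow> F w \<noteq> 2 * cos t \<and> F' w \<noteq> 0"
      using e1 F'h[OF w(1)] elim(2) by auto
    moreover have "(norm (F' w))\<^sup>2 \<le> A\<^sup>2 / B * norm (F w - 2 * cos t)"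
    proof -
      have "(norm (F' w))\<^sup>2 = norm (w - \<mu>) ^ ((k - 1) * 2) * (norm (h w))\<^sup>2"
        by (simp add: F'h[OF w(1)] norm_mult norm_power power_mult_distrib power_mult)
      \<comment> \<open>The exponent 2 (k - 1) may be lowered to k because the distance is below 1;
        this is why the ball has radius \<open>min r 1\<close>.\<close>
      also have "\<dots> \<le> norm (w - \<mu>) ^ k * A\<^sup>2"
        using w(3) k elim(1) by (intro mult_mono power_decreasing power_mono) auto
      also have "\<dots> = A\<^sup>2 / B * (B * norm (w - \<mu>) ^ k)" using B by simp
      also have "\<dots> \<le> A\<^sup>2 / B * (norm (g w) * norm (w - \<mu>) ^ k)"
        using elim(3) B by (intro mult_left_mono mult_right_mono) auto
      also have "norm (g w) * norm (w - \<mu>) ^ k = norm (F w - 2 * cos t)"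
        unfolding e1 by (simp add: norm_mult norm_power)
      finally show ?thesis .
    qed
    ultimately show ?case by blast
  qed
  then show "\<exists>C. eventually (\<lambda>w. (w \<noteq> \<mu> \<longrightarrow> F w \<noteq> 2 * cos t \<and> F' w \<noteq> 0) \<and>
           (norm (F' w))\<^sup>2 \<le> C * norm (F w - 2 * cos t)) (nhds \<mu>)" by blast
qed

section \<open>Geometric multiplicity\<close>

text \<open>If an off-diagonal entry vanishes, the diagonal entries are the eigenvalues of the
  monodromy matrix; their product 1 and sum 2 \<sigma> make both equal to \<sigma>.\<close>

lemma unipotent_monodromy:
  assumes "F \<mu> = 2 * \<sigma>" "\<sigma> * \<sigma> = 1" "ph \<mu> 1 = 0 \<or> th1 \<mu> 1 = 0"
  shows "th \<mu> 1 = \<sigma>" "ph1 \<mu> 1 = \<sigma>"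
proof -
  have TP: "th \<mu> 1 * ph1 \<mu> 1 = 1" using wronskian[of \<mu> 1] assms(3) by auto
  have s: "ph1 \<mu> 1 = 2 * \<sigma> - th \<mu> 1" using assms(1) by (simp add: discriminant_eq algebra_simps)
  have "(th \<mu> 1 - \<sigma>) * (th \<mu> 1 - \<sigma>) = \<sigma> * \<sigma> - th \<mu> 1 * (2 * \<sigma> - th \<mu> 1)" by (simp add: algebra_simps)
  also have "\<dots> = 0" using TP s assms(2) by simp
  finally show "th \<mu> 1 = \<sigma>" by simp
  then show "ph1 \<mu> 1 = \<sigma>" using s by simp
qed

text \<open>Once the diagonal entries agree, F' = 0 reads \<phi>(1) \<open>Itt\<close> =
  \<theta>'(1) \<open>Ipp\<close>, and nonvanishing integrals make the two off-diagonal entries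
  vanish together.\<close>

lemma degenerate_iff:
  assumes "F \<mu> = 2 * \<sigma>" "\<sigma> * \<sigma> = 1" "F' \<mu> = 0" "Itt \<mu> \<noteq> 0" "Ipp \<mu> \<noteq> 0"
  shows "ph \<mu> 1 = 0 \<longleftrightarrow> th1 \<mu> 1 = 0"
  using unipotent_monodromy[OF assms(1,2)] assms(3-5) by (auto simp: F'_def)

text \<open>A solution vanishing at 0 is a multiple of \<phi>, which is not identically zero on
  [0, 1] because its derivative at 0 is 1.\<close>

lemma dirichlet_eigenvalue_iff: "dirichlet_eigenvalue q \<mu> \<longleftrightarrow> ph \<mu> 1 = 0"
proof
  assume "dirichlet_eigenvalue q \<mu>"
  then obtain y y1 where y: "has_ac_derivative 0 1 y y1 (\<lambda>x. q x * y x - \<mu> * y x)"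
     and nz: "\<exists>x\<in>{0..1}. y x \<noteq> 0" and bc: "y 0 = 0" "y 1 = 0"
    unfolding dirichlet_eigenvalue_def hill_expr_iff by blast
  have ac: "has_ac_derivative 0 1 y y1 (\<lambda>x. (q x - \<mu>) * y x)" using y by (simp add: left_diff_distrib)
  have "y1 0 \<noteq> 0"
  proof
    assume "y1 0 = 0"
    then have "y x = 0" if "x \<in> {0..1}" for x
      using solution_on_unit_interval(1)[OF ac that] bc by simp
    with nz show False by blast
  qed
  then show "ph \<mu> 1 = 0" using solution_on_unit_interval(1)[OF ac, of 1] bc by simp
next
  assume p: "ph \<mu> 1 = 0"
  have "\<exists>x\<in>{0..1}. ph \<mu> x \<noteq> 0"
  proof (rule ccontr)
    assume "\<not> (\<exists>x\<in>{0..1}. ph \<mu> x \<noteq> 0)"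
    then have z: "\<And>x. x \<in> {0..1} \<Longrightarrow> ph \<mu> x = 0" by blast
    have "vector_derivative (ph \<mu>) (at 0 within {0..1}) = 1"
      using vector_derivative_endpoints(1)[OF phi_ac] by simp
    moreover have "(ph \<mu> has_vector_derivative 0) (at 0 within {0..1})"
      by (rule has_vector_derivative_transform[OF _ z has_vector_derivative_const]) auto
    ultimately show False
      using vector_derivative_within_closed_interval[of 0 1 0 "ph \<mu>" 0] by simp
  qed
  then show "dirichlet_eigenvalue q \<mu>"
    unfolding dirichlet_eigenvalue_def hill_expr_iff
    using phi_ac[of 0 1 \<mu>] p by (intro exI[of _ "ph \<mu>"]) (auto simp: left_diff_distrib)
qed

lemma neumann_eigenvalue_iff: "neumann_eigenvalue q \<mu> \<longleftrightarrow> th1 \<mu> 1 = 0"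
proof
  assume "neumann_eigenvalue q \<mu>"
  then obtain y y1 where y: "has_ac_derivative 0 1 y y1 (\<lambda>x. q x * y x - \<mu> * y x)"
     and nz: "\<exists>x\<in>{0..1}. y x \<noteq> 0"
     and bc: "vector_derivative y (at 0 within {0..1}) = 0" "vector_derivative y (at 1 within {0..1}) = 0"
    unfolding neumann_eigenvalue_def hill_expr_iff by blast
  have ac: "has_ac_derivative 0 1 y y1 (\<lambda>x. (q x - \<mu>) * y x)" using y by (simp add: left_diff_distrib)
  have bc: "y1 0 = 0" "y1 1 = 0" using bc vector_derivative_endpoints[OF y] by auto
  have "y 0 \<noteq> 0"
  proof
    assume "y 0 = 0"
    then have "y x = 0" if "x \<in> {0..1}" for x
      using solution_on_unit_interval(1)[OF ac that] bc by simp
    with nz show False by blast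
  qed
  then show "th1 \<mu> 1 = 0" using solution_on_unit_interval(2)[OF ac, of 1] bc by simp
next
  assume p: "th1 \<mu> 1 = 0"
  have "vector_derivative (th \<mu>) (at 0 within {0..1}) = 0" "vector_derivative (th \<mu>) (at 1 within {0..1}) = 0"
    using vector_derivative_endpoints[OF theta_ac] p by simp_all
  moreover have "\<exists>x\<in>{0..1}. th \<mu> x \<noteq> 0" by (rule bexI[of _ 0]) auto
  ultimately show "neumann_eigenvalue q \<mu>"
    unfolding neumann_eigenvalue_def hill_expr_iff
    using theta_ac[of 0 1 \<mu>] by (intro exI[of _ "th \<mu>"]) (auto simp: left_diff_distrib)
qed

lemma Lt_op_bloch:
  assumes "exp (\<i> * t) = e" "e * e + 1 = F \<mu> * e"
  shows "Lt_op q t (bloch e \<mu>) (\<lambda>x. \<mu> * bloch e \<mu> x)"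
  unfolding Lt_op_eigen_iff assms(1)
proof (intro exI conjI ballI)
  show "bloch e \<mu> x = ph \<mu> 1 * th \<mu> x + (e - th \<mu> 1) * ph \<mu> x" for x by (rule bloch_def)
  show "ph \<mu> 1 * th \<mu> 1 + (e - th \<mu> 1) * ph \<mu> 1 = e * ph \<mu> 1" by (simp add: algebra_simps)
  have "ph \<mu> 1 * th1 \<mu> 1 = th \<mu> 1 * ph1 \<mu> 1 - 1" using wronskian[of \<mu> 1] by (simp add: algebra_simps)
  then have "ph \<mu> 1 * th1 \<mu> 1 + (e - th \<mu> 1) * ph1 \<mu> 1 = e * ph1 \<mu> 1 - 1" by (simp add: algebra_simps)
  also have "\<dots> = e * (F \<mu> - th \<mu> 1) - 1" by (simp add: discriminant_eq)
  also have "\<dots> = e * (e - th \<mu> 1)" using assms(2) by (simp add: algebra_simps)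
  finally show "ph \<mu> 1 * th1 \<mu> 1 + (e - th \<mu> 1) * ph1 \<mu> 1 = e * (e - th \<mu> 1)" .
qed

interpretation fun_space: vector_space "\<lambda>(c::complex) (f::real \<Rightarrow> complex). (\<lambda>x. c * f x)"
  by unfold_locales (auto simp: fun_eq_iff algebra_simps)

lemma restrict_Lt_op:
  assumes "Lt_op q t y (\<lambda>x. \<mu> * y x)"
  shows "Lt_op q t (\<lambda>x. if x \<in> {0..1} then y x else 0) (\<lambda>x. \<mu> * (if x \<in> {0..1} then y x else 0))"
proof -
  obtain a b where "\<forall>x\<in>{0..1}. y x = a * th \<mu> x + b * ph \<mu> x"
     "a * th \<mu> 1 + b * ph \<mu> 1 = exp (\<i> * t) * a" "a * th1 \<mu> 1 + b * ph1 \<mu> 1 = exp (\<i> * t) * b"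
    using assms unfolding Lt_op_eigen_iff by blast
  then show ?thesis
    unfolding Lt_op_eigen_iff[where y = "\<lambda>x. if x \<in> {0..1} then y x else 0"]
    by (intro exI[of _ a] exI[of _ b]) auto
qed

lemma geometric_multiplicity_eq_1:
  assumes "F \<mu> = 2 * \<sigma>" "\<sigma> * \<sigma> = 1" "exp (\<i> * t) = \<sigma>" "ph \<mu> 1 \<noteq> 0"
  shows "Lt_geometric_multiplicity q t \<mu> = 1"
proof -
  let ?E = "{y. Lt_op q t y (\<lambda>x. \<mu> * y x) \<and> (\<forall>x. x \<notin> {0..1} \<longrightarrow> y x = 0)}"
  define b where "b x = (if x \<in> {0..1} then bloch \<sigma> \<mu> x else 0)" for x :: real
  have "\<sigma> * \<sigma> + 1 = F \<mu> * \<sigma>" using assms(1,2) by simp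
  then have "b \<in> ?E"
    using restrict_Lt_op[OF Lt_op_bloch[OF assms(3)]] by (simp add: b_def[abs_def])
  moreover have "?E \<subseteq> fun_space.span {b}"
  proof
    fix y assume "y \<in> ?E"
    then have y: "Lt_op q t y (\<lambda>x. \<mu> * y x)" "\<And>x. x \<notin> {0..1} \<Longrightarrow> y x = 0" by auto
    obtain c where c: "\<And>x. x \<in> {0..1} \<Longrightarrow> y x = c * bloch \<sigma> \<mu> x"
      using eigenfunction_eq_bloch[OF y(1) assms(4)] unfolding assms(3) by blast
    have "y = (\<lambda>x. c * b x)" by (rule ext) (use c y(2) in \<open>auto simp: b_def\<close>)
    then show "y \<in> fun_space.span {b}" by (auto simp: fun_space.span_singleton)
  qed
  moreover have "fun_space.independent {b}"
  proof -
    have "b 0 \<noteq> 0" using assms(4) by (simp add: b_def bloch_def)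
    then have "b \<noteq> 0" by auto
    then show ?thesis by (simp add: fun_space.dependent_single)
  qed
  ultimately show ?thesis
    unfolding Lt_geometric_multiplicity_def by (intro fun_space.dim_unique[of "{b}"]) auto
qed

lemma phi_nonzero:
  assumes "Ipp \<mu> \<noteq> 0"
  shows "\<exists>x\<in>{0..1}. ph \<mu> x \<noteq> 0"
proof (rule ccontr)
  assume "\<not> (\<exists>x\<in>{0..1}. ph \<mu> x \<noteq> 0)"
  then have "Ipp \<mu> = integral {0..1} (\<lambda>x::real. 0::complex)"
    unfolding Ipp_def by (intro integral_cong) auto
  then show False using assms by simp
qed

lemma Lt_op_fundamental:
  assumes "exp (\<i> * t) = \<sigma>" "ph \<mu> 1 = 0" "th1 \<mu> 1 = 0" "th \<mu> 1 = \<sigma>" "ph1 \<mu> 1 = \<sigma>"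
  shows "Lt_op q t (th \<mu>) (\<lambda>x. \<mu> * th \<mu> x)" "Lt_op q t (ph \<mu>) (\<lambda>x. \<mu> * ph \<mu> x)"
proof -
  show "Lt_op q t (th \<mu>) (\<lambda>x. \<mu> * th \<mu> x)"
    unfolding Lt_op_eigen_iff by (rule exI[of _ 1], rule exI[of _ 0]) (simp add: assms)
  show "Lt_op q t (ph \<mu>) (\<lambda>x. \<mu> * ph \<mu> x)"
    unfolding Lt_op_eigen_iff by (rule exI[of _ 0], rule exI[of _ 1]) (simp add: assms)
qed

text \<open>With scalar monodromy every solution satisfies the boundary conditions, so the
  eigenspace has dimension 2.\<close>

lemma geometric_multiplicity_ne_1:
  assumes "exp (\<i> * t) = \<sigma>" "ph \<mu> 1 = 0" "th1 \<mu> 1 = 0" "th \<mu> 1 = \<sigma>" "ph1 \<mu> 1 = \<sigma>" "Ipp \<mu> \<noteq> 0"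
  shows "Lt_geometric_multiplicity q t \<mu> \<noteq> 1"
proof -
  let ?E = "{y. Lt_op q t y (\<lambda>x. \<mu> * y x) \<and> (\<forall>x. x \<notin> {0..1} \<longrightarrow> y x = 0)}"
  define u where "u x = (if x \<in> {0..1} then th \<mu> x else 0)" for x :: real
  define v where "v x = (if x \<in> {0..1} then ph \<mu> x else 0)" for x :: real
  note op = Lt_op_fundamental[OF assms(1-5)]
  have "{u, v} \<subseteq> ?E" using op[THEN restrict_Lt_op] by (auto simp: u_def[abs_def] v_def[abs_def])
  moreover have "?E \<subseteq> fun_space.span {u, v}"
  proof
    fix y assume "y \<in> ?E"
    then have y: "Lt_op q t y (\<lambda>x. \<mu> * y x)" "\<And>x. x \<notin> {0..1} \<Longrightarrow> y x = 0" by auto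
    obtain a b where c: "\<And>x. x \<in> {0..1} \<Longrightarrow> y x = a * th \<mu> x + b * ph \<mu> x"
      using y(1) unfolding Lt_op_eigen_iff by blast
    have "y = (\<lambda>x. a * u x) + (\<lambda>x. b * v x)"
      by (rule ext) (use c y(2) in \<open>auto simp: u_def v_def\<close>)
    then show "y \<in> fun_space.span {u, v}"
      by (auto intro!: fun_space.span_add fun_space.span_scale intro: fun_space.span_base)
  qed
  moreover have uv: "u \<notin> fun_space.span {v}"
  proof
    assume "u \<in> fun_space.span {v}"
    then obtain c where "u = (\<lambda>x. c * v x)" by (auto simp: fun_space.span_singleton)
    then have "u 0 = c * v 0" by metis
    then show False by (simp add: u_def v_def)
  qed
  moreover have "v \<noteq> 0"
  proof -
    obtain x where "x \<in> {0..1}" "ph \<mu> x \<noteq> 0" using phi_nonzero[OF assms(6)] by blast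
    then have "v x \<noteq> 0" by (simp add: v_def)
    then show ?thesis by auto
  qed
  moreover have "u \<noteq> v" using uv fun_space.span_base by blast
  ultimately have "Lt_geometric_multiplicity q t \<mu> = 2"
    unfolding Lt_geometric_multiplicity_def
    by (intro fun_space.dim_unique[of "{u, v}"])
       (auto simp: fun_space.independent_insert fun_space.dependent_single)
  then show ?thesis by simp
qed

text \<open>As \<sigma> is its own inverse, the Bloch solution is also its own partner in the
  solvability condition, and the required integral of its square is -\<phi>(1) F'(\<mu>) =
  0.\<close>

lemma one_eigenfunction_one_associatedI:
  assumes F: "F \<mu> = 2 * \<sigma>" "\<sigma> * \<sigma> = 1" "F' \<mu> = 0" and e: "exp (\<i> * t) = \<sigma>" and p: "ph \<mu> 1 \<noteq> 0"
  shows "one_eigenfunction_one_associated q t \<mu>"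
proof -
  let ?\<psi> = "bloch \<sigma> \<mu>"
  have "\<sigma> * \<sigma> + 1 = F \<mu> * \<sigma>" using F(1,2) by simp
  note op = Lt_op_bloch[OF e this]
  have eig: "Lt_eigenfunction q t \<mu> ?\<psi>"
    unfolding Lt_eigenfunction_def using op p by (auto intro!: bexI[of _ 0] simp: bloch_def)
  have orth: "integral {0..1} (\<lambda>x. ?\<psi> x * ?\<psi> x) = 0"
    using integral_bloch_mult[of \<sigma> \<sigma> \<mu>] F by simp
  have L2: "L2_01 ?\<psi>" by (intro L2_01_continuous continuous_intros)
  have "exp (\<i> * t) * \<sigma> = 1" using e F(2) by simp
  then obtain \<phi> where \<phi>: "Lt_op q t \<phi> (\<lambda>x. \<mu> * \<phi> x + ?\<psi> x)"
    using Lt_op_solvable[OF L2 p _ orth] by blast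
  have uniq: "\<exists>c. \<forall>x\<in>{0..1}. y x = c * ?\<psi> x" if "Lt_op q t y (\<lambda>x. \<mu> * y x)" for y
  proof (rule eigenfunction_eq_bloch[OF that p])
    fix c assume "\<And>x. x \<in> {0..1} \<Longrightarrow> y x = c * bloch (exp (\<i> * t)) \<mu> x"
    then show ?thesis unfolding e by blast
  qed
  have "\<exists>c d. \<forall>x\<in>{0..1}. \<phi>' x = c * \<phi> x + d * ?\<psi> x" if a: "Lt_associated q t \<mu> \<psi>' \<phi>'" for \<psi>' \<phi>'
  proof -
    obtain c where c: "\<And>x. x \<in> {0..1} \<Longrightarrow> \<psi>' x = c * ?\<psi> x"
      using uniq a unfolding Lt_associated_def Lt_eigenfunction_def by blast
    obtain z1 where z: "has_ac_derivative 0 1 \<phi>' z1 (\<lambda>x. q x * \<phi>' x - (\<mu> * \<phi>' x + \<psi>' x))"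
       "\<phi>' 1 = \<sigma> * \<phi>' 0" "z1 1 = \<sigma> * z1 0"
      using a unfolding Lt_associated_def Lt_op_eq_iff e by blast
    obtain y1 where y: "has_ac_derivative 0 1 \<phi> y1 (\<lambda>x. q x * \<phi> x - (\<mu> * \<phi> x + ?\<psi> x))"
       "\<phi> 1 = \<sigma> * \<phi> 0" "y1 1 = \<sigma> * y1 0"
      using \<phi> unfolding Lt_op_eq_iff e by blast
    \<comment> \<open>If the eigenfunction below the second chain is c times the chosen one,
      subtracting c times the chosen associated function leaves a solution of the homogeneous
      problem.\<close>
    define w where "w x = 1 * \<phi>' x + - c * \<phi> x" for x
    have ac: "has_ac_derivative 0 1 w (\<lambda>x. 1 * z1 x + - c * y1 x) (\<lambda>x. q x * w x - \<mu> * w x)"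
      unfolding w_def[abs_def]
      by (rule has_ac_derivative_cong[OF has_ac_derivative_lincomb[OF z(1) y(1)]])
         (simp add: c algebra_simps)
    have "L2_01 (\<lambda>x. \<mu> * w x)"
      by (intro L2_01_cmult L2_01_continuous has_ac_derivative_continuous(1)[OF ac])
    then have "Lt_op q t w (\<lambda>x. \<mu> * w x)"
      unfolding Lt_op_eq_iff e using ac y(2,3) z(2,3)
      by (intro conjI exI[of _ "\<lambda>x. 1 * z1 x + - c * y1 x"]) (auto simp: w_def algebra_simps)
    then obtain d where "\<And>x. x \<in> {0..1} \<Longrightarrow> w x = d * ?\<psi> x" using uniq by blast
    then have "\<forall>x\<in>{0..1}. \<phi>' x = c * \<phi> x + d * ?\<psi> x"
      unfolding w_def by (auto simp: algebra_simps)
    then show ?thesis by blast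
  qed
  then show ?thesis
    unfolding one_eigenfunction_one_associated_def
    using eig \<phi> uniq by (intro exI[of _ ?\<psi>] exI[of _ \<phi>]) (auto simp: Lt_associated_def Lt_eigenfunction_def)
qed

text \<open>Both fundamental solutions are eigenfunctions here, and their values at 0 show that they
  are not multiples of one function.\<close>

lemma not_one_eigenfunction_one_associated:
  assumes "exp (\<i> * t) = \<sigma>" "ph \<mu> 1 = 0" "th1 \<mu> 1 = 0" "th \<mu> 1 = \<sigma>" "ph1 \<mu> 1 = \<sigma>" "Ipp \<mu> \<noteq> 0"
  shows "\<not> one_eigenfunction_one_associated q t \<mu>"
proof
  assume "one_eigenfunction_one_associated q t \<mu>"
  then obtain \<psi> where \<psi>: "\<And>y. Lt_eigenfunction q t \<mu> y \<Longrightarrow> \<exists>c. \<forall>x\<in>{0..1}. y x = c * \<psi> x"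
    unfolding one_eigenfunction_one_associated_def by metis
  note op = Lt_op_fundamental[OF assms(1-5)]
  have "Lt_eigenfunction q t \<mu> (th \<mu>)" "Lt_eigenfunction q t \<mu> (ph \<mu>)"
    unfolding Lt_eigenfunction_def using op phi_nonzero[OF assms(6)] by (auto intro!: bexI[of _ 0])
  then obtain c d where c: "\<And>x. x \<in> {0..1} \<Longrightarrow> th \<mu> x = c * \<psi> x" "\<And>x. x \<in> {0..1} \<Longrightarrow> ph \<mu> x = d * \<psi> x"
    using \<psi> by metis
  have "\<psi> 0 \<noteq> 0" using c(1)[of 0] by auto
  then have "d = 0" using c(2)[of 0] by auto
  then show False using c(2) phi_nonzero[OF assms(6)] by auto
qed

text \<open>\<open>L_t\<close> depends on t only through exp(i t). For t0 = pi this also gives the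
  membership at -t0 that an ESS requires.\<close>

lemma eigenvalue_in_spectrum:
  assumes "Lt_eigenfunction q t \<mu> y" "exp (\<i> * s) = exp (\<i> * t)"
  shows "\<mu> \<in> Lt_spectrum q s"
proof -
  have "Lt_op q s y (\<lambda>x. \<mu> * y x)" "\<exists>x\<in>{0..1}. y x \<noteq> 0"
    using assms unfolding Lt_eigenfunction_def Lt_op_def by auto
  then show ?thesis unfolding Lt_spectrum_def Lt_resolvent_set_def by blast
qed

end

section \<open>Elementary estimates for simple zeros, quadratic roots and the cosine\<close>

lemma DERIV_norm_bounds:
  fixes f :: "complex \<Rightarrow> complex"
  assumes "(f has_field_derivative D) (at \<mu>)"
  shows "eventually (\<lambda>w. norm (f w - f \<mu>) \<le> (norm D + 1) * norm (w - \<mu>)) (at \<mu>)"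
    and "D \<noteq> 0 \<Longrightarrow> eventually (\<lambda>w. norm D / 2 * norm (w - \<mu>) \<le> norm (f w - f \<mu>)) (at \<mu>)"
proof -
  have lim: "((\<lambda>w. norm ((f w - f \<mu>) / (w - \<mu>))) \<longlongrightarrow> norm D) (at \<mu>)"
    using assms unfolding has_field_derivative_iff by (rule tendsto_norm)
  have ne: "eventually (\<lambda>w. w \<noteq> \<mu>) (at \<mu>)" by (simp add: eventually_at_filter)
  have "eventually (\<lambda>w. norm ((f w - f \<mu>) / (w - \<mu>)) < norm D + 1) (at \<mu>)"
    using order_tendstoD(2)[OF lim, of "norm D + 1"] by simp
  with ne show "eventually (\<lambda>w. norm (f w - f \<mu>) \<le> (norm D + 1) * norm (w - \<mu>)) (at \<mu>)"
    by eventually_elim (simp add: norm_divide field_simps)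
  assume "D \<noteq> 0"
  then have "eventually (\<lambda>w. norm D / 2 < norm ((f w - f \<mu>) / (w - \<mu>))) (at \<mu>)"
    using order_tendstoD(1)[OF lim, of "norm D / 2"] by simp
  with ne show "eventually (\<lambda>w. norm D / 2 * norm (w - \<mu>) \<le> norm (f w - f \<mu>)) (at \<mu>)"
    by eventually_elim (simp add: norm_divide field_simps)
qed

text \<open>Where \<open>f\<close> vanishes, the other factor need only be continuous. This suits
  the Gram integrals, for which only continuity has been established.\<close>

lemma DERIV_mult_vanishing:
  fixes f g :: "complex \<Rightarrow> complex"
  assumes "(f has_field_derivative D) (at \<mu>)" "f \<mu> = 0" "isCont g \<mu>"
  shows "((\<lambda>w. f w * g w) has_field_derivative D * g \<mu>) (at \<mu>)"
proof -
  obtain k where k: "\<And>z. f z - f \<mu> = k z * (z - \<mu>)" "isCont k \<mu>" "k \<mu> = D"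
    using assms(1) unfolding CARAT_DERIV by blast
  have "f z * g z - f \<mu> * g \<mu> = (k z * g z) * (z - \<mu>)" for z
    using k(1)[of z] assms(2) by simp
  moreover have "isCont (\<lambda>z. k z * g z) \<mu>" using k(2) assms(3) by (intro continuous_intros)
  ultimately show ?thesis
    unfolding CARAT_DERIV using k(3) by (intro exI[of _ "\<lambda>z. k z * g z"]) auto
qed

text \<open>A root larger than 3 B would exceed what the two lower-order terms can balance. It is
  applied to the difference between a multiplier and \<theta>(1).\<close>

lemma quadratic_root_bound:
  fixes u :: complex and B :: real
  assumes "u * u = b * u + c" "norm b \<le> 2 * B" "norm c \<le> B * B"
  shows "norm u \<le> 3 * B"
proof (rule ccontr)
  assume "\<not> norm u \<le> 3 * B"
  then have u: "3 * B < norm u" by simp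
  have B: "0 \<le> B" using assms(2) norm_ge_zero[of b] by linarith
  have "norm u * norm u = norm (b * u + c)" using assms(1) by (metis norm_mult)
  also have "\<dots> \<le> norm b * norm u + norm c" by (metis norm_mult norm_triangle_ineq)
  also have "\<dots> \<le> 2 * B * norm u + B * B" using assms by (intro add_mono mult_right_mono) auto
  also have "\<dots> \<le> 2 * B * norm u + B * norm u" using u B by (intro add_left_mono mult_left_mono) auto
  also have "\<dots> = 3 * B * norm u" by simp
  also have "\<dots> < norm u * norm u" using u B by (intro mult_strict_right_mono) auto
  finally show False by simp
qed

text \<open>The cosine is critical at 0 and pi; the half-angle formula turns the difference into 4
  sin^2((t - t0)/2), which gives both claims.\<close>

lemma abs_cos_diff_le:
  fixes t t0 :: real
  assumes "t0 = 0 \<or> t0 = pi"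
  shows "\<bar>2 * cos t - 2 * cos t0\<bar> \<le> (t - t0)\<^sup>2"
    and "\<lbrakk>t \<noteq> t0; \<bar>t - t0\<bar> < 2 * pi\<rbrakk> \<Longrightarrow> cos t \<noteq> cos t0"
proof -
  have c: "cos t = cos t0 * cos (t - t0)" using assms by (auto simp: cos_diff)
  have h: "cos (t - t0) = 1 - 2 * (sin ((t - t0) / 2))\<^sup>2"
  proof -
    have "2 * ((t - t0) / 2) = t - t0" by simp
    with cos_double_sin[of "(t - t0) / 2"] show ?thesis by metis
  qed
  have "2 * cos t - 2 * cos t0 = - (4 * cos t0) * (sin ((t - t0) / 2))\<^sup>2"
    unfolding c h by (simp add: algebra_simps)
  moreover have "\<bar>cos t0\<bar> = 1" using assms by auto
  ultimately have e: "\<bar>2 * cos t - 2 * cos t0\<bar> = 4 * (sin ((t - t0) / 2))\<^sup>2" by (simp add: abs_mult)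
  have "(sin ((t - t0) / 2))\<^sup>2 \<le> ((t - t0) / 2)\<^sup>2"
    using abs_sin_x_le_abs_x[of "(t - t0) / 2"] by (simp only: abs_le_square_iff)
  then show "\<bar>2 * cos t - 2 * cos t0\<bar> \<le> (t - t0)\<^sup>2" unfolding e by (simp add: power_divide)
  assume "t \<noteq> t0" "\<bar>t - t0\<bar> < 2 * pi"
  have m: "sin ((t0 - t) / 2) = - sin ((t - t0) / 2)"
    using sin_minus[of "(t - t0) / 2"] by (metis minus_diff_eq minus_divide_left)
  have "0 < sin (\<bar>t - t0\<bar> / 2)" using \<open>t \<noteq> t0\<close> \<open>\<bar>t - t0\<bar> < 2 * pi\<close> by (intro sin_gt_zero) auto
  then have "sin ((t - t0) / 2) \<noteq> 0" by (cases "0 \<le> t - t0") (use m in auto)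
  then show "cos t \<noteq> cos t0" using e by auto
qed

context hill_potential begin

section \<open>Behaviour near a multiple eigenvalue\<close>

text \<open>The formula for the modulus of \<alpha> as a function of the multipliers and of a free
  spectral parameter. It can be estimated in a full neighbourhood of a multiple eigenvalue before
  any branch \<open>lam n\<close> enters.\<close>

definition alpha_modulus :: "complex \<Rightarrow> complex \<Rightarrow> complex \<Rightarrow> real" where
  "alpha_modulus e e' \<mu> = norm (ph \<mu> 1 * F' \<mu>) / sqrt (bloch_norm2 e \<mu> * bloch_norm2 e' \<mu>)"

lemma continuous_on_bloch_norm2:
  assumes "continuous_on A f" "continuous_on A g"
  shows "continuous_on A (\<lambda>s. bloch_norm2 (f s) (g s))"
proof -
  have "continuous_on (A \<times> {0..1}) (\<lambda>p. (norm (bloch (f (fst p)) (g (fst p)) (snd p)))\<^sup>2)"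
    unfolding bloch_def
    by (intro continuous_intros continuous_on_theta continuous_on_phi
        continuous_on_compose2[OF assms(1)] continuous_on_compose2[OF assms(2)]) auto
  then show ?thesis unfolding bloch_norm2_def by (rule continuous_on_integral_param)
qed

lemma continuous_on_monodromy_compose:
  assumes "continuous_on A g"
  shows "continuous_on A (\<lambda>s. th (g s) 1)" "continuous_on A (\<lambda>s. ph (g s) 1)" "continuous_on A (\<lambda>s. F' (g s))"
  using continuous_on_compose2[OF continuous_on_monodromy(1) assms]
    continuous_on_compose2[OF continuous_on_monodromy(2) assms]
    continuous_on_compose2[OF continuous_on_F' assms] by auto

lemma isCont_gram: "isCont Itt \<mu>" "isCont Itp \<mu>" "isCont Ipp \<mu>"
  using continuous_on_gram by (auto simp: continuous_on_eq_continuous_at)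

text \<open>At a point with monodromy matrix \<open>\<sigma> I\<close> all entries of the monodromy matrix minus \<open>\<sigma> I\<close>, the
  off-diagonal one with a nonzero derivative, and \<open>F'\<close> vanish to first order, so that
  numerator and denominator of \<open>\<bar>\<alpha>\<bar>\<close> are both quadratic.\<close>

lemma alpha_modulus_bounded_below:
  assumes \<sigma>: "\<sigma> * \<sigma> = 1" and M: "th \<mu> 1 = \<sigma>" "ph1 \<mu> 1 = \<sigma>" "ph \<mu> 1 = 0" "th1 \<mu> 1 = 0"
      and nz: "Ipp \<mu> \<noteq> 0" "Itt \<mu> * Ipp \<mu> \<noteq> Itp \<mu> * Itp \<mu>"
  shows "\<exists>c>0. eventually (\<lambda>w. ph w 1 \<noteq> 0 \<and> F' w \<noteq> 0 \<and>
     (\<forall>e e'. e * e' = 1 \<longrightarrow> e + e' = F w \<longrightarrow> c \<le> alpha_modulus e e' w)) (at \<mu>)"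
proof -
  have \<sigma>0: "\<sigma> \<noteq> 0" using \<sigma> by auto
  note D = monodromy_derivative[of \<mu>, unfolded M]
  \<comment> \<open>The entries multiplying the Gram integrals vanish at \<mu>, so only they are
    differentiated. The result is -2 \<sigma> times the Gram determinant, which is nonzero by
    assumption.\<close>
  have dF: "(F' has_field_derivative - 2 * \<sigma> * (Itt \<mu> * Ipp \<mu> - Itp \<mu> * Itp \<mu>)) (at \<mu>)"
  proof -
    have 1: "((\<lambda>w. ph w 1 * Itt w) has_field_derivative - (0 * Itp \<mu> - \<sigma> * Ipp \<mu>) * Itt \<mu>) (at \<mu>)"
      by (rule DERIV_mult_vanishing[OF D(2) M(3) isCont_gram(1)])
    have 2: "((\<lambda>w. (ph1 w 1 - th w 1) * Itp w) has_field_derivative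
        (- (\<sigma> * Itp \<mu> - 0 * Ipp \<mu>) - - (0 * Itt \<mu> - \<sigma> * Itp \<mu>)) * Itp \<mu>) (at \<mu>)"
      by (rule DERIV_mult_vanishing[OF DERIV_diff[OF D(4) D(1)] _ isCont_gram(2)]) (simp add: M)
    have 3: "((\<lambda>w. th1 w 1 * Ipp w) has_field_derivative - (\<sigma> * Itt \<mu> - 0 * Itp \<mu>) * Ipp \<mu>) (at \<mu>)"
      by (rule DERIV_mult_vanishing[OF D(3) M(4) isCont_gram(3)])
    show ?thesis
      unfolding F'_def[abs_def]
      by (rule DERIV_cong[OF DERIV_minus[OF DERIV_diff[OF DERIV_add[OF 1 2] 3]]])
         (simp add: algebra_simps)
  qed
  have F'0: "F' \<mu> = 0" by (simp add: F'_def M)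
  define c1 where "c1 = norm (- (0 * Itp \<mu> - \<sigma> * Ipp \<mu>)) / 2"
  define c2 where "c2 = norm (- 2 * \<sigma> * (Itt \<mu> * Ipp \<mu> - Itp \<mu> * Itp \<mu>)) / 2"
  have c: "0 < c1" "0 < c2" using nz \<sigma>0 by (auto simp: c1_def c2_def)
  \<comment> \<open>A single constant dominating the first-order upper bounds of all four
    entries.\<close>
  define K where "K = (norm (- (0 * Itt \<mu> - \<sigma> * Itp \<mu>)) + 1) + (norm (- (0 * Itp \<mu> - \<sigma> * Ipp \<mu>)) + 1)
     + (norm (- (\<sigma> * Itt \<mu> - 0 * Itp \<mu>)) + 1) + (norm (- (\<sigma> * Itp \<mu> - 0 * Ipp \<mu>)) + 1)"
  have K: "0 < K" unfolding K_def by (smt (verit) norm_ge_zero)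
  have up: "norm X \<le> K * d" if "norm X \<le> Y * d" "Y \<le> K" "0 \<le> d" for X :: complex and Y d
    using that mult_right_mono[of Y K d] by linarith
  have comp: "compact ((\<lambda>p. th (fst p) (snd p)) ` (cball \<mu> 1 \<times> {0..1}))"
             "compact ((\<lambda>p. ph (fst p) (snd p)) ` (cball \<mu> 1 \<times> {0..1}))"
    by (intro compact_continuous_image continuous_on_theta continuous_on_phi continuous_intros
        compact_Times; auto)+
  obtain A1 where A1: "0 < A1" "\<And>w x. w \<in> cball \<mu> 1 \<Longrightarrow> x \<in> {0..1} \<Longrightarrow> norm (th w x) \<le> A1"
    using compact_imp_bounded[OF comp(1)] unfolding bounded_pos by auto
  obtain A2 where A2: "0 < A2" "\<And>w x. w \<in> cball \<mu> 1 \<Longrightarrow> x \<in> {0..1} \<Longrightarrow> norm (ph w x) \<le> A2"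
    using compact_imp_bounded[OF comp(2)] unfolding bounded_pos by auto
  define L where "L = K * A1 + 3 * K * A2"
  have L: "0 < L" using K A1 A2 by (simp add: L_def add_pos_pos)
  have "eventually (\<lambda>w. ph w 1 \<noteq> 0 \<and> F' w \<noteq> 0 \<and>
     (\<forall>e e'. e * e' = 1 \<longrightarrow> e + e' = F w \<longrightarrow> c1 * c2 / (L * L) \<le> alpha_modulus e e' w)) (at \<mu>)"
  proof -
    have "eventually (\<lambda>w. w \<in> ball \<mu> 1) (at \<mu>)"
      by (intro eventually_at_in_open') auto
    moreover have "eventually (\<lambda>w. w \<noteq> \<mu>) (at \<mu>)" by (simp add: eventually_at_filter)
    moreover have "eventually (\<lambda>w. c1 * norm (w - \<mu>) \<le> norm (ph w 1 - ph \<mu> 1)) (at \<mu>)"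
      using DERIV_norm_bounds(2)[OF D(2)] nz \<sigma>0 by (simp add: c1_def)
    moreover have "eventually (\<lambda>w. c2 * norm (w - \<mu>) \<le> norm (F' w - F' \<mu>)) (at \<mu>)"
      unfolding c2_def by (rule DERIV_norm_bounds(2)[OF dF]) (use nz \<sigma>0 in auto)
    moreover note DERIV_norm_bounds(1)[OF D(1)] DERIV_norm_bounds(1)[OF D(2)]
      DERIV_norm_bounds(1)[OF D(3)] DERIV_norm_bounds(1)[OF D(4)]
    ultimately show ?thesis
    proof eventually_elim
      case (elim w)
      let ?d = "norm (w - \<mu>)"
      have d: "0 < ?d" using elim(2) by simp
      have wc: "w \<in> cball \<mu> 1" using elim(1) by simp
      have p: "c1 * ?d \<le> norm (ph w 1)" using elim(3) M by simp
      have f: "c2 * ?d \<le> norm (F' w)" using elim(4) F'0 by simp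
      have pos: "0 < c1 * ?d" "0 < c2 * ?d" using c d by simp_all
      have b: "norm (th w 1 - \<sigma>) \<le> K * ?d" "norm (ph w 1) \<le> K * ?d"
              "norm (th1 w 1) \<le> K * ?d" "norm (ph1 w 1 - \<sigma>) \<le> K * ?d"
      proof -
        show "norm (th w 1 - \<sigma>) \<le> K * ?d" using elim(5) unfolding M by (rule up) (auto simp: K_def)
        show "norm (ph w 1) \<le> K * ?d" using elim(6) unfolding M diff_zero by (rule up) (auto simp: K_def)
        show "norm (th1 w 1) \<le> K * ?d" using elim(7) unfolding M diff_zero by (rule up) (auto simp: K_def)
        show "norm (ph1 w 1 - \<sigma>) \<le> K * ?d" using elim(8) unfolding M by (rule up) (auto simp: K_def)
      qed
      have bn: "0 \<le> bloch_norm2 e w \<and> bloch_norm2 e w \<le> (L * ?d) * (L * ?d)"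
        if e: "e * e + 1 = F w * e" for e
      proof -
        let ?u = "e - th w 1"
        \<comment> \<open>The characteristic equation shifted by \<theta>(1). Its coefficients are
          O(d) and O(d^2), with d the distance to \<mu>, so \<open>?u\<close> is O(d); the
          multiplier itself, which may branch at \<mu>, is not differentiated.\<close>
        have "?u * ?u = (ph1 w 1 - th w 1) * ?u + ph w 1 * th1 w 1"
        proof -
          have "e * e = (ph1 w 1 + th w 1) * e - 1" using e by (simp add: discriminant_eq algebra_simps)
          moreover have "th w 1 * ph1 w 1 = 1 + th1 w 1 * ph w 1"
            using wronskian[of w 1] by (simp add: algebra_simps)
          ultimately show ?thesis by (simp add: algebra_simps)
        qed
        moreover have "norm (ph1 w 1 - th w 1) \<le> 2 * (K * ?d)"
          using norm_triangle_ineq4[of "ph1 w 1 - \<sigma>" "th w 1 - \<sigma>"] b by simp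
        moreover have "norm (ph w 1 * th1 w 1) \<le> (K * ?d) * (K * ?d)"
          unfolding norm_mult using b K d by (intro mult_mono) auto
        ultimately have u: "norm ?u \<le> 3 * (K * ?d)" by (rule quadratic_root_bound)
        have bx: "norm (bloch e w x) \<le> L * ?d" if x: "x \<in> {0..1}" for x
        proof -
          have "norm (bloch e w x) \<le> norm (ph w 1) * norm (th w x) + norm ?u * norm (ph w x)"
            unfolding bloch_def by (metis norm_mult norm_triangle_ineq)
          also have "\<dots> \<le> (K * ?d) * A1 + (3 * (K * ?d)) * A2"
            using b(2) u A1(2)[OF wc x] A2(2)[OF wc x] K d by (intro add_mono mult_mono) auto
          finally show ?thesis by (simp add: L_def algebra_simps)
        qed
        have i: "(\<lambda>x. (norm (bloch e w x))\<^sup>2) integrable_on {0..1}"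
          by (intro integrable_continuous_real continuous_intros)
        have "bloch_norm2 e w \<le> integral {0..1} (\<lambda>x::real. (L * ?d)\<^sup>2)"
          unfolding bloch_norm2_def using bx
          by (intro Henstock_Kurzweil_Integration.integral_le i) (auto intro: power_mono)
        moreover have "0 \<le> bloch_norm2 e w" unfolding bloch_norm2_def
          by (intro Henstock_Kurzweil_Integration.integral_nonneg i) auto
        ultimately show ?thesis by (simp add: power2_eq_square)
      qed
      have "c1 * c2 / (L * L) \<le> alpha_modulus e e' w" if e: "e * e' = 1" "e + e' = F w" for e e'
      proof -
        have "e * e + 1 = F w * e" "e' * e' + 1 = F w * e'"
          using e by (auto simp: e(2)[symmetric] algebra_simps)
        note n = bn[OF this(1)] bn[OF this(2)]
        have p0: "ph w 1 \<noteq> 0" using p pos by auto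
        have "bloch_norm2 e w * bloch_norm2 e' w \<le> ((L * ?d) * (L * ?d)) * ((L * ?d) * (L * ?d))"
          using n L d by (intro mult_mono) auto
        also have "\<dots> = ((L * ?d) * (L * ?d))\<^sup>2" by (simp add: power2_eq_square)
        finally have "sqrt (bloch_norm2 e w * bloch_norm2 e' w) \<le> (L * ?d) * (L * ?d)"
          by (intro real_le_lsqrt) auto
        moreover have "0 < sqrt (bloch_norm2 e w * bloch_norm2 e' w)"
          using bloch_norm2_pos[OF p0] by simp
        moreover have "(c1 * ?d) * (c2 * ?d) \<le> norm (ph w 1 * F' w)"
          unfolding norm_mult using p f pos by (intro mult_mono) auto
        ultimately have "(c1 * ?d) * (c2 * ?d) / ((L * ?d) * (L * ?d)) \<le> alpha_modulus e e' w"
          unfolding alpha_modulus_def using pos by (intro frac_le) auto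
        \<comment> \<open>Numerator and denominator are both quadratic in the distance, which
          cancels.\<close>
        moreover have "(c1 * ?d) * (c2 * ?d) / ((L * ?d) * (L * ?d)) = c1 * c2 / (L * L)"
          using d L by (simp add: field_simps)
        ultimately show ?thesis by simp
      qed
      moreover have "ph w 1 \<noteq> 0" "F' w \<noteq> 0" using p f pos by auto
      ultimately show ?case by blast
    qed
  qed
  moreover have "0 < c1 * c2 / (L * L)" using c L by simp
  ultimately show ?thesis by blast
qed

end

section \<open>The numbered Bloch eigenvalues and the modulus of \<alpha> along them\<close>

locale hill_bloch = hill_potential +
  fixes lam :: "int \<Rightarrow> real \<Rightarrow> complex" and \<Psi> \<Psi>s :: "int \<Rightarrow> real \<Rightarrow> real \<Rightarrow> complex"
  assumes eigenvalues: "bloch_eigenvalues q lam"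
      and eigenfunctions: "bloch_eigenfunctions q lam \<Psi> \<Psi>s"
begin

abbreviation "\<alpha> \<equiv> bloch_alpha \<Psi> \<Psi>s"

text \<open>The index \<open>n\<close> belongs to the finite set whose cardinality is the
  multiplicity, so the multiplicity is positive.\<close>

lemma discriminant_lam: "F (lam n t) = 2 * cos (of_real t)"
proof -
  have "finite {m. lam m t = lam n t}"
    "card {m. lam m t = lam n t} = Lt_multiplicity q (of_real t) (lam n t)"
    using eigenvalues unfolding bloch_eigenvalues_def by blast+
  moreover have "n \<in> {m. lam m t = lam n t}" by simp
  ultimately have "0 < Lt_multiplicity q (of_real t) (lam n t)"
    by (metis card_gt_0_iff empty_iff)
  then show ?thesis by (rule multiplicity_pos_imp_root)
qed

lemma lam_even: "lam n (- t) = lam n t"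
  using eigenvalues unfolding bloch_eigenvalues_def by blast

lemma lam_periodic: "lam n (t + 2 * pi * of_int k) = lam n t"
proof -
  have p: "lam n (t + 2 * pi) = lam n t" for t
    using eigenvalues unfolding bloch_eigenvalues_def by blast
  have pn: "lam n (t + 2 * pi * real j) = lam n t" for t j
  proof (induction j)
    case (Suc j)
    have "t + 2 * pi * real (Suc j) = (t + 2 * pi * real j) + 2 * pi" by (simp add: algebra_simps)
    then show ?case using Suc p by metis
  qed simp
  show ?thesis
  proof (cases "0 \<le> k")
    case True
    then show ?thesis using pn[of t "nat k"] by simp
  next
    case False
    then show ?thesis using pn[of "t + 2 * pi * of_int k" "nat (- k)"] by simp
  qed
qed

text \<open>Evenness and periodicity reduce every t to [0, pi]. Since arccos (cos t) is continuous
  in t, continuity of \<open>lam n\<close> on [0, pi] then extends to the line.\<close>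

lemma lam_arccos_cos: "lam n t = lam n (arccos (cos t))"
proof -
  obtain k :: int where "t = arccos (cos t) + 2 * real_of_int k * pi \<or> t = - arccos (cos t) + 2 * real_of_int k * pi"
    using cos_eq_arccos_Ex[of t "cos t"] by blast
  then have "t = arccos (cos t) + 2 * pi * of_int k \<or> t = - arccos (cos t) + 2 * pi * of_int k"
    by (simp add: mult_ac)
  then show ?thesis using lam_periodic lam_even by metis
qed

lemma continuous_on_lam: "continuous_on UNIV (lam n)"
proof -
  have "lam n = (\<lambda>t. lam n (arccos (cos t)))" by (rule ext) (rule lam_arccos_cos)
  moreover have "continuous_on UNIV (\<lambda>t. lam n (arccos (cos t)))"
  proof -
    have 1: "continuous_on {0..pi} (lam n)" using eigenvalues unfolding bloch_eigenvalues_def by blast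
    have 2: "continuous_on UNIV (\<lambda>t::real. arccos (cos t))" by (intro continuous_intros) auto
    show ?thesis by (rule continuous_on_compose2[OF 1 2]) (auto simp: arccos_lbound arccos_ubound)
  qed
  ultimately show ?thesis by metis
qed

lemma norm_alpha:
  assumes "ph (lam n t) 1 \<noteq> 0"
  shows "norm (\<alpha> n t) = alpha_modulus (exp (\<i> * of_real t)) (exp (- (\<i> * of_real t))) (lam n t)"
  unfolding bloch_alpha_def alpha_modulus_def
  by (rule norm_bloch_alpha) (use eigenfunctions discriminant_lam assms in \<open>auto simp: bloch_eigenfunctions_def\<close>)

lemma alpha_modulus_pos:
  assumes "ph w 1 \<noteq> 0" "F' w \<noteq> 0"
  shows "0 < alpha_modulus e e' w"
  unfolding alpha_modulus_def using assms bloch_norm2_pos[OF assms(1)] by simp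

lemma not_multiple_quasimomentum:
  assumes "F' (lam n t) \<noteq> 0"
  shows "t \<notin> multiple_quasimomenta q lam n"
  using assms multiple_root_estimate(2)
  by (auto simp: multiple_quasimomenta_def Lt_multiple_eigenvalue_def)

lemma continuous_on_alpha_modulus_lam:
  assumes "\<And>t. t \<in> U \<Longrightarrow> ph (lam n t) 1 \<noteq> 0"
  shows "continuous_on U (\<lambda>t. alpha_modulus (exp (\<i> * of_real t)) (exp (- (\<i> * of_real t))) (lam n t))"
proof -
  have c: "continuous_on U (lam n)" using continuous_on_lam continuous_on_subset by blast
  have "bloch_norm2 e (lam n t) * bloch_norm2 e' (lam n t) \<noteq> 0" if "t \<in> U" for e e' t
    using bloch_norm2_pos[OF assms[OF that]] by (metis less_numeral_extra(3) mult_pos_pos)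
  then show ?thesis
    unfolding alpha_modulus_def
    by (intro continuous_intros continuous_on_bloch_norm2 continuous_on_monodromy_compose c) auto
qed

text \<open>Near t0 both \<phi>(1) and the norms of the Bloch solutions stay close to nonzero
  limits, so only F' decides. Its size is governed by 2 cos t - 2 cos t0, and of
  \<open>lam n\<close> only continuity is used.\<close>

lemma alpha_small_near_nondegenerate:
  assumes t0: "t0 = 0 \<or> t0 = pi" and n: "lam n t0 = \<mu>" and p: "ph \<mu> 1 \<noteq> 0"
      and m: "2 \<le> Lt_multiplicity q (of_real t0) \<mu>"
  obtains C where "0 < C" "eventually (\<lambda>t. F' (lam n t) \<noteq> 0 \<and> 0 < norm (\<alpha> n t) \<and> norm (\<alpha> n t) \<le> C * \<bar>t - t0\<bar>) (at t0)"
proof -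
  obtain C0 where C0: "eventually (\<lambda>w. (w \<noteq> \<mu> \<longrightarrow> F w \<noteq> 2 * cos (of_real t0) \<and> F' w \<noteq> 0) \<and>
           (norm (F' w))\<^sup>2 \<le> C0 * norm (F w - 2 * cos (of_real t0))) (nhds \<mu>)"
    using multiple_root_estimate(3)[OF m] by blast
  define C1 where "C1 = \<bar>C0\<bar> + 1"
  have C1: "0 < C1" "C0 \<le> C1" by (auto simp: C1_def)
  have lim: "(lam n \<longlongrightarrow> \<mu>) (at t0)"
    using continuous_on_lam[of n] unfolding continuous_on_def n[symmetric] by simp
  have ev1: "eventually (\<lambda>t. (lam n t \<noteq> \<mu> \<longrightarrow> F (lam n t) \<noteq> 2 * cos (of_real t0) \<and> F' (lam n t) \<noteq> 0) \<and>
           (norm (F' (lam n t)))\<^sup>2 \<le> C0 * norm (F (lam n t) - 2 * cos (of_real t0))) (at t0)"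
    using C0 lim by (rule eventually_compose_filterlim)
  let ?N = "\<lambda>t. sqrt (bloch_norm2 (exp (\<i> * of_real t)) (lam n t) * bloch_norm2 (exp (- (\<i> * of_real t))) (lam n t))"
  have cN: "isCont ?N t0" "isCont (\<lambda>t. norm (ph (lam n t) 1)) t0"
  proof -
    have "continuous_on UNIV ?N" "continuous_on UNIV (\<lambda>t. norm (ph (lam n t) 1))"
      by (intro continuous_intros continuous_on_bloch_norm2 continuous_on_monodromy_compose continuous_on_lam)+
    then show "isCont ?N t0" "isCont (\<lambda>t. norm (ph (lam n t) 1)) t0"
      by (simp_all add: continuous_on_eq_continuous_at)
  qed
  define N where "N = ?N t0"
  define P where "P = norm (ph \<mu> 1)"
  have N: "0 < N" unfolding N_def n using bloch_norm2_pos[OF p] by simp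
  have P: "0 < P" using p by (simp add: P_def)
  have "(?N \<longlongrightarrow> N) (at t0)" "((\<lambda>t. norm (ph (lam n t) 1)) \<longlongrightarrow> P) (at t0)"
    using cN n by (auto simp: isCont_def N_def P_def)
  then have ev2: "eventually (\<lambda>t. N / 2 < ?N t) (at t0)" "eventually (\<lambda>t. norm (ph (lam n t) 1) < 2 * P) (at t0)"
     "eventually (\<lambda>t. 0 < norm (ph (lam n t) 1)) (at t0)"
    using order_tendstoD(1)[of ?N N "at t0" "N / 2"] order_tendstoD(1)[of "\<lambda>t. norm (ph (lam n t) 1)" P "at t0" 0]
      order_tendstoD(2)[of "\<lambda>t. norm (ph (lam n t) 1)" P "at t0" "2 * P"] N P
    by simp_all
  have ev3: "eventually (\<lambda>t. t \<noteq> t0) (at t0)" by (simp add: eventually_at_filter)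
  have "eventually (\<lambda>t. t \<in> {t0 - 2 * pi<..<t0 + 2 * pi}) (at t0)"
    by (intro eventually_at_in_open') auto
  with ev1 ev2 ev3 have "eventually (\<lambda>t. F' (lam n t) \<noteq> 0 \<and> 0 < norm (\<alpha> n t) \<and>
      norm (\<alpha> n t) \<le> (2 * P * sqrt C1 / (N / 2)) * \<bar>t - t0\<bar>) (at t0)"
  proof eventually_elim
    case (elim t)
    have cc: "F (lam n t) - 2 * cos (of_real t0) = of_real (2 * cos t - 2 * cos t0)"
      by (simp add: discriminant_lam cos_of_real)
    have "cos t \<noteq> cos t0" using elim by (intro abs_cos_diff_le(2)[OF t0]) (auto simp: abs_less_iff)
    then have "lam n t \<noteq> \<mu>"
      using discriminant_lam[of n t] discriminant_lam[of n t0] n by (auto simp: cos_of_real)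
    then have F'0: "F' (lam n t) \<noteq> 0" using elim by blast
    have p0: "ph (lam n t) 1 \<noteq> 0" using elim by auto
    have "(norm (F' (lam n t)))\<^sup>2 \<le> C0 * norm (F (lam n t) - 2 * cos (of_real t0))" using elim by blast
    also have "\<dots> \<le> C1 * (t - t0)\<^sup>2"
      unfolding cc norm_of_real using abs_cos_diff_le(1)[OF t0, of t] C1 by (intro mult_mono) auto
    also have "\<dots> = (sqrt C1 * \<bar>t - t0\<bar>)\<^sup>2" using C1 by (simp add: power_mult_distrib)
    finally have f: "norm (F' (lam n t)) \<le> sqrt C1 * \<bar>t - t0\<bar>"
      by (rule power2_le_imp_le) (use C1 in simp)
    have "norm (\<alpha> n t) = norm (ph (lam n t) 1) * norm (F' (lam n t)) / ?N t"
      unfolding norm_alpha[OF p0] alpha_modulus_def norm_mult by simp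
    also have "\<dots> \<le> (2 * P) * (sqrt C1 * \<bar>t - t0\<bar>) / (N / 2)"
    proof -
      have "0 \<le> 2 * P * (sqrt C1 * \<bar>t - t0\<bar>)" using P C1 by simp
      then show ?thesis using f elim N P by (intro frac_le mult_mono) auto
    qed
    finally have "norm (\<alpha> n t) \<le> (2 * P * sqrt C1 / (N / 2)) * \<bar>t - t0\<bar>" by (simp add: mult_ac)
    moreover have "0 < norm (\<alpha> n t)" unfolding norm_alpha[OF p0] by (rule alpha_modulus_pos[OF p0 F'0])
    ultimately show ?case using F'0 by blast
  qed
  moreover have "0 < 2 * P * sqrt C1 / (N / 2)" using P C1 N by simp
  ultimately show ?thesis using that by blast
qed

end

text \<open>The primitive is a logarithm: integrals over intervals ending at distance \<eta> from t0
  would be bounded by \<open>I\<close>, but they grow without bound.\<close>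

lemma inverse_distance_not_integrable:
  fixes t0 \<delta> :: real
  assumes "0 < \<delta>"
  shows "\<not> (\<lambda>t. 1 / (t0 - t)) integrable_on {t0 - \<delta><..<t0}"
proof
  assume i: "(\<lambda>t. 1 / (t0 - t)) integrable_on {t0 - \<delta><..<t0}"
  define I where "I = integral {t0 - \<delta><..<t0} (\<lambda>t. 1 / (t0 - t))"
  have key: "ln (\<delta> / 2) - ln \<eta> \<le> I" if \<eta>: "0 < \<eta>" "\<eta> < \<delta> / 2" for \<eta>
  proof -
    have "((\<lambda>t. 1 / (t0 - t)) has_integral - ln (t0 - (t0 - \<eta>)) - - ln (t0 - (t0 - \<delta> / 2)))
        {t0 - \<delta> / 2..t0 - \<eta>}"
    proof (rule fundamental_theorem_of_calculus)
      show "t0 - \<delta> / 2 \<le> t0 - \<eta>" using \<eta> by simp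
      show "((\<lambda>t. - ln (t0 - t)) has_vector_derivative 1 / (t0 - x)) (at x within {t0 - \<delta> / 2..t0 - \<eta>})"
        if "x \<in> {t0 - \<delta> / 2..t0 - \<eta>}" for x
        unfolding has_real_derivative_iff_has_vector_derivative[symmetric]
        using that \<eta> by (auto intro!: derivative_eq_intros simp: field_simps)
    qed
    then have h: "((\<lambda>t. 1 / (t0 - t)) has_integral ln (\<delta> / 2) - ln \<eta>) {t0 - \<delta> / 2..t0 - \<eta>}" by simp
    have "integral {t0 - \<delta> / 2..t0 - \<eta>} (\<lambda>t. 1 / (t0 - t)) \<le> I"
      unfolding I_def using \<eta> h i
      by (intro integral_subset_le) (auto simp: has_integral_integrable)
    then show ?thesis using h by (simp add: integral_unique)
  qed
  \<comment> \<open>Chosen so that the integral between the distances \<delta>/2 and \<eta> equals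
    |I| + 1.\<close>
  define \<eta> where "\<eta> = \<delta> / 2 * exp (- (\<bar>I\<bar> + 1))"
  have "exp (- (\<bar>I\<bar> + 1)) < 1" by simp
  then have "0 < \<eta>" "\<eta> < \<delta> / 2"
    unfolding \<eta>_def using assms mult_strict_left_mono[of "exp (- (\<bar>I\<bar> + 1))" 1 "\<delta> / 2"] by auto
  moreover have "ln \<eta> = ln (\<delta> / 2) - (\<bar>I\<bar> + 1)"
    unfolding \<eta>_def using assms by (subst ln_mult) auto
  ultimately show False using key[of \<eta>] by linarith
qed

section \<open>Singular and regular behaviour at multiple eigenvalues\<close>

context hill_bloch begin

lemma multiple_eigenvalue_attained:
  assumes "Lt_multiple_eigenvalue q (of_real t) \<mu>"
  obtains n where "lam n t = \<mu>"
proof -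
  have "card {n. lam n t = \<mu>} = Lt_multiplicity q (of_real t) \<mu>"
    using eigenvalues unfolding bloch_eigenvalues_def by blast
  then have "{n. lam n t = \<mu>} \<noteq> {}"
    using assms unfolding Lt_multiple_eigenvalue_def by (metis card.empty not_numeral_le_zero)
  then show ?thesis using that by blast
qed

lemma essential_spectral_singularity_nondegenerate:
  assumes t0: "t0 = 0 \<or> t0 = pi" and m: "Lt_multiple_eigenvalue q (of_real t0) \<mu>" and p: "ph \<mu> 1 \<noteq> 0"
  shows "essential_spectral_singularity q lam \<alpha> \<mu>"
proof -
  have m2: "2 \<le> Lt_multiplicity q (of_real t0) \<mu>" using m by (simp add: Lt_multiple_eigenvalue_def)
  obtain y where y: "Lt_eigenfunction q (of_real t0) \<mu> y" using m by (auto simp: Lt_multiple_eigenvalue_def)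
  obtain n where n: "lam n t0 = \<mu>" using m by (rule multiple_eigenvalue_attained)
  have ex: "exp (\<i> * of_real (- t0)) = exp (\<i> * of_real t0)"
    using t0 by (auto simp: exp_minus exp_pi_i mult.commute)
  obtain C where C: "0 < C" "eventually (\<lambda>t. F' (lam n t) \<noteq> 0 \<and> 0 < norm (\<alpha> n t) \<and>
      norm (\<alpha> n t) \<le> C * \<bar>t - t0\<bar>) (at t0)"
    using alpha_small_near_nondegenerate[OF t0 n p m2] by blast
  then obtain d where d: "0 < d" "\<And>t. \<lbrakk>t \<noteq> t0; \<bar>t - t0\<bar> < d\<rbrakk> \<Longrightarrow> F' (lam n t) \<noteq> 0 \<and> 0 < norm (\<alpha> n t) \<and>
      norm (\<alpha> n t) \<le> C * \<bar>t - t0\<bar>"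
    unfolding eventually_at by (auto simp: dist_real_def)
  have "\<not> (\<lambda>t. 1 / norm (\<alpha> n t)) absolutely_integrable_on
      (({t0 - \<epsilon><..<t0 + \<epsilon>} \<union> {- t0 - \<epsilon><..<- t0 + \<epsilon>}) - multiple_quasimomenta q lam n)"
    if \<epsilon>: "0 < \<epsilon>" for \<epsilon>
  proof
    let ?S = "({t0 - \<epsilon><..<t0 + \<epsilon>} \<union> {- t0 - \<epsilon><..<- t0 + \<epsilon>}) - multiple_quasimomenta q lam n"
    assume i: "(\<lambda>t. 1 / norm (\<alpha> n t)) absolutely_integrable_on ?S"
    define \<delta> where "\<delta> = min d \<epsilon>"
    have \<delta>: "0 < \<delta>" "\<delta> \<le> d" "\<delta> \<le> \<epsilon>" using d \<epsilon> by (auto simp: \<delta>_def)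
    \<comment> \<open>A one-sided neighbourhood suffices; it avoids the excluded quasimomenta
      because F' is nonzero along it.\<close>
    have sub: "{t0 - \<delta><..<t0} \<subseteq> ?S"
      using \<delta> d(2) not_multiple_quasimomentum by (auto simp: abs_if)
    have i': "(\<lambda>t. 1 / norm (\<alpha> n t)) integrable_on {t0 - \<delta><..<t0}"
      using set_integrable_subset[OF i _ sub] absolutely_integrable_on_def by auto
    have "(\<lambda>t. 1 / (t0 - t)) absolutely_integrable_on {t0 - \<delta><..<t0}"
    proof (rule measurable_bounded_by_integrable_imp_absolutely_integrable)
      show "(\<lambda>t. 1 / (t0 - t)) \<in> borel_measurable (lebesgue_on {t0 - \<delta><..<t0})"
        by (intro continuous_imp_measurable_on_sets_lebesgue continuous_intros) auto
      show "(\<lambda>t. C * (1 / norm (\<alpha> n t))) integrable_on {t0 - \<delta><..<t0}"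
        using i' by (rule integrable_on_mult_right)
      show "norm (1 / (t0 - t)) \<le> C * (1 / norm (\<alpha> n t))" if t: "t \<in> {t0 - \<delta><..<t0}" for t
      proof -
        have "0 < norm (\<alpha> n t)" "norm (\<alpha> n t) \<le> C * (t0 - t)" using d(2)[of t] t \<delta> by auto
        then show ?thesis using t C(1) by (simp add: field_simps)
      qed
    qed auto
    then show False
      using inverse_distance_not_integrable[OF \<delta>(1)] absolutely_integrable_on_def by blast
  qed
  moreover have "t0 \<in> {-pi<..pi}" using t0 pi_gt_zero by auto
  ultimately show ?thesis
    unfolding essential_spectral_singularity_def
    using n eigenvalue_in_spectrum[OF y refl] eigenvalue_in_spectrum[OF y ex] by blast
qed

text \<open>Where F' is nonzero, F has a local holomorphic inverse G, and G(2 cos z) is an analytic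
  continuation of the merely continuous branch \<open>lam n\<close>.\<close>

lemma regular_arc_through:
  assumes t1: "0 < t1" "t1 < pi" and F': "F' (lam n t1) \<noteq> 0" and V: "open V" "lam n t1 \<in> V"
  obtains \<gamma> where "regular_spectral_arc q \<gamma>" "lam n t1 \<in> \<gamma>" "\<gamma> \<subseteq> V" "\<gamma> \<subseteq> lam n ` {0..pi}"
proof -
  let ?w = "lam n t1"
  obtain r where r: "0 < r" "ball ?w r \<subseteq> V" "open (F ` ball ?w r)" "inj_on F (ball ?w r)"
    using has_complex_derivative_locally_invertible[OF holomorphic_discriminant V(2,1)] F'
    unfolding deriv_discriminant by blast
  obtain G where G: "G holomorphic_on (F ` ball ?w r)"
     "\<And>z. z \<in> ball ?w r \<Longrightarrow> deriv F z * deriv G (F z) = 1" "\<And>z. z \<in> ball ?w r \<Longrightarrow> G (F z) = z"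
    using holomorphic_has_inverse[OF holomorphic_discriminant open_ball r(4)] by metis
  have "isCont (lam n) t1" using continuous_on_lam by (simp add: continuous_on_eq_continuous_at)
  then obtain d where d: "0 < d" "\<And>t. \<bar>t - t1\<bar> < d \<Longrightarrow> lam n t \<in> ball ?w r"
    using r(1) unfolding continuous_at_eps_delta
    by (metis dist_commute dist_norm mem_ball real_norm_def)
  \<comment> \<open>Small enough to stay inside (0, pi) and within the range where G inverts
    F.\<close>
  define \<eta> where "\<eta> = min (d / 2) (min (t1 / 2) ((pi - t1) / 2))"
  have \<eta>: "0 < \<eta>" "\<eta> < d" "\<eta> < t1" "\<eta> < pi - t1" using d t1 by (auto simp: \<eta>_def min_def)
  let ?I = "{t1 - \<eta>..t1 + \<eta>}"
  have I: "0 < t" "t < pi" "lam n t \<in> ball ?w r" if "t \<in> ?I" for t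
    using that \<eta> d(2)[of t] by (auto simp: abs_if)
  define l where "l z = G (2 * cos z)" for z
  have l: "l (of_real t) = lam n t" if "t \<in> ?I" for t
    using G(3)[OF I(3)[OF that]] by (simp add: l_def discriminant_lam)
  let ?U = "(\<lambda>z. 2 * cos z) -` (F ` ball ?w r)"
  have U: "open ?U" by (intro open_vimage r(3) continuous_intros)
  have hl: "l holomorphic_on ?U"
    unfolding l_def[abs_def]
    by (rule holomorphic_on_compose_gen[OF _ G(1), unfolded o_def]) (intro holomorphic_intros, auto)
  have IU: "of_real t \<in> ?U" if "t \<in> ?I" for t :: real
    using I(3)[OF that] discriminant_lam[of n t] by (metis imageI vimageI2)
  have "regular_spectral_arc q ((\<lambda>t. l (of_real t)) ` ?I)"
    unfolding regular_spectral_arc_def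
  proof (intro exI conjI ballI)
    show "t1 - \<eta> < t1 + \<eta>" using \<eta> by simp
    show "l analytic_on (of_real ` ?I)"
      unfolding analytic_on_holomorphic using U hl IU by blast
    fix t assume t: "t \<in> ?I"
    show "hill_discriminant q (l (of_real t)) = 2 * cos (of_real t)"
      using l[OF t] by (simp add: discriminant_lam)
    show "deriv (hill_discriminant q) (l (of_real t)) \<noteq> 0"
      using G(2)[OF I(3)[OF t]] unfolding l[OF t] by auto
  next
    fix t assume "t \<in> {t1 - \<eta><..<t1 + \<eta>}"
    then have t: "t \<in> ?I" by simp
    have FG: "deriv F (lam n t) * deriv G (2 * cos (of_real t)) = 1"
      using G(2)[OF I(3)[OF t]] by (simp add: discriminant_lam)
    have "2 * cos (of_real t) \<in> F ` ball ?w r" using IU[OF t] by simp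
    from holomorphic_derivI[OF G(1) r(3) this]
    have "(G has_field_derivative deriv G (2 * cos (of_real t))) (at (2 * cos (of_real t)))" .
    moreover have "((\<lambda>z. 2 * cos z) has_field_derivative 2 * - sin (of_real t)) (at (complex_of_real t))"
      by (auto intro!: derivative_eq_intros)
    ultimately have "(l has_field_derivative deriv G (2 * cos (of_real t)) * (2 * - sin (of_real t))) (at (of_real t))"
      unfolding l_def[abs_def] using DERIV_chain2[of G _ "\<lambda>z. 2 * cos z"] by blast
    then have "deriv l (of_real t) = deriv G (2 * cos (of_real t)) * (2 * - sin (of_real t))"
      by (rule DERIV_imp_deriv)
    \<comment> \<open>Here 0 < t < pi enters: the derivative of 2 cos vanishes at both ends.\<close>
    moreover have "sin (complex_of_real t) \<noteq> 0"
      using sin_gt_zero[OF I(1,2)[OF t]] by (simp add: sin_of_real)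
    ultimately show "deriv l (of_real t) \<noteq> 0" using FG by auto
  qed simp
  moreover have img: "(\<lambda>t. l (of_real t)) ` ?I = lam n ` ?I" using l by force
  moreover have "lam n t1 \<in> lam n ` ?I" using \<eta> by auto
  moreover have "lam n ` ?I \<subseteq> V" using I(3) r(2) by blast
  moreover have "lam n ` ?I \<subseteq> lam n ` {0..pi}"
    by (rule image_mono) (use \<eta> in auto)
  ultimately show ?thesis using that[of "lam n ` ?I"] by simp
qed

text \<open>A regular arc cannot contain \<mu>, where F' = 0, so short arcs are placed through
  points \<open>lam n t1\<close> with t1 tending to t0; one such point already makes the projection
  norm large.\<close>

lemma spectral_singularity_nondegenerate:
  assumes t0: "t0 = 0 \<or> t0 = pi" and m: "Lt_multiple_eigenvalue q (of_real t0) \<mu>" and p: "ph \<mu> 1 \<noteq> 0"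
  shows "spectral_singularity q lam \<alpha> \<mu>"
proof -
  have m2: "2 \<le> Lt_multiplicity q (of_real t0) \<mu>" using m by (simp add: Lt_multiple_eigenvalue_def)
  obtain y where y: "Lt_eigenfunction q (of_real t0) \<mu> y" using m by (auto simp: Lt_multiple_eigenvalue_def)
  obtain n where n: "lam n t0 = \<mu>" using m by (rule multiple_eigenvalue_attained)
  obtain C where C: "0 < C" "eventually (\<lambda>t. F' (lam n t) \<noteq> 0 \<and> 0 < norm (\<alpha> n t) \<and>
      norm (\<alpha> n t) \<le> C * \<bar>t - t0\<bar>) (at t0)"
    using alpha_small_near_nondegenerate[OF t0 n p m2] by blast
  have isC: "isCont (lam n) t0" using continuous_on_lam by (simp add: continuous_on_eq_continuous_at)
  have arc: "\<exists>\<gamma>. regular_spectral_arc q \<gamma> \<and> \<gamma> \<subseteq> lam n ` {0..pi} \<and> \<gamma> \<subseteq> ball \<mu> \<epsilon> \<and>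
      ereal (real k) \<le> spectral_projection_norm lam \<alpha> n \<gamma>" if \<epsilon>: "0 < \<epsilon>" for \<epsilon> k
  proof -
    have "(lam n \<longlongrightarrow> \<mu>) (at t0)" using isC n by (simp add: isCont_def)
    then have "eventually (\<lambda>t. dist (lam n t) \<mu> < \<epsilon>) (at t0)" using \<epsilon> by (rule tendstoD)
    with C(2) have "eventually (\<lambda>t. (F' (lam n t) \<noteq> 0 \<and> 0 < norm (\<alpha> n t) \<and>
      norm (\<alpha> n t) \<le> C * \<bar>t - t0\<bar>) \<and> dist (lam n t) \<mu> < \<epsilon>) (at t0)" by (rule eventually_conj)
    then obtain d where d: "0 < d" "\<And>t. \<lbrakk>t \<noteq> t0; \<bar>t - t0\<bar> < d\<rbrakk> \<Longrightarrow> F' (lam n t) \<noteq> 0 \<and> 0 < norm (\<alpha> n t) \<and>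
      norm (\<alpha> n t) \<le> C * \<bar>t - t0\<bar> \<and> dist (lam n t) \<mu> < \<epsilon>"
      unfolding eventually_at by (auto simp: dist_real_def)
    \<comment> \<open>The last entry gives norm (\<alpha> n t1) \<le> C h \<le> 1/(k+1); the entry 1
      keeps t1 inside (0, pi).\<close>
    define h where "h = min (d / 2) (min 1 (1 / (C * (real k + 1))))"
    have h: "0 < h" "h < d" "h \<le> 1" "h \<le> 1 / (C * (real k + 1))"
    proof -
      have "0 < 1 / (C * (real k + 1))" using C(1) by simp
      then show "0 < h" unfolding h_def using d(1) by simp
      have "h \<le> d / 2" unfolding h_def by (rule min.cobounded1)
      then show "h < d" using d(1) by simp
      show "h \<le> 1" "h \<le> 1 / (C * (real k + 1))" unfolding h_def by (simp_all only: min_le_iff_disj order_refl simp_thms)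
    qed
    define t1 where "t1 = (if t0 = 0 then h else pi - h)"
    have t1: "0 < t1" "t1 < pi" "t1 \<noteq> t0" "\<bar>t1 - t0\<bar> = h"
      using h t0 pi_gt3 by (auto simp: t1_def)
    note D = d(2)[OF t1(3), unfolded t1(4), OF h(2)]
    have "lam n t1 \<in> ball \<mu> \<epsilon>" using D by (simp add: dist_commute)
    then obtain \<gamma> where \<gamma>: "regular_spectral_arc q \<gamma>" "lam n t1 \<in> \<gamma>" "\<gamma> \<subseteq> ball \<mu> \<epsilon>" "\<gamma> \<subseteq> lam n ` {0..pi}"
      using regular_arc_through[OF t1(1,2) _ open_ball] D by metis
    have "real k \<le> inverse (norm (\<alpha> n t1))"
    proof -
      have "C * h \<le> C * (1 / (C * (real k + 1)))" using h C(1) by (intro mult_left_mono) auto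
      then have "norm (\<alpha> n t1) \<le> 1 / (real k + 1)" using D C(1) by simp
      moreover have "0 < norm (\<alpha> n t1)" using D by blast
      ultimately have "real k + 1 \<le> inverse (norm (\<alpha> n t1))" by (simp add: field_simps)
      then show ?thesis by simp
    qed
    then have "ereal (real k) \<le> inverse (ereal (norm (\<alpha> n t1)))" using D by simp
    also have "\<dots> \<le> spectral_projection_norm lam \<alpha> n \<gamma>"
      unfolding spectral_projection_norm_def using t1 \<gamma>(2) by (intro SUP_upper) auto
    finally show ?thesis using \<gamma> by blast
  qed
  have "\<exists>(\<gamma> :: nat \<Rightarrow> complex set) m.
        (\<forall>k. regular_spectral_arc q (\<gamma> k) \<and> \<gamma> k \<subseteq> lam (m k) ` {0..pi} \<and> \<gamma> k \<subseteq> ball \<mu> \<epsilon>) \<and>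
        (\<lambda>k. spectral_projection_norm lam \<alpha> (m k) (\<gamma> k)) \<longlonglongrightarrow> \<infinity>" if \<epsilon>: "0 < \<epsilon>" for \<epsilon>
  proof -
    obtain \<gamma> where \<gamma>: "\<And>k. regular_spectral_arc q (\<gamma> k) \<and> \<gamma> k \<subseteq> lam n ` {0..pi} \<and> \<gamma> k \<subseteq> ball \<mu> \<epsilon> \<and>
      ereal (real k) \<le> spectral_projection_norm lam \<alpha> n (\<gamma> k)"
      using arc[OF \<epsilon>] by metis
    have "(\<lambda>k. spectral_projection_norm lam \<alpha> n (\<gamma> k)) \<longlonglongrightarrow> \<infinity>"
      unfolding Lim_PInfty
    proof
      fix r
      obtain N :: nat where "r \<le> real N" using real_arch_simple by blast
      then have "ereal r \<le> spectral_projection_norm lam \<alpha> n (\<gamma> k)" if "N \<le> k" for k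
        using \<gamma>[of k] that by (meson ereal_less_eq(3) of_nat_le_iff order_trans)
      then show "\<exists>N. \<forall>k\<ge>N. ereal r \<le> spectral_projection_norm lam \<alpha> n (\<gamma> k)" by blast
    qed
    then show ?thesis using \<gamma> by (intro exI[of _ \<gamma>] exI[of _ "\<lambda>_. n"]) auto
  qed
  moreover have "\<mu> \<in> hill_spectrum q"
    unfolding hill_spectrum_def using eigenvalue_in_spectrum[OF y refl] t0 pi_gt_zero
    by (intro UN_I[of t0]) auto
  ultimately show ?thesis unfolding spectral_singularity_def by blast
qed

lemma degenerate_not_singular:
  assumes t0: "t0 = 0 \<or> t0 = pi" and m: "Lt_multiple_eigenvalue q (of_real t0) \<mu>"
      and M: "th \<mu> 1 = of_real (cos t0)" "ph1 \<mu> 1 = of_real (cos t0)" "ph \<mu> 1 = 0" "th1 \<mu> 1 = 0"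
      and nz: "Ipp \<mu> \<noteq> 0" "Itt \<mu> * Ipp \<mu> \<noteq> Itp \<mu> * Itp \<mu>"
  shows "\<not> spectral_singularity q lam \<alpha> \<mu>" "\<not> essential_spectral_singularity q lam \<alpha> \<mu>"
proof -
  have m2: "2 \<le> Lt_multiplicity q (of_real t0) \<mu>" using m by (simp add: Lt_multiple_eigenvalue_def)
  have F\<mu>: "F \<mu> = 2 * cos (of_real t0)" and F'\<mu>: "F' \<mu> = 0" using multiple_root_estimate[OF m2] by auto
  have "cos t0 * cos t0 = 1" using t0 by auto
  then have "complex_of_real (cos t0) * of_real (cos t0) = 1" by (metis of_real_1 of_real_mult)
  from alpha_modulus_bounded_below[OF this M nz]
  obtain c where c: "0 < c" and "eventually (\<lambda>w. ph w 1 \<noteq> 0 \<and> F' w \<noteq> 0 \<and>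
     (\<forall>e e'. e * e' = 1 \<longrightarrow> e + e' = F w \<longrightarrow> c \<le> alpha_modulus e e' w)) (at \<mu>)" by blast
  then obtain r where r: "0 < r" "\<And>w. \<lbrakk>w \<noteq> \<mu>; dist w \<mu> < r\<rbrakk> \<Longrightarrow> ph w 1 \<noteq> 0 \<and> F' w \<noteq> 0 \<and>
     (\<forall>e e'. e * e' = 1 \<longrightarrow> e + e' = F w \<longrightarrow> c \<le> alpha_modulus e e' w)"
    unfolding eventually_at by auto
  have low: "ph (lam n t) 1 \<noteq> 0" "F' (lam n t) \<noteq> 0" "c \<le> norm (\<alpha> n t)"
    if "lam n t \<noteq> \<mu>" "dist (lam n t) \<mu> < r" for n t
  proof -
    show p: "ph (lam n t) 1 \<noteq> 0" and "F' (lam n t) \<noteq> 0" using r(2)[OF that] by blast+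
    show "c \<le> norm (\<alpha> n t)"
      using r(2)[OF that] exp_quasimomentum[of "of_real t"] discriminant_lam[of n t]
      unfolding norm_alpha[OF p] by auto
  qed
  show "\<not> spectral_singularity q lam \<alpha> \<mu>"
  proof
    assume "spectral_singularity q lam \<alpha> \<mu>"
    then obtain \<gamma> :: "nat \<Rightarrow> complex set" and m where
      \<gamma>: "\<And>k. regular_spectral_arc q (\<gamma> k)" "\<And>k. \<gamma> k \<subseteq> ball \<mu> r"
      and lim: "(\<lambda>k. spectral_projection_norm lam \<alpha> (m k) (\<gamma> k)) \<longlonglongrightarrow> \<infinity>"
      unfolding spectral_singularity_def using r(1) by metis
    have "spectral_projection_norm lam \<alpha> (m k) (\<gamma> k) \<le> ereal (1 / c)" for k
      unfolding spectral_projection_norm_def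
    proof (rule SUP_least)
      fix t assume "t \<in> {t \<in> {-pi<..pi}. lam (m k) t \<in> \<gamma> k}"
      then have t: "lam (m k) t \<in> \<gamma> k" by simp
      \<comment> \<open>A regular arc never meets \<mu>, so the lower bound on the punctured
        neighbourhood holds along the whole arc.\<close>
      have "F' (lam (m k) t) \<noteq> 0"
        using \<gamma>(1)[of k] t unfolding regular_spectral_arc_def deriv_discriminant by auto
      then have "lam (m k) t \<noteq> \<mu>" using F'\<mu> by auto
      moreover have "dist (lam (m k) t) \<mu> < r" using \<gamma>(2)[of k] t by (auto simp: dist_commute)
      ultimately have "c \<le> norm (\<alpha> (m k) t)" by (rule low(3))
      then show "inverse (ereal (norm (\<alpha> (m k) t))) \<le> ereal (1 / c)"
        using c by (auto simp: field_simps)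
    qed
    moreover have "eventually (\<lambda>k. ereal (1 / c) < spectral_projection_norm lam \<alpha> (m k) (\<gamma> k)) sequentially"
      using order_tendstoD(1)[OF lim, of "ereal (1 / c)"] by simp
    ultimately show False by (auto simp: eventually_sequentially not_less[symmetric])
  qed
  show "\<not> essential_spectral_singularity q lam \<alpha> \<mu>"
  proof
    assume "essential_spectral_singularity q lam \<alpha> \<mu>"
    then obtain s n where s: "s \<in> {-pi<..pi}" "\<mu> = lam n s"
      and ni: "\<And>\<epsilon>. 0 < \<epsilon> \<Longrightarrow> \<not> (\<lambda>t. 1 / norm (\<alpha> n t)) absolutely_integrable_on
         (({s - \<epsilon><..<s + \<epsilon>} \<union> {- s - \<epsilon><..<- s + \<epsilon>}) - multiple_quasimomenta q lam n)"
      unfolding essential_spectral_singularity_def by blast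
    have "cos s = cos t0"
      using discriminant_lam[of n s] F\<mu> s(2) by (simp add: cos_of_real)
    \<comment> \<open>The period is half-open, so within it the cosine determines s even when t0 =
      pi.\<close>
    then have st: "s = t0"
    proof -
      have a: "\<bar>s - t0\<bar> < 2 * pi" using s(1) t0 pi_gt_zero by auto
      show ?thesis using abs_cos_diff_le(2)[OF t0 _ a] \<open>cos s = cos t0\<close> by blast
    qed
    have isC: "isCont (lam n) x" for x using continuous_on_lam by (simp add: continuous_on_eq_continuous_at)
    then obtain d where d: "0 < d" "\<And>t. \<bar>t - t0\<bar> < d \<Longrightarrow> dist (lam n t) \<mu> < r"
      using r(1) s(2) st unfolding continuous_at_eps_delta by (metis dist_norm real_norm_def)
    define \<epsilon> where "\<epsilon> = min d 1"
    have \<epsilon>: "0 < \<epsilon>" "\<epsilon> \<le> d" "\<epsilon> \<le> 1" using d by (auto simp: \<epsilon>_def)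
    let ?S = "{t0 - \<epsilon><..<t0 + \<epsilon>} \<union> {- t0 - \<epsilon><..<- t0 + \<epsilon>}"
    \<comment> \<open>At the removed points \<open>lam n\<close> equals \<mu> and nothing is known
      about \<alpha>; two points do not affect integrability.\<close>
    let ?U = "?S - {t0, - t0}"
    have near: "dist (lam n t) \<mu> < r" "lam n t \<noteq> \<mu>" if t: "t \<in> ?U" for t
    proof -
      \<comment> \<open>\<open>lam n\<close> is even, so points near -t0 are reflected to points
        near t0.\<close>
      obtain t' where t': "t' = t \<or> t' = - t" "\<bar>t' - t0\<bar> < \<epsilon>" "t' \<noteq> t0"
      proof (cases "\<bar>t - t0\<bar> < \<epsilon>")
        case True
        then show ?thesis using that[of t] t by auto
      next
        case False
        then have "\<bar>- t - t0\<bar> < \<epsilon>" using t by (auto simp: abs_if split: if_splits)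
        then show ?thesis using that[of "- t"] t by auto
      qed
      have l: "lam n t = lam n t'" using t'(1) lam_even by auto
      show "dist (lam n t) \<mu> < r" unfolding l using d(2) t' \<epsilon> by auto
      have "cos t' \<noteq> cos t0" using t' \<epsilon> pi_gt3 by (intro abs_cos_diff_le(2)[OF t0]) auto
      then show "lam n t \<noteq> \<mu>"
        unfolding l using discriminant_lam[of n t'] F\<mu> by (auto simp: cos_of_real)
    qed
    let ?f = "\<lambda>t. 1 / norm (\<alpha> n t)"
    \<comment> \<open>The eigenfunctions are chosen separately for each t, so measurability is not
      evident for \<open>?f\<close>; \<open>?g\<close> agrees with it on \<open>?U\<close> and is
      continuous there.\<close>
    let ?g = "\<lambda>t. 1 / alpha_modulus (exp (\<i> * of_real t)) (exp (- (\<i> * of_real t))) (lam n t)"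
    have U: "open ?U"
      by (intro open_Diff open_Un open_greaterThanLessThan finite_imp_closed) auto
    have fg: "?f t = ?g t" if "t \<in> ?U" for t
      using norm_alpha[OF low(1)[OF near(2)[OF that] near(1)[OF that]]] by simp
    have "?g absolutely_integrable_on ?U"
    proof (rule measurable_bounded_by_integrable_imp_absolutely_integrable)
      have "alpha_modulus e e' (lam n t) \<noteq> 0" if "t \<in> ?U" for e e' t
        using alpha_modulus_pos[OF low(1,2)] near[OF that] by (metis less_irrefl)
      then have "continuous_on ?U ?g"
        using low(1) near
        by (intro continuous_on_divide continuous_on_const continuous_on_alpha_modulus_lam) auto
      then show "?g \<in> borel_measurable (lebesgue_on ?U)"
        using U by (intro continuous_imp_measurable_on_sets_lebesgue) auto
      show "?U \<in> sets lebesgue" using U by auto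
      have "bounded ?U" by (rule bounded_subset[of "{- (\<bar>t0\<bar> + 2)..\<bar>t0\<bar> + 2}"]) (use \<epsilon> in auto)
      then have "?U \<in> lmeasurable" using U by (simp add: lmeasurable_open)
      then show "(\<lambda>t::real. 1 / c) integrable_on ?U" by (rule integrable_on_const)
      show "norm (?g t) \<le> 1 / c" if "t \<in> ?U" for t
      proof -
        have "c \<le> alpha_modulus (exp (\<i> * of_real t)) (exp (- (\<i> * of_real t))) (lam n t)"
          using low(3)[OF near(2)[OF that] near(1)[OF that]]
            norm_alpha[OF low(1)[OF near(2)[OF that] near(1)[OF that]]] by simp
        then show ?thesis using c by (simp add: frac_le)
      qed
    qed
    then have "?f absolutely_integrable_on ?U"
      by (rule absolutely_integrable_spike[OF _ negligible_empty]) (use fg in auto)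
    then have "?f absolutely_integrable_on (?S - multiple_quasimomenta q lam n)"
    proof (rule absolutely_integrable_spike_set)
      have "?U \<inter> multiple_quasimomenta q lam n = {}"
        using not_multiple_quasimomentum low(2)[OF near(2) near(1)] by blast
      then show "negligible {t \<in> ?U - (?S - multiple_quasimomenta q lam n). ?f t \<noteq> 0}"
        by (intro negligible_subset[OF negligible_empty]) blast
      show "negligible {t \<in> (?S - multiple_quasimomenta q lam n) - ?U. ?f t \<noteq> 0}"
        by (rule negligible_subset[of "{t0, - t0}"]) auto
    qed
    then show False using ni[OF \<epsilon>(1)] unfolding st by blast
  qed
qed

text \<open>A single dichotomy decides everything: all the statements hold if \<phi>(1) \<noteq> 0
  and all fail if \<phi>(1) = 0.\<close>

lemma characterization:
  assumes nd: "Itt \<mu> \<noteq> 0 \<and> Ipp \<mu> \<noteq> 0 \<and> Itt \<mu> * Ipp \<mu> \<noteq> Itp \<mu> * Itp \<mu>"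
      and t0: "t0 = 0 \<or> t0 = pi" and m: "Lt_multiple_eigenvalue q (of_real t0) \<mu>"
  shows "(essential_spectral_singularity q lam \<alpha> \<mu> \<longleftrightarrow> spectral_singularity q lam \<alpha> \<mu>) \<and>
       (spectral_singularity q lam \<alpha> \<mu> \<longleftrightarrow> Lt_geometric_multiplicity q (of_real t0) \<mu> = 1) \<and>
       (Lt_geometric_multiplicity q (of_real t0) \<mu> = 1
          \<longleftrightarrow> one_eigenfunction_one_associated q (of_real t0) \<mu>) \<and>
       (Lt_geometric_multiplicity q (of_real t0) \<mu> = 1
          \<longleftrightarrow> \<not> dirichlet_eigenvalue q \<mu> \<and> \<not> neumann_eigenvalue q \<mu>) \<and>
       (\<not> dirichlet_eigenvalue q \<mu> \<and> \<not> neumann_eigenvalue q \<mu>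
          \<longleftrightarrow> phi q \<mu> 1 \<noteq> 0 \<and> vector_derivative (theta q \<mu>) (at 1) \<noteq> 0)"
proof -
  let ?\<sigma> = "complex_of_real (cos t0)"
  have m2: "2 \<le> Lt_multiplicity q (of_real t0) \<mu>" using m by (simp add: Lt_multiple_eigenvalue_def)
  have F: "F \<mu> = 2 * ?\<sigma>" and F': "F' \<mu> = 0"
    using multiple_root_estimate(1,2)[OF m2] by (auto simp: cos_of_real)
  have "cos t0 * cos t0 = 1" using t0 by auto
  then have \<sigma>: "?\<sigma> * ?\<sigma> = 1" by (metis of_real_1 of_real_mult)
  have e: "exp (\<i> * of_real t0) = ?\<sigma>" using t0 by (auto simp: exp_pi_i mult.commute)
  have deg: "ph \<mu> 1 = 0 \<longleftrightarrow> th1 \<mu> 1 = 0" using degenerate_iff[OF F \<sigma> F'] nd by blast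
  show ?thesis
  proof (cases "ph \<mu> 1 = 0")
    case False
    then show ?thesis
      using deg essential_spectral_singularity_nondegenerate[OF t0 m False]
        spectral_singularity_nondegenerate[OF t0 m False] geometric_multiplicity_eq_1[OF F \<sigma> e False]
        one_eigenfunction_one_associatedI[OF F \<sigma> F' e False]
        dirichlet_eigenvalue_iff neumann_eigenvalue_iff by simp
  next
    case True
    then have M: "th \<mu> 1 = ?\<sigma>" "ph1 \<mu> 1 = ?\<sigma>" "ph \<mu> 1 = 0" "th1 \<mu> 1 = 0"
      using unipotent_monodromy[OF F \<sigma>] deg by auto
    show ?thesis
      using M degenerate_not_singular[OF t0 m M] nd geometric_multiplicity_ne_1[OF e M(3,4,1,2)]
        not_one_eigenfunction_one_associated[OF e M(3,4,1,2)]
        dirichlet_eigenvalue_iff neumann_eigenvalue_iff by simp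
  qed
qed

end

theorem theorem2:
  fixes q :: "real \<Rightarrow> complex"
  assumes periodic: "\<And>x. q (x + 1) = q x"
    and integrable: "q absolutely_integrable_on {0..1}"
    and mean_zero: "integral {0..1} q = 0"
  shows "\<exists>R>0. \<forall>lam \<Psi> \<Psi>s.
    bloch_eigenvalues q lam \<and> bloch_eigenfunctions q lam \<Psi> \<Psi>s \<longrightarrow>
    (\<forall>t\<in>{0, pi}. \<forall>\<mu>. Lt_multiple_eigenvalue q (of_real t) \<mu> \<and> norm \<mu> > R \<longrightarrow>
       (essential_spectral_singularity q lam (bloch_alpha \<Psi> \<Psi>s) \<mu>
          \<longleftrightarrow> spectral_singularity q lam (bloch_alpha \<Psi> \<Psi>s) \<mu>) \<and>
       (spectral_singularity q lam (bloch_alpha \<Psi> \<Psi>s) \<mu>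
          \<longleftrightarrow> Lt_geometric_multiplicity q (of_real t) \<mu> = 1) \<and>
       (Lt_geometric_multiplicity q (of_real t) \<mu> = 1
          \<longleftrightarrow> one_eigenfunction_one_associated q (of_real t) \<mu>) \<and>
       (Lt_geometric_multiplicity q (of_real t) \<mu> = 1
          \<longleftrightarrow> \<not> dirichlet_eigenvalue q \<mu> \<and> \<not> neumann_eigenvalue q \<mu>) \<and>
       (\<not> dirichlet_eigenvalue q \<mu> \<and> \<not> neumann_eigenvalue q \<mu>
          \<longleftrightarrow> phi q \<mu> 1 \<noteq> 0 \<and> vector_derivative (theta q \<mu>) (at 1) \<noteq> 0))"
proof -
  interpret hill_potential q by unfold_locales (fact periodic integrable)+
  \<comment> \<open>\<open>R\<close> is obtained from \<open>q\<close> alone, before a numbering and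
    eigenfunctions are fixed.\<close>
  obtain R where R: "0 < R" "\<And>\<mu>. R < norm \<mu> \<Longrightarrow> F \<mu> = 2 \<or> F \<mu> = - 2 \<Longrightarrow>
    Itt \<mu> \<noteq> 0 \<and> Ipp \<mu> \<noteq> 0 \<and> Itt \<mu> * Ipp \<mu> \<noteq> Itp \<mu> * Itp \<mu>"
    using gram_nondegenerate by blast
  show ?thesis
  proof (rule exI[of _ R], rule conjI[OF R(1)], intro allI impI ballI, elim conjE, goal_cases)
    case (1 lam \<Psi> \<Psi>s t \<mu>)
    interpret hill_bloch q lam \<Psi> \<Psi>s by unfold_locales (fact 1)+
    have t: "t = 0 \<or> t = pi" using 1 by simp
    have m: "Lt_multiple_eigenvalue q (of_real t) \<mu>" and \<mu>: "R < norm \<mu>" using 1 by blast+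
    have "F \<mu> = 2 * cos (of_real t)"
      using m multiple_root_estimate(1) by (simp add: Lt_multiple_eigenvalue_def)
    then have "F \<mu> = 2 \<or> F \<mu> = - 2" using t by (auto simp: cos_of_real)
    from characterization[OF R(2)[OF \<mu> this] t m] show ?case .
  qed
qed

end
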